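(* For any positive integer $n$ and $0\le j\le n$, the triple $\left(\widetilde{\mathtt{Code}}_{n,j-1},\,C_n,\,\widetilde{a}_{n,j}(q)\right)$ exhibits the cyclic sieving phenomenon.
   Context: Cyclic sieving phenomenon: let $C=\langle c\rangle$ be a finite cyclic group acting on a finite set $X$, let $X(q)$ be a polynomial with nonnegative integer coefficients, and let $\omega=e^{2\pi i/|C|}$. The triple $(X,C,X(q))$ exhibits the cyclic sieving phenomenon if $|\{x\in X:c^r\cdot x=x\}|=X(\omega^r)$ for all $r\ge0$. $C_n=\langle c_n\rangle\le\mathfrak{S}_n$ with $c_n=(1\,2\,\cdots\,n)$. An extended code of length $n$ is a pair $(\alpha,f)$ where $\alpha=\alpha_1\cdots\alpha_n$ is a sequence over $\{0,1,2,\dots\}\cup\{\infty\}$ such that, with $m(\alpha)$ the maximum finite number appearing in $\alpha$ (taken as $0$ if there is none), each $k\in\{1,\dots,m(\alpha)\}$ occurs at least twice in $\alpha$; and for each such $k$ exactly one occurrence of $k$ other than the first is marked, with $f(k)$ the number of occurrences of $k$ to the left of the marked one (so $1\le f(k)\le(\text{number of occurrences of }k)-1$). The letters $0$ and $\infty$ may occur any number of times. The index is $\mathrm{ind}(\alpha,f)=-1$ if $\alpha=\infty\cdots\infty$ and $\mathrm{ind}(\alpha,f)=\sum_{k=1}^{m(\alpha)}f(k)$ otherwise. $\widetilde{\mathtt{Code}}_{n,j}$ is the set of extended codes of length $n$ and index $j$. $C_n$ acts by $\sigma\cdot(\alpha_1\cdots\alpha_n,f)=(\alpha_{\sigma(1)}\cdots\alpha_{\sigma(n)},f)$.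 $\widetilde a_{n,j}(q)$ is the coefficient of $t^j$ in the $q$-binomial Eulerian polynomial $\widetilde A_n(q,t)=1+t\sum_{k=1}^n\begin{bmatrix}n\\k\end{bmatrix}_qA_k(q,t)$, where $A_k(q,t)=\sum_{\sigma\in\mathfrak S_k}q^{\mathrm{maj}(\sigma)-\mathrm{exc}(\sigma)}t^{\mathrm{exc}(\sigma)}$, $\mathrm{maj}(\sigma)=\sum_{i:\sigma_i>\sigma_{i+1}}i$, $\mathrm{exc}(\sigma)=|\{i:\sigma_i>i\}|$, and $\begin{bmatrix}n\\k\end{bmatrix}_q$ is the $q$-binomial coefficient. *)

theory Defs
  imports
    "HOL-Analysis.Analysis"
    "HOL-Computational_Algebra.Polynomial"
    "HOL-Library.Extended_Nat"
    "HOL-Algebra.Sym_Groups"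
    "HOL-Algebra.Group_Action"
begin

section \<open>Cyclic sieving\<close>

text \<open>
  The group \<open>C\<close> comes with a chosen generator \<open>c\<close>. The raw action \<open>\<phi>\<close> is restricted to \<open>X\<close>
  because \<^const>\<open>BijGroup\<close> only contains functions that are \<^const>\<open>undefined\<close> outside \<open>X\<close>.
\<close>

definition cyclic_sieving ::
  "'x set \<Rightarrow> ('g, 'm) monoid_scheme \<Rightarrow> 'g \<Rightarrow> ('g \<Rightarrow> 'x \<Rightarrow> 'x) \<Rightarrow> int poly \<Rightarrow> bool"
  where "cyclic_sieving X C c \<phi> p \<longleftrightarrow>
    group C \<and> finite (carrier C) \<and> c \<in> carrier C \<and> generate C {c} = carrier C \<and>
    finite X \<and> group_action C X (\<lambda>g. restrict (\<phi> g) X) \<and>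
    (\<forall>i. coeff p i \<ge> 0) \<and>
    (let \<omega> = exp (2 * complex_of_real pi * \<i> / of_nat (card (carrier C))) in
      \<forall>r::nat. of_nat (card {x \<in> X. \<phi> (c [^]\<^bsub>C\<^esub> r) x = x}) =
        poly (map_poly of_int p) (\<omega> ^ r))"

definition long_cycle :: "nat \<Rightarrow> nat \<Rightarrow> nat"
  where "long_cycle n = cycle_of_list [1..<Suc n]"

definition cyc_group :: "nat \<Rightarrow> (nat \<Rightarrow> nat) monoid"
  where "cyc_group n = subgroup_generated (sym_group n) {long_cycle n}"


section \<open>Extended codes\<close>

text \<open>
  A sequence \<open>\<alpha>\<^sub>1 \<dots> \<alpha>\<^sub>n\<close> is a function on \<open>{1..n}\<close>, extended by \<^const>\<open>undefined\<close>; likewise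
  \<open>f\<close> is a function on \<open>{1..m(\<alpha>)}\<close>, so that equality of codes is equality of pairs.
\<close>

definition max_letter :: "nat \<Rightarrow> (nat \<Rightarrow> enat) \<Rightarrow> nat"
  where "max_letter n \<alpha> = Max (insert 0 {k. enat k \<in> \<alpha> ` {1..n}})"

definition occs :: "nat \<Rightarrow> (nat \<Rightarrow> enat) \<Rightarrow> nat \<Rightarrow> nat set"
  where "occs n \<alpha> k = {i \<in> {1..n}. \<alpha> i = enat k}"

text \<open>
  \<open>p\<close> is the position of the marked occurrence of \<open>k\<close>; it is not the first one.
  The mark is recorded only through \<open>f k\<close>, which determines \<open>p\<close>.
\<close>

definition is_code :: "nat \<Rightarrow> (nat \<Rightarrow> enat) \<times> (nat \<Rightarrow> nat) \<Rightarrow> bool"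
  where "is_code n = (\<lambda>(\<alpha>, f).
    \<alpha> \<in> extensional {1..n} \<and> f \<in> extensional {1..max_letter n \<alpha>} \<and>
    (\<forall>k\<in>{1..max_letter n \<alpha>}.
      card (occs n \<alpha> k) \<ge> 2 \<and>
      (\<exists>p\<in>occs n \<alpha> k. (\<exists>i\<in>occs n \<alpha> k. i < p) \<and> f k = card {i \<in> occs n \<alpha> k. i < p})))"

definition code_index :: "nat \<Rightarrow> (nat \<Rightarrow> enat) \<times> (nat \<Rightarrow> nat) \<Rightarrow> int"
  where "code_index n = (\<lambda>(\<alpha>, f).
    if \<forall>i\<in>{1..n}. \<alpha> i = \<infinity> then -1 else (\<Sum>k = 1..max_letter n \<alpha>. int (f k)))"

definition ext_codes :: "nat \<Rightarrow> int \<Rightarrow> ((nat \<Rightarrow> enat) \<times> (nat \<Rightarrow> nat)) set"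
  where "ext_codes n j = {x. is_code n x \<and> code_index n x = j}"

definition code_act ::
  "(nat \<Rightarrow> nat) \<Rightarrow> (nat \<Rightarrow> enat) \<times> (nat \<Rightarrow> nat) \<Rightarrow> (nat \<Rightarrow> enat) \<times> (nat \<Rightarrow> nat)"
  where "code_act \<sigma> = (\<lambda>(\<alpha>, f). (\<alpha> \<circ> \<sigma>, f))"

text \<open>The marked positions give exactly the values \<open>1, \<dots>, |occurrences| - 1\<close>.\<close>

lemma mark_values:
  fixes A :: "nat set"
  assumes "finite A"
  shows "(\<exists>p\<in>A. (\<exists>i\<in>A. i < p) \<and> v = card {i \<in> A. i < p}) \<longleftrightarrow> v \<in> {1..<card A}"
proof
  assume "\<exists>p\<in>A. (\<exists>i\<in>A. i < p) \<and> v = card {i \<in> A. i < p}"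
  then obtain p i where p: "p \<in> A" "i \<in> A" "i < p" "v = card {i \<in> A. i < p}" by blast
  have "{i \<in> A. i < p} \<subset> A" using p by blast
  then have "v < card A" using p assms by (simp add: psubset_card_mono)
  moreover have "{i \<in> A. i < p} \<noteq> {}" using p by blast
  then have "v \<noteq> 0" using p assms by simp
  ultimately show "v \<in> {1..<card A}" by simp
next
  assume v: "v \<in> {1..<card A}"
  have "\<exists>p\<in>A. v = card {i \<in> A. i < p}" if "v < card A" for v
    using assms that
  proof (induction A rule: finite_linorder_max_induct)
    case empty then show ?case by simp
  next
    case (insert b A)
    have b: "b \<notin> A" using insert by auto
    show ?case
    proof (cases "v < card A")
      case True
      with insert obtain p where p: "p \<in> A" "v = card {i \<in> A. i < p}" by blast
      have "{i \<in> insert b A. i < p} = {i \<in> A. i < p}" using insert p by auto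
      with p show ?thesis by (intro bexI[of _ p]) simp_all
    next
      case False
      then have "v = card A" using insert b by simp
      moreover have "{i \<in> insert b A. i < b} = A" using insert by auto
      ultimately show ?thesis by auto
    qed
  qed
  with v obtain p where p: "p \<in> A" "v = card {i \<in> A. i < p}" by auto
  have "{i \<in> A. i < p} \<noteq> {}"
  proof
    assume "{i \<in> A. i < p} = {}"
    then show False using p v by (simp only: card.empty) simp
  qed
  then show "\<exists>p\<in>A. (\<exists>i\<in>A. i < p) \<and> v = card {i \<in> A. i < p}" using p by blast
qed

lemma is_code_iff:
  "is_code n (\<alpha>, f) \<longleftrightarrow>
    \<alpha> \<in> extensional {1..n} \<and> f \<in> extensional {1..max_letter n \<alpha>} \<and>
    (\<forall>k\<in>{1..max_letter n \<alpha>}. 2 \<le> card (occs n \<alpha> k) \<and> 1 \<le> f k \<and> f k \<le> card (occs n \<alpha> k) - 1)"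
proof -
  have "(\<exists>p\<in>occs n \<alpha> k. (\<exists>i\<in>occs n \<alpha> k. i < p) \<and> f k = card {i \<in> occs n \<alpha> k. i < p}) \<longleftrightarrow>
      f k \<in> {1..<card (occs n \<alpha> k)}" for k
    by (rule mark_values) (simp add: occs_def)
  then show ?thesis unfolding is_code_def prod.case by (simp only:) fastforce
qed


section \<open>The \<open>q\<close>-binomial Eulerian polynomials\<close>

text \<open>
  Polynomials in \<open>q\<close> are of type \<^typ>\<open>int poly\<close>, polynomials in \<open>t\<close> over these of type
  \<^typ>\<open>int poly poly\<close>.
\<close>

definition q_int :: "nat \<Rightarrow> int poly"
  where "q_int n = (\<Sum>i<n. monom 1 i)"

definition q_fact :: "nat \<Rightarrow> int poly"
  where "q_fact n = (\<Prod>i=1..n. q_int i)"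

definition q_binomial :: "nat \<Rightarrow> nat \<Rightarrow> int poly"
  where "q_binomial n k = (if k \<le> n then q_fact n div (q_fact k * q_fact (n - k)) else 0)"

text \<open>The division is exact.\<close>

lemma q_int_add: "q_int (a + b) = q_int a + monom 1 a * q_int b"
proof (induction b)
  case (Suc b) then show ?case by (simp add: q_int_def algebra_simps mult_monom)
qed (simp add: q_int_def)

lemma q_fact_Suc: "q_fact (Suc n) = q_int (Suc n) * q_fact n"
  by (simp add: q_fact_def mult.commute)

lemma q_fact_dvd: "q_fact a * q_fact b dvd q_fact (a + b)"
proof (induction "a + b" arbitrary: a b)
  case 0 then show ?case by (simp add: q_fact_def)
next
  case (Suc m)
  show ?case
  proof (cases a; cases b)
    fix a' b' assume ab: "a = Suc a'" "b = Suc b'"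
    have "q_fact a' * q_fact b dvd q_fact m" "q_fact a * q_fact b' dvd q_fact m"
      using Suc.hyps(1)[of a' b] Suc.hyps(1)[of a b'] Suc.hyps(2) ab by auto
    then obtain x y where
      x: "q_fact m = q_fact a' * q_fact b * x" and y: "q_fact m = q_fact a * q_fact b' * y"
      by (elim dvdE)
    have "q_fact (a + b) = q_int a * q_fact m + monom 1 a * q_int b * q_fact m"
      using Suc.hyps(2) by (metis q_fact_Suc q_int_add distrib_right)
    also have "q_int a * q_fact m = q_fact a * q_fact b * x"
      by (simp add: x ab q_fact_Suc algebra_simps)
    also have "monom 1 a * q_int b * q_fact m = q_fact a * q_fact b * (monom 1 a * y)"
      by (simp add: y ab(2) q_fact_Suc algebra_simps)
    finally show ?thesis by (metis dvd_def distrib_left)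
  qed (auto simp: q_fact_def)
qed

lemma q_binomial_exact:
  assumes "k \<le> n" shows "q_binomial n k * (q_fact k * q_fact (n - k)) = q_fact n"
  using q_fact_dvd[of k "n - k"] assms by (simp add: q_binomial_def)

definition maj :: "nat \<Rightarrow> (nat \<Rightarrow> nat) \<Rightarrow> nat"
  where "maj k \<sigma> = \<Sum>{i \<in> {1..<k}. \<sigma> i > \<sigma> (i + 1)}"

definition exc :: "nat \<Rightarrow> (nat \<Rightarrow> nat) \<Rightarrow> nat"
  where "exc k \<sigma> = card {i \<in> {1..k}. \<sigma> i > i}"

text \<open>Hence the subtraction in \<open>q_eulerian\<close> below is not truncated.\<close>

lemma exc_le_maj:
  assumes "\<sigma> permutes {1..k}" shows "exc k \<sigma> \<le> maj k \<sigma>"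
proof -
  define D where "D = {i \<in> {1..<k}. \<sigma> i > \<sigma> (i + 1)}"
  define d where "d = Max (insert 0 D)"
  have fin: "finite D" by (simp add: D_def)
  have "{i \<in> {1..k}. \<sigma> i > i} \<subseteq> {1..d}"
  proof
    fix i assume i: "i \<in> {i \<in> {1..k}. \<sigma> i > i}"
    have "i \<le> d"
    proof (rule ccontr)
      assume "\<not> i \<le> d"
      have "i \<le> j \<Longrightarrow> j \<le> k \<Longrightarrow> \<sigma> j > j" for j
      proof (induction j rule: dec_induct)
        case base then show ?case using i by simp
      next
        case (step j)
        have "j \<notin> D"
        proof
          assume "j \<in> D"
          then have "j \<le> d" using fin by (simp add: d_def)
          then show False using step \<open>\<not> i \<le> d\<close> by simp
        qed
        then have "\<sigma> j \<le> \<sigma> (j + 1)" using step i by (auto simp: D_def)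
        moreover have "\<sigma> j \<noteq> \<sigma> (j + 1)"
          using permutes_inj[OF assms] by (simp add: inj_eq)
        ultimately show ?case using step by simp
      qed
      then have "\<sigma> k > k" using i by simp
      moreover have "\<sigma> k \<in> {1..k}" using permutes_in_image[OF assms, of k] i by simp
      ultimately show False by simp
    qed
    then show "i \<in> {1..d}" using i by simp
  qed
  then have "exc k \<sigma> \<le> card {1..d}" unfolding exc_def by (intro card_mono) auto
  also have "\<dots> = d" by simp
  also have "d \<le> \<Sum>D"
  proof (cases "d = 0")
    case False
    have "d \<in> insert 0 D" unfolding d_def using fin by (intro Max_in) auto
    then have "d \<in> D" using False by simp
    then show ?thesis using member_le_sum[of d D "\<lambda>x. x"] fin by simp
  qed simp
  finally show ?thesis by (simp add: maj_def D_def)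
qed

definition q_eulerian :: "nat \<Rightarrow> int poly poly"
  where "q_eulerian k =
    (\<Sum>\<sigma> | \<sigma> permutes {1..k}. monom (monom 1 (maj k \<sigma> - exc k \<sigma>)) (exc k \<sigma>))"

definition q_bin_eulerian :: "nat \<Rightarrow> int poly poly"
  where "q_bin_eulerian n =
    1 + monom 1 1 * (\<Sum>k = 1..n. smult (q_binomial n k) (q_eulerian k))"

definition q_bin_eulerian_coeff :: "nat \<Rightarrow> nat \<Rightarrow> int poly"
  where "q_bin_eulerian_coeff n j = coeff (q_bin_eulerian n) j"

end

theory Submission
  imports Defs "HOL-Library.Poly_Mapping"
begin

text \<open>
  Removing the largest letter shows that codes invariant under a rotation of order \<open>d\<close> satisfy
  a binomial recurrence in the number of orbits of positions. At a primitive \<open>d\<close>-th root of unity the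
  \<open>q\<close>-binomial coefficients become ordinary ones, so everything reduces to the recurrence
  \<open>A\<^sub>n = 1 + \<Sum>\<^sub>k [n, k]\<^sub>q (t + \<dots> + t\<^bsup>k-1\<^esup>) A\<^bsub>n-k\<^esub>\<close>,
  which is the generating function of Shareshian and Wachs for \<open>(maj, exc)\<close>.

  For the latter, \<open>maj - exc\<close> is the sum of the set \<open>DEX\<close>, so \<open>A\<^sub>n\<close> is a principal specialization of
  a quasisymmetric function whose coefficient at a composition \<open>a\<close> counts the permutations with
  \<open>DEX\<close> contained in the partial sums of \<open>a\<close>. These permutations correspond to coloured words of
  content \<open>a\<close>, hence to the coefficient of \<open>u\<^sup>a\<close> in a product of linear forms. Up to the factor \<open>t\<close>
  the linear forms of consecutive blocks are related by a cyclic shift, and this yields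
  \<open>\<Sum>\<^sub>b (t\<^bsup>|b|\<^esup> - t) N(a - b) = 1 - t\<close>, the coefficientwise form of the recurrence.
\<close>

section \<open>The set \<open>DEX\<close>\<close>

text \<open>The obstacle is that the specialization behind the Eulerian recurrence divides by 1 -
  q^n, which vanishes at the very roots of unity that matter. It is therefore carried out for real 0
  < q < 1, the recurrence is lifted to an identity of polynomials in q and t, and only then is a
  root of unity substituted. There, with d the order of the root, the weight t + ... + t^(d*i-1)
  arises twice: on the polynomial side as the surviving factor for k = d * i, and on the code side
  as the sum over the possible marks of a letter that fills i orbits of size d. The two recurrences
  differ only in their initial terms, 1 against 2^N, because a code has two free letters, 0 and
  infinity. The binomial sum in \<open>q_bin_eulerian\<close> makes up for one of them. The
  exceptional index -1 of the code made of infinities alone accounts for the summand 1 of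
  \<open>q_bin_eulerian\<close> and for its sum starting at k = 1.\<close>

text \<open>
  Bar the excedance values and let barred values precede unbarred ones: \<open>dex\<close> is the descent set of
  the resulting word.
\<close>

definition dex :: "nat \<Rightarrow> (nat \<Rightarrow> nat) \<Rightarrow> nat set" where
  "dex n \<sigma> = {i \<in> {1..<n}. if i < \<sigma> i \<longleftrightarrow> Suc i < \<sigma> (Suc i) then \<sigma> (Suc i) < \<sigma> i
                           else Suc i < \<sigma> (Suc i)}"

lemma dex_subset: "dex n \<sigma> \<subseteq> {1..<n}"
  by (auto simp: dex_def)

text \<open>Let e be the indicator of excedance positions. By cases on e i and e (i+1), the
  indicator of a descent at i minus that of i in \<open>dex\<close> is e i - e (i+1). Weighted by i
  this sums by parts to the number of excedances, because e n = 0.\<close>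

lemma sum_dex:
  assumes \<sigma>: "\<sigma> permutes {1..n}"
  shows "\<Sum>(dex n \<sigma>) + exc n \<sigma> = maj n \<sigma>"
proof (cases "n = 0")
  case True
  then show ?thesis by (simp add: dex_def exc_def maj_def)
next
  case False
  define e where "e i = (if i < \<sigma> i then 1 else 0 :: int)" for i
  have abel: "(\<Sum>i\<in>{1..<Suc m}. int i * (e i - e (i + 1))) = (\<Sum>i=1..m. e i) - int m * e (Suc m)" for m
    by (induction m) (simp_all add: algebra_simps)
  have "\<sigma> n \<in> {1..n}" using permutes_in_image[OF \<sigma>, of n] False by simp
  then have en: "e n = 0" by (simp add: e_def)
  have "(\<Sum>i=1..n - 1. e i) = (\<Sum>i=1..n. e i)"
    using False en by (cases n) auto
  also have "\<dots> = int (exc n \<sigma>)"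
    by (simp add: e_def exc_def sum.If_cases Int_def)
  finally have sum_e: "(\<Sum>i=1..n - 1. e i) = int (exc n \<sigma>)" .
  have step: "(if \<sigma> (i + 1) < \<sigma> i then int i else 0) - (if i \<in> dex n \<sigma> then int i else 0) =
      int i * (e i - e (i + 1))" if i: "i \<in> {1..<n}" for i
  proof -
    have "\<sigma> i \<noteq> \<sigma> (i + 1)" using permutes_inj[OF \<sigma>] by (simp add: inj_eq)
    then show ?thesis using i by (auto simp: dex_def e_def)
  qed
  have "int (maj n \<sigma>) = (\<Sum>i\<in>{1..<n}. if \<sigma> (i + 1) < \<sigma> i then int i else 0)"
    unfolding of_nat_sum maj_def by (rule sum.mono_neutral_cong_left) auto
  moreover have "int (\<Sum>(dex n \<sigma>)) = (\<Sum>i\<in>{1..<n}. if i \<in> dex n \<sigma> then int i else 0)"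
    unfolding of_nat_sum using dex_subset[of n \<sigma>] by (intro sum.mono_neutral_cong_left) auto
  ultimately have "int (maj n \<sigma>) - int (\<Sum>(dex n \<sigma>)) =
      (\<Sum>i\<in>{1..<n}. (if \<sigma> (i + 1) < \<sigma> i then int i else 0) - (if i \<in> dex n \<sigma> then int i else 0))"
    by (simp add: sum_subtractf)
  also have "\<dots> = (\<Sum>i\<in>{1..<n}. int i * (e i - e (i + 1)))"
    by (intro sum.cong refl step)
  also have "\<dots> = int (exc n \<sigma>)"
    using abel[of "n - 1"] False en sum_e by simp
  finally show ?thesis by linarith
qed

section \<open>Principal specialization of quasisymmetric functions\<close>

definition q_poch :: "real \<Rightarrow> nat \<Rightarrow> real" where
  "q_poch q n = (\<Prod>i=1..n. 1 - q ^ i)"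

lemma q_poch_0 [simp]: "q_poch q 0 = 1" by (simp add: q_poch_def)
lemma q_poch_Suc: "q_poch q (Suc n) = q_poch q n * (1 - q ^ Suc n)" by (simp add: q_poch_def)

text \<open>
  The specialization \<open>x\<^sub>i = q\<^sup>i\<close> of the quasisymmetric function of degree \<open>n\<close> whose coefficient at the
  monomial with exponents \<open>a\<close> is \<open>N a\<close>. Compositions are written backwards: the head of the list
  is the last block, which carries the smallest power of \<open>q\<close> and is split off by the recursion.
\<close>

fun phi :: "real \<Rightarrow> nat \<Rightarrow> (nat list \<Rightarrow> real) \<Rightarrow> real" where
  "phi q n N = (if n = 0 then N [] else
     (\<Sum>m=1..n. q ^ (n - m) * phi q (n - m) (\<lambda>a. N (m # a))) / (1 - q ^ n))"

declare phi.simps [simp del]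

lemma phi_0 [simp]: "phi q 0 N = N []"
  by (simp add: phi.simps)

text \<open>The boundary 0 in front of the first block is included; it does no harm, as
  \<open>dex\<close> lies in {1..<n}.\<close>

primrec partial_sums :: "nat list \<Rightarrow> nat set" where
  "partial_sums [] = {}"
| "partial_sums (m # a) = insert (sum_list a) (partial_sums a)"

text \<open>Multiplication by the complete homogeneous symmetric function of degree \<open>k\<close>, on coefficients.\<close>

fun star :: "nat \<Rightarrow> (nat list \<Rightarrow> real) \<Rightarrow> nat list \<Rightarrow> real" where
  "star k N [] = (if k = 0 then N [] else 0)"
| "star k N (m # a) = (\<Sum>c\<le>min k m. star (k - c) (\<lambda>a. N ((m - c) # a)) a)"

context
  fixes q :: real
  assumes q: "0 < q" "q < 1"
begin

lemma one_minus_pow: "n \<ge> 1 \<Longrightarrow> 1 - q ^ n \<noteq> 0"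
  using q power_strict_decreasing[of 0 n q] by simp

lemma q_poch_nonzero: "q_poch q n \<noteq> 0"
  using one_minus_pow by (auto simp: q_poch_def)

text \<open>Here m is the exponent of the variable q^0, and the remaining variables are q times the
  original ones, whence q^(n-m). The term m = 0 is the one that \<open>phi\<close> solves for, which
  produces its divisor 1 - q^n. The correction vanishes when N ignores a leading zero part.\<close>

lemma phi_rec: "(\<Sum>m\<le>n. q ^ (n - m) * phi q (n - m) (\<lambda>a. N (m # a))) =
   phi q n N + q ^ n * (phi q n (\<lambda>a. N (0 # a)) - phi q n N)"
proof (cases "n = 0")
  case False
  have "(\<Sum>m\<le>n. q ^ (n - m) * phi q (n - m) (\<lambda>a. N (m # a))) =
     q ^ n * phi q n (\<lambda>a. N (0 # a)) + (\<Sum>m=1..n. q ^ (n - m) * phi q (n - m) (\<lambda>a. N (m # a)))"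
    by (subst sum.atMost_shift) (simp add: sum.atLeast1_atMost_eq)
  also have "(\<Sum>m=1..n. q ^ (n - m) * phi q (n - m) (\<lambda>a. N (m # a))) = phi q n N * (1 - q ^ n)"
    using False one_minus_pow[of n] by (subst (2) phi.simps) simp
  finally show ?thesis by (simp add: algebra_simps)
qed simp

lemma phi_sum: "phi q n (\<lambda>a. \<Sum>x\<in>X. c x * N x a) = (\<Sum>x\<in>X. c x * phi q n (N x))"
proof (induction n arbitrary: N rule: less_induct)
  case (less n)
  show ?case
  proof (cases "n = 0")
    case False
    have "phi q n (\<lambda>a. \<Sum>x\<in>X. c x * N x a) =
      (\<Sum>m=1..n. q ^ (n - m) * (\<Sum>x\<in>X. c x * phi q (n - m) (\<lambda>a. N x (m # a)))) / (1 - q ^ n)"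
      using False less.IH[of "n - _" "\<lambda>x a. N x (_ # a)"] by (subst phi.simps) simp
    also have "\<dots> = (\<Sum>m=1..n. \<Sum>x\<in>X. c x * (q ^ (n - m) * phi q (n - m) (\<lambda>a. N x (m # a)))) / (1 - q ^ n)"
      by (simp add: sum_distrib_left algebra_simps)
    also have "\<dots> = (\<Sum>x\<in>X. c x * (\<Sum>m=1..n. q ^ (n - m) * phi q (n - m) (\<lambda>a. N x (m # a)))) / (1 - q ^ n)"
      by (subst sum.swap) (simp add: sum_distrib_left)
    also have "\<dots> = (\<Sum>x\<in>X. c x * phi q n (N x))"
      using False by (simp add: phi.simps[of q n] flip: sum_divide_distrib)
    finally show ?thesis .
  qed simp
qed

lemma star_eq_0: "sum_list a < k \<Longrightarrow> star k N a = 0"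
  by (induction a arbitrary: k N) (auto intro!: sum.neutral)

lemma phi_zero: "phi q n (\<lambda>a. 0) = 0"
  using phi_sum[of n "\<lambda>_. 0" "\<lambda>_ _. 0" "{}"] by simp

lemma phi_cong:
  "(\<And>a. sum_list a = n \<Longrightarrow> N a = N' a) \<Longrightarrow> phi q n N = phi q n N'"
proof (induction n arbitrary: N N' rule: less_induct)
  case (less n)
  show ?case
  proof (cases "n = 0")
    case True
    with less.prems[of "[]"] show ?thesis by simp
  next
    case False
    have "phi q (n - m) (\<lambda>a. N (m # a)) = phi q (n - m) (\<lambda>a. N' (m # a))" if "m \<in> {1..n}" for m
      using that less.prems False by (intro less.IH) auto
    then show ?thesis using False by (simp add: phi.simps)
  qed
qed

text \<open>Consecutive reciprocals of (q;q)_i differ by q^i / (q;q)_i.\<close>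

lemma inverse_q_poch_telescope:
  "M \<le> n \<Longrightarrow> 1 / q_poch q M + (\<Sum>i\<in>{M<..n}. q ^ i / q_poch q i) = 1 / q_poch q n"
proof (induction n rule: dec_induct)
  case (step n)
  have "{M<..Suc n} = insert (Suc n) {M<..n}" using step by auto
  then have "1 / q_poch q M + (\<Sum>i\<in>{M<..Suc n}. q ^ i / q_poch q i) = 1 / q_poch q n + q ^ Suc n / q_poch q (Suc n)"
    using step.IH by (simp del: power_Suc)
  also have "\<dots> = 1 / q_poch q (Suc n)"
    using q_poch_nonzero[of n] one_minus_pow[of "Suc n"] unfolding q_poch_Suc by (simp add: field_simps del: power_Suc)
  finally show ?case .
qed simp

text \<open>This is the specialized fundamental quasisymmetric function. The indices decrease weakly
  along the word and must drop after each d in D; a drop after position d raises the first d indices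
  by one and so contributes q^d.\<close>

lemma phi_subset:
  assumes "D \<subseteq> {1..<n}"
  shows "phi q n (\<lambda>a. if D \<subseteq> partial_sums a then 1 else 0) = q ^ (\<Sum>D) / q_poch q n"
  using assms
proof (induction n arbitrary: D rule: less_induct)
  case (less n)
  show ?case
  proof (cases "n = 0")
    case True
    with less.prems show ?thesis by simp
  next
    case False
    define M where "M = Max (insert 0 D)"
    have fin: "finite D" using less.prems finite_subset by blast
    have M: "d \<le> M" if "d \<in> D" for d using fin that by (simp add: M_def)
    have M_in: "M \<in> D" if "M \<noteq> 0"
    proof -
      have "M \<in> insert 0 D" unfolding M_def using fin by (intro Max_in) auto
      with that show ?thesis by simp
    qed
    have Mn: "M < n" using M_in less.prems False by (cases "M = 0") auto
    \<comment> \<open>Stripping the block after position i creates the boundary i. For i < M the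
      required boundary M would lie inside that block, so nothing survives; otherwise D - {i} is
      left to the induction hypothesis.\<close>
    have phi_term: "phi q i (\<lambda>a. if D \<subseteq> partial_sums ((n - i) # a) then 1 else 0) =
        (if M \<le> i then q ^ (\<Sum>(D - {i})) / q_poch q i else 0)" if i: "i < n" for i
    proof -
      have "phi q i (\<lambda>a. if D \<subseteq> partial_sums ((n - i) # a) then 1 else 0) =
        phi q i (\<lambda>a. if D - {i} \<subseteq> partial_sums a then 1 else 0)"
        by (rule phi_cong) auto
      also have "\<dots> = (if M \<le> i then q ^ (\<Sum>(D - {i})) / q_poch q i else 0)"
      proof (cases "M \<le> i")
        case True
        have "D - {i} \<subseteq> {1..<i}" using True M less.prems by fastforce
        with True less.IH[OF i] show ?thesis by simp
      next
        case False
        have ps: "partial_sums a \<subseteq> {..sum_list a}" for a by (induction a) auto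
        have "phi q i (\<lambda>a. if D - {i} \<subseteq> partial_sums a then 1 else 0) = phi q i (\<lambda>a. 0)"
        proof (rule phi_cong)
          fix a assume "sum_list a = i"
          then have "\<not> D - {i} \<subseteq> partial_sums a" using ps[of a] False M_in by force
          then show "(if D - {i} \<subseteq> partial_sums a then 1 else 0) = (0::real)" by simp
        qed
        also have "\<dots> = 0" by (rule phi_zero)
        finally show ?thesis using False by simp
      qed
      finally show ?thesis .
    qed
    have "(\<Sum>m=1..n. q ^ (n - m) * phi q (n - m) (\<lambda>a. if D \<subseteq> partial_sums (m # a) then 1 else 0)) =
       (\<Sum>i<n. q ^ i * phi q i (\<lambda>a. if D \<subseteq> partial_sums ((n - i) # a) then 1 else 0))"
      by (rule sum.reindex_bij_witness[of _ "\<lambda>i. n - i" "\<lambda>m. n - m"]) auto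
    also have "\<dots> = (\<Sum>i<n. if M \<le> i then q ^ i * q ^ (\<Sum>(D - {i})) / q_poch q i else 0)"
      by (intro sum.cong refl, subst phi_term) simp_all
    also have "\<dots> = (\<Sum>i\<in>{M..n - 1}. q ^ i * q ^ (\<Sum>(D - {i})) / q_poch q i)"
      using False by (intro sum.mono_neutral_cong_right) auto
    also have "{M..n - 1} = insert M {M<..n - 1}" using Mn by auto
    also have "(\<Sum>i\<in>insert M {M<..n - 1}. q ^ i * q ^ (\<Sum>(D - {i})) / q_poch q i) =
       q ^ (\<Sum>D) / q_poch q M + (\<Sum>i\<in>{M<..n - 1}. q ^ (\<Sum>D) * (q ^ i / q_poch q i))"
    proof -
      \<comment> \<open>For i = M the factor q^i restores the element removed from D; for i > M it
        remains as a term of the telescoping sum.\<close>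
      have "q ^ M * q ^ (\<Sum>(D - {M})) = q ^ (\<Sum>D)"
      proof (cases "M = 0")
        case True
        then have "M \<notin> D" using less.prems by auto
        with True show ?thesis by simp
      next
        case False
        then show ?thesis using sum.remove[OF fin M_in, of "\<lambda>x. x"] by (simp add: power_add)
      qed
      moreover have "D - {i} = D" if "i \<in> {M<..n - 1}" for i using that M by fastforce
      ultimately show ?thesis by (simp add: mult.commute)
    qed
    also have "\<dots> = q ^ (\<Sum>D) * (1 / q_poch q M + (\<Sum>i\<in>{M<..n - 1}. q ^ i / q_poch q i))"
      by (simp add: sum_distrib_left algebra_simps)
    also have "\<dots> = q ^ (\<Sum>D) / q_poch q (n - 1)"
      using Mn by (subst inverse_q_poch_telescope) auto
    finally show ?thesis using False q_poch_Suc[of q "n - 1"]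
      by (subst phi.simps) simp
  qed
qed

text \<open>The specialization is multiplicative here and sends the complete homogeneous function of
  degree k to 1 / (q;q)_k. Both factors obey the same recursion: c and d are the exponents of the
  variable q^0 coming from the homogeneous function and from N, so m = c + d, and the sum over the
  whole rectangle factors.\<close>

lemma phi_star:
  assumes "\<And>x y. N (x @ 0 # y) = N (x @ y)" "k \<le> n"
  shows "phi q n (star k N) = phi q (n - k) N / q_poch q k"
  using assms
proof (induction n arbitrary: k N rule: less_induct)
  case (less n)
  show ?case
  proof (cases "n = 0")
    case True
    with less.prems show ?thesis by simp
  next
    case False
    have N0: "N (0 # a) = N a" for a using less.prems(1)[of "[]"] by simp
    define h where "h k = 1 / q_poch q k" for k
    define g where "g d = q ^ (n - k - d) * phi q (n - k - d) (\<lambda>a. N (d # a))" for d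
    have h_rec: "(\<Sum>c\<le>k. q ^ (k - c) * h (k - c)) = h k"
    proof -
      have "(\<Sum>c\<le>k. q ^ (k - c) * h (k - c)) = (\<Sum>i\<in>{..k}. q ^ i / q_poch q i)"
        by (rule sum.reindex_bij_witness[of _ "\<lambda>i. k - i" "\<lambda>m. k - m"]) (auto simp: h_def)
      also have "\<dots> = (\<Sum>i\<in>insert 0 {0<..k}. q ^ i / q_poch q i)"
        by (rule sum.cong) auto
      also have "\<dots> = h k"
        using inverse_q_poch_telescope[of 0 k] by (simp add: h_def)
      finally show ?thesis .
    qed
    have g_rec: "(\<Sum>d\<le>n - k. g d) = phi q (n - k) N"
      unfolding g_def by (subst phi_rec) (simp add: N0)
    define T where "T = (\<lambda>(c, d). q ^ (k - c) * h (k - c) * g d)"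
    have "(\<Sum>p\<in>{..k} \<times> {..n - k}. T p) = (\<Sum>c\<le>k. q ^ (k - c) * h (k - c)) * (\<Sum>d\<le>n - k. g d)"
      by (simp add: T_def sum_product sum.cartesian_product)
    then have total: "(\<Sum>p\<in>{..k} \<times> {..n - k}. T p) = h k * phi q (n - k) N"
      by (simp add: h_rec g_rec)
    \<comment> \<open>The corner c = d = 0 avoids the variable q^0 and reproduces the whole product
      times q^n. Removing it leaves the factor 1 - q^n by which \<open>phi\<close> divides.\<close>
    have "T (0, 0) = q ^ n * (h k * phi q (n - k) N)"
      using less.prems(2) by (simp add: T_def g_def N0 flip: power_add)
    moreover have "(\<Sum>p\<in>{..k} \<times> {..n - k}. T p) = T (0, 0) + (\<Sum>p\<in>{..k} \<times> {..n - k} - {(0, 0)}. T p)"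
      by (rule sum.remove) auto
    ultimately have rest: "(\<Sum>p\<in>{..k} \<times> {..n - k} - {(0, 0)}. T p) = (1 - q ^ n) * (h k * phi q (n - k) N)"
      using total by (simp only: left_diff_distrib mult_1)
    have phi_term: "q ^ (n - m) * phi q (n - m) (\<lambda>a. star k N (m # a)) =
        (\<Sum>c | c \<le> k \<and> c \<le> m \<and> m - c \<le> n - k. T (c, m - c))" if m: "m \<in> {1..n}" for m
    proof -
      have "phi q (n - m) (\<lambda>a. star k N (m # a)) =
         phi q (n - m) (\<lambda>a. \<Sum>c\<le>min k m. 1 * star (k - c) (\<lambda>a. N ((m - c) # a)) a)"
        by simp
      also have "\<dots> = (\<Sum>c\<le>min k m. 1 * phi q (n - m) (star (k - c) (\<lambda>a. N ((m - c) # a))))"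
        by (rule phi_sum)
      also have "\<dots> = (\<Sum>c | c \<le> k \<and> c \<le> m \<and> m - c \<le> n - k. phi q (n - m) (star (k - c) (\<lambda>a. N ((m - c) # a))))"
      \<comment> \<open>If m - c > n - k, then k - c exceeds the remaining degree n - m and
        \<open>star\<close> vanishes.\<close>
      proof (rule sum.mono_neutral_cong_right)
        show "\<forall>c\<in>{..min k m} - {c. c \<le> k \<and> c \<le> m \<and> m - c \<le> n - k}.
          1 * phi q (n - m) (star (k - c) (\<lambda>a. N ((m - c) # a))) = 0"
        proof
          fix c assume "c \<in> {..min k m} - {c. c \<le> k \<and> c \<le> m \<and> m - c \<le> n - k}"
          then have "n - m < k - c" using m less.prems(2) by auto
          then have "phi q (n - m) (star (k - c) (\<lambda>a. N ((m - c) # a))) = phi q (n - m) (\<lambda>a. 0)"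
            by (intro phi_cong star_eq_0) simp
          then show "1 * phi q (n - m) (star (k - c) (\<lambda>a. N ((m - c) # a))) = 0"
            by (simp add: phi_zero)
        qed
      qed auto
      also have "\<dots> = (\<Sum>c | c \<le> k \<and> c \<le> m \<and> m - c \<le> n - k. h (k - c) * phi q (n - k - (m - c)) (\<lambda>a. N ((m - c) # a)))"
      proof (rule sum.cong[OF refl])
        fix c assume c: "c \<in> {c. c \<le> k \<and> c \<le> m \<and> m - c \<le> n - k}"
        have "phi q (n - m) (star (k - c) (\<lambda>a. N ((m - c) # a))) =
            phi q (n - m - (k - c)) (\<lambda>a. N ((m - c) # a)) / q_poch q (k - c)"
          using m c less.prems(1)[of "_ # _"] less.prems(2) by (intro less.IH) auto
        moreover have "n - m - (k - c) = n - k - (m - c)" using c m less.prems(2) by auto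
        ultimately show "phi q (n - m) (star (k - c) (\<lambda>a. N ((m - c) # a))) =
            h (k - c) * phi q (n - k - (m - c)) (\<lambda>a. N ((m - c) # a))" by (simp add: h_def)
      qed
      finally have 1: "phi q (n - m) (\<lambda>a. star k N (m # a)) = \<dots>" .
      have "q ^ (n - m) * (\<Sum>c | c \<le> k \<and> c \<le> m \<and> m - c \<le> n - k. h (k - c) * phi q (n - k - (m - c)) (\<lambda>a. N ((m - c) # a))) =
          (\<Sum>c | c \<le> k \<and> c \<le> m \<and> m - c \<le> n - k. T (c, m - c))"
        unfolding sum_distrib_left
      proof (rule sum.cong[OF refl])
        fix c assume c: "c \<in> {c. c \<le> k \<and> c \<le> m \<and> m - c \<le> n - k}"
        then have "n - m = (k - c) + (n - k - (m - c))" using m less.prems(2) by auto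
        then show "q ^ (n - m) * (h (k - c) * phi q (n - k - (m - c)) (\<lambda>a. N ((m - c) # a))) = T (c, m - c)"
          by (simp add: T_def g_def power_add)
      qed
      then show ?thesis unfolding 1 .
    qed
    have "(\<Sum>m=1..n. q ^ (n - m) * phi q (n - m) (\<lambda>a. star k N (m # a))) =
      (\<Sum>m=1..n. \<Sum>c | c \<le> k \<and> c \<le> m \<and> m - c \<le> n - k. T (c, m - c))"
      by (intro sum.cong refl phi_term)
    also have "\<dots> = (\<Sum>(m, c)\<in>(SIGMA m:{1..n}. {c. c \<le> k \<and> c \<le> m \<and> m - c \<le> n - k}). T (c, m - c))"
      by (rule sum.Sigma) auto
    also have "\<dots> = (\<Sum>p\<in>{..k} \<times> {..n - k} - {(0, 0)}. T p)"
      using less.prems(2)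
      by (intro sum.reindex_bij_witness[of _ "\<lambda>(c, d). (c + d, c)" "\<lambda>(m, c). (c, m - c)"]) auto
    finally show ?thesis using False one_minus_pow[of n] rest by (subst phi.simps) (simp add: h_def)
  qed
qed

end

section \<open>Products of linear forms\<close>

type_synonym mpol = "(nat \<Rightarrow>\<^sub>0 nat) \<Rightarrow>\<^sub>0 real"

definition var :: "nat \<Rightarrow> mpol" where
  "var i = Poly_Mapping.single (Poly_Mapping.single i 1) 1"

definition cst :: "real \<Rightarrow> mpol" where
  "cst x = Poly_Mapping.single 0 x"

lemma cst_mult: "cst x * cst y = cst (x * y)"
  by (simp add: cst_def mult_single)
lemma cst_add: "cst x + cst y = cst (x + y)"
  by (simp add: cst_def single_add)
lemma cst_1: "cst 1 = 1"
  by (simp add: cst_def)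
lemma cst_0: "cst 0 = 0"
  by (simp add: cst_def)
lemma cst_power: "cst x ^ k = cst (x ^ k)"
  by (induction k) (simp_all add: cst_mult cst_1)
lemma cst_prod: "(\<Prod>i\<in>A. cst (f i)) = cst (\<Prod>i\<in>A. f i)"
  by (induction A rule: infinite_finite_induct) (simp_all add: cst_mult cst_1)

lemma lookup_cst_mult: "Poly_Mapping.lookup (cst x * p) m = x * Poly_Mapping.lookup p m"
proof (induction p rule: Poly_Mapping.update_induct)
  case const
  then show ?case by simp
next
  case (update f a b)
  have eq: "Poly_Mapping.update a b f = f + Poly_Mapping.single a b"
    using update(1) by (intro poly_mapping_eqI) (auto simp: lookup_update lookup_add lookup_single in_keys_iff when_def)
  show ?case unfolding eq using update
    by (simp add: distrib_left lookup_add cst_def mult_single lookup_single when_def)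
qed

lemma var_power: "var i ^ k = Poly_Mapping.single (Poly_Mapping.single i k) 1"
  by (induction k) (simp_all add: var_def mult_single single_add[symmetric])

lemma lookup_var_power_mult:
  fixes m :: "nat \<Rightarrow>\<^sub>0 nat" and p :: mpol
  shows "Poly_Mapping.lookup (var i ^ k * p) m = (if k \<le> Poly_Mapping.lookup m i then Poly_Mapping.lookup p (m - Poly_Mapping.single i k) else 0)"
proof (induction p rule: Poly_Mapping.update_induct)
  case const
  then show ?case by simp
next
  case (update f a b)
  have eq: "Poly_Mapping.update a b f = f + Poly_Mapping.single a b"
    using update(1) by (intro poly_mapping_eqI) (auto simp: lookup_update lookup_add lookup_single in_keys_iff when_def)
  have 1: "m = Poly_Mapping.single i k + a \<longleftrightarrow> k \<le> Poly_Mapping.lookup m i \<and> m - Poly_Mapping.single i k = a"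
    by (auto simp: poly_mapping_eq_iff fun_eq_iff lookup_add lookup_minus lookup_single when_def split: if_splits)
  show ?case unfolding eq using update 1
    by (auto simp add: distrib_left lookup_add var_power mult_single lookup_single when_def)
qed

definition content_mon :: "nat \<Rightarrow> (nat \<Rightarrow> nat) \<Rightarrow> (nat \<Rightarrow>\<^sub>0 nat)" where
  "content_mon s a = (\<Sum>i<s. Poly_Mapping.single i (a i))"

lemma lookup_content_mon: "Poly_Mapping.lookup (content_mon s a) i = (if i < s then a i else 0)"
  by (simp add: content_mon_def lookup_sum lookup_single when_def)

text \<open>
  Modulo this ideal, a monomial with exponents \<open>m\<close> is annihilated by every variable, which makes the
  linear forms of neighbouring blocks interchangeable in its presence.
\<close>

definition vanishing :: "(nat \<Rightarrow>\<^sub>0 nat) \<Rightarrow> mpol \<Rightarrow> bool" where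
  "vanishing m p \<longleftrightarrow> (\<forall>r. Poly_Mapping.lookup (r * p) m = 0)"

lemma vanishing_0: "vanishing m 0"
  by (simp add: vanishing_def)

lemma vanishing_add: "vanishing m p \<Longrightarrow> vanishing m p' \<Longrightarrow> vanishing m (p + p')"
  by (simp add: vanishing_def distrib_left lookup_add)

lemma vanishing_diff: "vanishing m p \<Longrightarrow> vanishing m p' \<Longrightarrow> vanishing m (p - p')"
  by (simp add: vanishing_def right_diff_distrib lookup_minus)

lemma vanishing_mult: "vanishing m p \<Longrightarrow> vanishing m (r * p)"
  by (simp add: vanishing_def flip: mult.assoc)

lemma vanishing_lookup: "vanishing m (p - p') \<Longrightarrow> Poly_Mapping.lookup p m = Poly_Mapping.lookup p' m"
  unfolding vanishing_def by (metis lookup_minus mult_1 right_minus_eq)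

lemma vanishing_var: "Poly_Mapping.lookup m i < k \<Longrightarrow> vanishing m (var i ^ k)"
  unfolding vanishing_def by (subst mult.commute) (simp add: lookup_var_power_mult)

text \<open>Modulo \<open>vanishing\<close>, multiplying by u_B^(a B) makes y B and y (B+1) equal,
  since the difference contains u_B^(a B + 1). The two products over B < i thus reduce to M + y i *
  K and M + y 0 * K with one common K, where M is the product of the u_B^(a B). At i = s the
  relation y s = t * y 0 eliminates K and leaves (1 - t) * M.\<close>

lemma cyclic_shift_identity:
  fixes y E :: "nat \<Rightarrow> mpol" and a :: "nat \<Rightarrow> nat" and t :: real
  assumes y: "\<And>B. B < s \<Longrightarrow> y (Suc B) = y B + cst (t - 1) * var B"
    and ys: "y s = cst t * y 0"
  shows "Poly_Mapping.lookup (\<Prod>B<s. var B ^ a B + y (Suc B) * E B) (content_mon s a) -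
         t * Poly_Mapping.lookup (\<Prod>B<s. var B ^ a B + y B * E B) (content_mon s a) = 1 - t"
proof -
  let ?N = "vanishing (content_mon s a)"
  define M where "M s = (\<Prod>B<s. var B ^ a B)" for s
  have key: "?N (var B ^ a B * (y (Suc B) - y B))" if "B < s" for B
  proof -
    have "var B ^ a B * (y (Suc B) - y B) = cst (t - 1) * var B ^ Suc (a B)"
      using y[OF that] by (simp add: algebra_simps)
    then show ?thesis using that by (auto intro!: vanishing_mult vanishing_var simp del: power_Suc simp: lookup_content_mon)
  qed
  have Mkey: "?N (M i * (y i - y 0))" if "i \<le> s" for i
    using that
  proof (induction i)
    case (Suc i)
    have "M (Suc i) * (y (Suc i) - y 0) =
       var i ^ a i * (M i * (y i - y 0)) + M i * (var i ^ a i * (y (Suc i) - y i))"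
      by (simp add: M_def algebra_simps)
    then show ?case using Suc key[of i] by (auto intro!: vanishing_add vanishing_mult)
  qed (simp add: vanishing_0)
  have "\<exists>K. ?N ((\<Prod>B<i. var B ^ a B + y (Suc B) * E B) - (M i + y i * K)) \<and>
            ?N ((\<Prod>B<i. var B ^ a B + y B * E B) - (M i + y 0 * K))" if "i \<le> s" for i
    using that
  proof (induction i)
    case 0
    show ?case by (intro exI[of _ 0]) (simp add: M_def vanishing_0)
  next
    case (Suc i)
    let ?P = "\<Prod>B<i. var B ^ a B + y (Suc B) * E B"
    let ?F = "\<Prod>B<i. var B ^ a B + y B * E B"
    from Suc obtain K where K: "?N (?P - (M i + y i * K))" "?N (?F - (M i + y 0 * K))" by auto
    \<comment> \<open>Both expansions have this cofactor: the first after replacing u_i^(a i) * y i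
      by u_i^(a i) * y (i+1), the second after replacing M i * y i by M i * y 0.\<close>
    define K' where "K' = var i ^ a i * K + E i * (M i + y i * K)"
    have M_Suc: "M (Suc i) = M i * var i ^ a i" by (simp add: M_def)
    have "?P * (var i ^ a i + y (Suc i) * E i) - (M (Suc i) + y (Suc i) * K') =
       (var i ^ a i + y (Suc i) * E i) * (?P - (M i + y i * K)) - K * (var i ^ a i * (y (Suc i) - y i))"
      unfolding M_Suc K'_def by (simp add: algebra_simps)
    then have 1: "?N (?P * (var i ^ a i + y (Suc i) * E i) - (M (Suc i) + y (Suc i) * K'))"
      using K(1) key[of i] Suc.prems by (auto intro!: vanishing_diff vanishing_mult)
    have "?F * (var i ^ a i + y i * E i) - (M (Suc i) + y 0 * K') =
       (var i ^ a i + y i * E i) * (?F - (M i + y 0 * K)) + E i * (M i * (y i - y 0))"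
      unfolding M_Suc K'_def by (simp add: algebra_simps)
    then have 2: "?N (?F * (var i ^ a i + y i * E i) - (M (Suc i) + y 0 * K'))"
      using K(2) Mkey[of i] Suc.prems by (auto intro!: vanishing_add vanishing_mult)
    from 1 2 show ?case by auto
  qed
  from this[of s] obtain K where
    K: "Poly_Mapping.lookup (\<Prod>B<s. var B ^ a B + y (Suc B) * E B) (content_mon s a) = Poly_Mapping.lookup (M s + y s * K) (content_mon s a)"
       "Poly_Mapping.lookup (\<Prod>B<s. var B ^ a B + y B * E B) (content_mon s a) = Poly_Mapping.lookup (M s + y 0 * K) (content_mon s a)"
    by (auto dest: vanishing_lookup)
  have M_single: "M i = Poly_Mapping.single (content_mon i a) 1" for i
    by (induction i) (simp_all add: M_def content_mon_def var_power mult_single)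
  show ?thesis unfolding K ys
    by (simp add: lookup_add mult.assoc lookup_cst_mult M_single) (simp add: algebra_simps)
qed

section \<open>Permutations and coloured words\<close>

lemma card_less_permutes:
  assumes "\<pi> permutes {1..n::nat}" "j \<in> {1..n}"
  shows "card {j' \<in> {1..n}. \<pi> j' < \<pi> j} = \<pi> j - 1"
proof -
  have "\<pi> j \<in> {1..n}" using permutes_in_image[OF assms(1)] assms(2) by blast
  have "bij_betw \<pi> {j' \<in> {1..n}. \<pi> j' < \<pi> j} {1..<\<pi> j}"
  proof (rule bij_betw_imageI)
    show "inj_on \<pi> {j' \<in> {1..n}. \<pi> j' < \<pi> j}"
      using permutes_inj_on[OF assms(1)] by blast
    show "\<pi> ` {j' \<in> {1..n}. \<pi> j' < \<pi> j} = {1..<\<pi> j}"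
    proof safe
      fix x assume x: "x \<in> {1..n}" "\<pi> x < \<pi> j"
      with permutes_in_image[OF assms(1), of x] show "\<pi> x \<in> {1..<\<pi> j}" by auto
    next
      fix y assume y: "y \<in> {1..<\<pi> j}"
      then have "y \<in> {1..n}" using \<open>\<pi> j \<in> {1..n}\<close> by auto
      then obtain x where "x \<in> {1..n}" "\<pi> x = y"
        using permutes_image[OF assms(1)] by (metis imageE)
      with y show "y \<in> \<pi> ` {j' \<in> {1..n}. \<pi> j' < \<pi> j}" by auto
    qed
  qed
  then show ?thesis by (auto dest: bij_betw_same_card)
qed

definition rank_in :: "nat \<Rightarrow> (nat \<Rightarrow> nat \<Rightarrow> bool) \<Rightarrow> nat \<Rightarrow> nat" where
  "rank_in n R j = (if j \<in> {1..n} then Suc (card {j' \<in> {1..n}. R j' j}) else j)"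

locale strict_order_upto =
  fixes n :: nat and R :: "nat \<Rightarrow> nat \<Rightarrow> bool"
  assumes irrefl: "\<not> R j j"
    and trans: "R i j \<Longrightarrow> R j k \<Longrightarrow> R i k"
    and total: "i \<in> {1..n} \<Longrightarrow> j \<in> {1..n} \<Longrightarrow> i \<noteq> j \<Longrightarrow> R i j \<or> R j i"
begin

lemma rank_less:
  assumes "i \<in> {1..n}" "j \<in> {1..n}" "R i j"
  shows "rank_in n R i < rank_in n R j"
proof -
  have "{j' \<in> {1..n}. R j' i} \<subset> {j' \<in> {1..n}. R j' j}"
    using assms trans irrefl by blast
  then have "card {j' \<in> {1..n}. R j' i} < card {j' \<in> {1..n}. R j' j}"
    by (intro psubset_card_mono) auto
  with assms show ?thesis by (simp add: rank_in_def)
qed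

lemma rank_permutes: "rank_in n R permutes {1..n}"
proof (rule bij_imp_permutes)
  have inj: "inj_on (rank_in n R) {1..n}"
    by (rule inj_onI) (metis rank_less total less_irrefl)
  have sub: "rank_in n R ` {1..n} \<subseteq> {1..n}"
  proof safe
    fix j assume j: "j \<in> {1..n}"
    have "{j' \<in> {1..n}. R j' j} \<subset> {1..n}" using j irrefl by blast
    then have "card {j' \<in> {1..n}. R j' j} < card {1..n}" by (intro psubset_card_mono) auto
    with j show "rank_in n R j \<in> {1..n}" by (simp add: rank_in_def)
  qed
  show "bij_betw (rank_in n R) {1..n} {1..n}"
    using inj sub by (simp add: bij_betw_def endo_inj_surj)
qed (simp add: rank_in_def del: atLeastAtMost_iff)

lemma rank_unique:
  assumes \<pi>: "\<pi> permutes {1..n}"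
    and less: "\<And>i j. i \<in> {1..n} \<Longrightarrow> j \<in> {1..n} \<Longrightarrow> R i j \<Longrightarrow> \<pi> i < \<pi> j"
  shows "\<pi> = rank_in n R"
proof
  fix j
  show "\<pi> j = rank_in n R j"
  proof (cases "j \<in> {1..n}")
    case True
    have "{j' \<in> {1..n}. R j' j} = {j' \<in> {1..n}. \<pi> j' < \<pi> j}"
      using less total True by (metis (no_types, lifting) less_asym less_irrefl)
    moreover have "\<pi> j \<ge> 1" using permutes_in_image[OF \<pi>, of j] True by auto
    ultimately show ?thesis using True card_less_permutes[OF \<pi> True] by (simp add: rank_in_def)
  next
    case False
    with permutes_not_in[OF \<pi> False] show ?thesis unfolding rank_in_def if_not_P[OF False] by simp
  qed
qed

end

text \<open>The sublevel sets of a monotone function are initial segments, hence known from their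
  cardinalities.\<close>

lemma mono_eq_if_same_content:
  fixes f g :: "nat \<Rightarrow> nat"
  assumes f: "mono_on {1..n} f" and g: "mono_on {1..n} g"
    and same: "\<And>c. card {i \<in> {1..n}. f i = c} = card {i \<in> {1..n}. g i = c}"
    and i: "i \<in> {1..n}"
  shows "f i = g i"
proof -
  have seg: "{i \<in> {1..n}. h i \<le> c} = {1..card {i \<in> {1..n}. h i \<le> c}}"
    if h: "mono_on {1..n} h" for h :: "nat \<Rightarrow> nat" and c
  proof -
    define A where "A = {i \<in> {1..n}. h i \<le> c}"
    define m where "m = Max (insert 0 A)"
    have fin: "finite A" by (simp add: A_def)
    have "A = {1..m}"
    proof
      show "A \<subseteq> {1..m}" using fin by (auto simp: m_def A_def)
      show "{1..m} \<subseteq> A"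
      proof
        fix x assume x: "x \<in> {1..m}"
        have "m \<in> insert 0 A" unfolding m_def using fin by (intro Max_in) auto
        with x have "m \<in> A" by auto
        with x show "x \<in> A" using monotone_onD[OF h, of x m] by (auto simp: A_def)
      qed
    qed
    then show ?thesis unfolding A_def[symmetric] by simp
  qed
  have card_le: "card {i \<in> {1..n}. f i \<le> c} = card {i \<in> {1..n}. g i \<le> c}" for c
  proof -
    have "card {i \<in> {1..n}. h i \<le> c} = (\<Sum>c'\<le>c. card {i \<in> {1..n}. h i = c'})" for h :: "nat \<Rightarrow> nat"
    proof -
      have "{i \<in> {1..n}. h i \<le> c} = (\<Union>c'\<le>c. {i \<in> {1..n}. h i = c'})" by auto
      then show ?thesis by (subst card_UN_disjoint[symmetric]) auto
    qed
    then show ?thesis using same by simp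
  qed
  have "{i \<in> {1..n}. f i \<le> c} = {i \<in> {1..n}. g i \<le> c}" for c
    using seg[OF f, of c] seg[OF g, of c] unfolding card_le by (rule trans[OF _ sym])
  then have "f i \<le> c \<longleftrightarrow> g i \<le> c" for c using i by blast
  then show ?thesis by (meson le_antisym order_refl)
qed

definition first_in_block :: "(nat \<Rightarrow> nat) \<Rightarrow> nat \<Rightarrow> bool" where
  "first_in_block \<beta> j \<longleftrightarrow> (\<forall>i\<in>{1..<j}. \<beta> i \<noteq> \<beta> j)"

text \<open>Values are sorted by block, then excedance values first, then by size, which is the
  barred order behind \<open>dex\<close>. A permutation has \<open>dex\<close> inside the block
  boundaries exactly when it lists the values in this order.\<close>

definition key_less :: "(nat \<Rightarrow> nat) \<Rightarrow> nat set \<Rightarrow> nat \<Rightarrow> nat \<Rightarrow> bool" where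
  "key_less w C j j' \<longleftrightarrow> w j < w j' \<or>
     w j = w j' \<and> (j \<in> C \<and> j' \<notin> C \<or> (j \<in> C \<longleftrightarrow> j' \<in> C) \<and> j < j')"

interpretation key_less: strict_order_upto n "key_less w C" for n w C
  by unfold_locales (auto simp: key_less_def)

text \<open>
  A permutation \<open>\<sigma>\<close> is encoded by \<open>w j = \<beta> (inv \<sigma> j)\<close> and the set \<open>C\<close> of its excedance values. A first
  position of a block cannot be an excedance value of its own block.
\<close>

definition coloured_words :: "nat \<Rightarrow> (nat \<Rightarrow> nat) \<Rightarrow> ((nat \<Rightarrow> nat) \<times> nat set) set" where
  "coloured_words n \<beta> = {(w, C). w \<in> extensional {1..n} \<and> C \<subseteq> {1..n} \<and>
     (\<forall>c. card {j \<in> {1..n}. w j = c} = card {j \<in> {1..n}. \<beta> j = c}) \<and>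
     (\<forall>j\<in>C. w j < \<beta> j \<or> w j = \<beta> j \<and> \<not> first_in_block \<beta> j) \<and>
     (\<forall>j\<in>{1..n} - C. \<beta> j \<le> w j)}"

text \<open>Read in rank order, w is weakly increasing with the content of \<beta>, hence equal to
  \<beta>. For the second claim a strict inequality between w j and \<beta> j decides at once; for w
  j = \<beta> j the keys below or above that of j have to be counted.\<close>

lemma rank_coloured_word:
  assumes mono: "mono_on {1..n} \<beta>" and wC: "(w, C) \<in> coloured_words n \<beta>"
  defines "\<pi> \<equiv> rank_in n (key_less w C)"
  assumes j: "j \<in> {1..n}"
  shows "\<beta> (\<pi> j) = w j" "\<pi> j < j \<longleftrightarrow> j \<in> C"
proof -
  have \<pi>: "\<pi> permutes {1..n}" unfolding \<pi>_def by (rule key_less.rank_permutes)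
  have \<pi>_in: "\<pi> i \<in> {1..n} \<longleftrightarrow> i \<in> {1..n}" for i by (rule permutes_in_image[OF \<pi>])
  define \<sigma> where "\<sigma> = inv' \<pi>"
  have \<sigma>: "\<sigma> permutes {1..n}" unfolding \<sigma>_def by (rule permutes_inv[OF \<pi>])
  have \<sigma>_in: "\<sigma> i \<in> {1..n} \<longleftrightarrow> i \<in> {1..n}" for i by (rule permutes_in_image[OF \<sigma>])
  have \<pi>\<sigma>: "\<pi> (\<sigma> i) = i" and \<sigma>\<pi>: "\<sigma> (\<pi> i) = i" for i
    unfolding \<sigma>_def using permutes_inverses[OF \<pi>] by auto
  have less: "key_less w C (\<sigma> i) (\<sigma> i')" if "i \<in> {1..n}" "i' \<in> {1..n}" "i < i'" for i i'
    using key_less.total[of "\<sigma> i" n "\<sigma> i'" w C] key_less.rank_less[of "\<sigma> i'" n "\<sigma> i" w C] that \<sigma>_in \<pi>\<sigma>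
    unfolding \<pi>_def by (metis less_asym less_irrefl)
  have content: "card {j \<in> {1..n}. w j = c} = card {j \<in> {1..n}. \<beta> j = c}" for c
    using wC by (auto simp: coloured_words_def)
  have w_mono: "mono_on {1..n} (w \<circ> \<sigma>)"
  proof (rule monotone_onI)
    fix i i' assume "i \<in> {1..n}" "i' \<in> {1..n}" "i \<le> i'"
    then show "(w \<circ> \<sigma>) i \<le> (w \<circ> \<sigma>) i'"
      using less[of i i'] by (cases "i = i'") (auto simp: key_less_def)
  qed
  have w_content: "card {i \<in> {1..n}. (w \<circ> \<sigma>) i = c} = card {i \<in> {1..n}. \<beta> i = c}" for c
  proof -
    have "bij_betw \<sigma> {i \<in> {1..n}. (w \<circ> \<sigma>) i = c} {i \<in> {1..n}. w i = c}"
      by (rule bij_betw_byWitness[where f' = \<pi>]) (use \<pi>_in \<sigma>_in \<pi>\<sigma> \<sigma>\<pi> in auto)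
    then show ?thesis using content by (auto dest: bij_betw_same_card)
  qed
  have "\<pi> j \<in> {1..n}" using \<pi>_in j by blast
  then have "(w \<circ> \<sigma>) (\<pi> j) = \<beta> (\<pi> j)"
    by (rule mono_eq_if_same_content[OF w_mono mono w_content])
  then show \<beta>\<pi>: "\<beta> (\<pi> j) = w j" by (simp add: \<sigma>\<pi>)
  have less_iff: "i < j" if "\<beta> i < \<beta> j" "i \<in> {1..n}" "j \<in> {1..n}" for i j
    using monotone_onD[OF mono, of j i] that by (meson not_le)
  have card_image_eq: "card {i \<in> {1..n}. P (w i)} = card {i \<in> {1..n}. P (\<beta> i)}" for P
  proof -
    define T where "T = w ` {1..n} \<union> \<beta> ` {1..n}"
    have eq: "card {i \<in> {1..n}. P (f i)} = (\<Sum>c\<in>{c \<in> T. P c}. card {i \<in> {1..n}. f i = c})"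
      if "\<And>i. i \<in> {1..n} \<Longrightarrow> f i \<in> T" for f
    proof -
      have "{i \<in> {1..n}. P (f i)} = (\<Union>c\<in>{c \<in> T. P c}. {i \<in> {1..n}. f i = c})"
        using that by (auto simp del: atLeastAtMost_iff)
      moreover have "finite {c \<in> T. P c}" by (simp add: T_def)
      ultimately show ?thesis by (subst card_UN_disjoint[symmetric]) auto
    qed
    have "card {i \<in> {1..n}. P (w i)} = (\<Sum>c\<in>{c \<in> T. P c}. card {i \<in> {1..n}. w i = c})"
      by (rule eq) (simp add: T_def)
    also have "\<dots> = card {i \<in> {1..n}. P (\<beta> i)}"
      unfolding content by (rule eq[symmetric]) (simp add: T_def)
    finally show ?thesis .
  qed
  show "\<pi> j < j \<longleftrightarrow> j \<in> C"
  proof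
    assume jC: "j \<in> C"
    then have le: "w j < \<beta> j \<or> w j = \<beta> j \<and> \<not> first_in_block \<beta> j"
      using wC by (auto simp: coloured_words_def)
    show "\<pi> j < j"
    proof (cases "w j < \<beta> j")
      case True
      then show ?thesis using less_iff \<beta>\<pi> \<pi>_in j by auto
    next
      case False
      with le have eq: "w j = \<beta> j" and nf: "\<not> first_in_block \<beta> j" by auto
      \<comment> \<open>f starts the block of j. It cannot carry the letter of its own block as a
        coloured letter, and leaving it out is what makes the bound on the rank strict.\<close>
      define f where "f = (LEAST i. i \<in> {1..n} \<and> \<beta> i = \<beta> j)"
      have f: "f \<in> {1..n}" "\<beta> f = \<beta> j" and f_le: "\<And>i. i \<in> {1..n} \<Longrightarrow> \<beta> i = \<beta> j \<Longrightarrow> f \<le> i"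
        unfolding f_def using LeastI[of "\<lambda>i. i \<in> {1..n} \<and> \<beta> i = \<beta> j" j] j by (auto intro: Least_le)
      have f_first: "first_in_block \<beta> f"
        unfolding first_in_block_def using f f_le by force
      have fj: "f < j"
        using nf f f_le[OF j] f_first by (cases "f = j") auto
      have "{j' \<in> {1..n}. key_less w C j' j} =
         {j' \<in> {1..n}. w j' < \<beta> j} \<union> {j' \<in> {1..n}. w j' = \<beta> j \<and> j' \<in> C \<and> j' < j}"
        using jC eq by (auto simp: key_less_def)
      then have "card {j' \<in> {1..n}. key_less w C j' j} =
         card {j' \<in> {1..n}. w j' < \<beta> j} + card {j' \<in> {1..n}. w j' = \<beta> j \<and> j' \<in> C \<and> j' < j}"
        by (simp only:) (intro card_Un_disjoint; auto)
      \<comment> \<open>A coloured j' with the letter of j satisfies \<beta> j' \<ge> \<beta> j, so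
        it is disjoint from the positions of smaller blocks counted by the first summand.\<close>
      also have "card {j' \<in> {1..n}. w j' < \<beta> j} = card {j' \<in> {1..n}. \<beta> j' < \<beta> j}"
        by (rule card_image_eq)
      also have "card {j' \<in> {1..n}. w j' = \<beta> j \<and> j' \<in> C \<and> j' < j} \<le>
          card {j' \<in> {1..n} - {f}. j' < j \<and> \<beta> j \<le> \<beta> j'}"
        using wC f f_first by (intro card_mono) (auto simp: coloured_words_def)
      also have "card {j' \<in> {1..n}. \<beta> j' < \<beta> j} + card {j' \<in> {1..n} - {f}. j' < j \<and> \<beta> j \<le> \<beta> j'} =
          card ({j' \<in> {1..n}. \<beta> j' < \<beta> j} \<union> {j' \<in> {1..n} - {f}. j' < j \<and> \<beta> j \<le> \<beta> j'})"
        by (intro card_Un_disjoint[symmetric]) auto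
      also have "{j' \<in> {1..n}. \<beta> j' < \<beta> j} \<union> {j' \<in> {1..n} - {f}. j' < j \<and> \<beta> j \<le> \<beta> j'} = {1..<j} - {f}"
        using f j less_iff[of _ j] by auto
      also have "card ({1..<j} - {f}) = j - 2" using f fj by simp
      finally show ?thesis using j fj f by (simp add: \<pi>_def rank_in_def)
    qed
  next
    assume "\<pi> j < j"
    show "j \<in> C"
    proof (rule ccontr)
      assume jC: "j \<notin> C"
      then have "\<beta> j \<le> w j" using wC j by (auto simp: coloured_words_def)
      then have eq: "w j = \<beta> j" 
        using \<open>\<pi> j < j\<close> less_iff[of j "\<pi> j"] \<beta>\<pi> \<pi>_in[of j] j by fastforce
      \<comment> \<open>The dual count: the keys above that of j inject into the positions beyond j,
        so there are at most n - j of them.\<close>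
      have "n - \<pi> j = card {i \<in> {1..n}. key_less w C j i}"
      proof -
        have "{1..n} = {i \<in> {1..n}. key_less w C i j} \<union> insert j {i \<in> {1..n}. key_less w C j i}"
          using j key_less.total[of _ n j w C] by blast
        then have "n = card ({i \<in> {1..n}. key_less w C i j} \<union> insert j {i \<in> {1..n}. key_less w C j i})"
          by (metis card_atLeastAtMost diff_Suc_1)
        also have "\<dots> = card {i \<in> {1..n}. key_less w C i j} + card (insert j {i \<in> {1..n}. key_less w C j i})"
          using key_less.irrefl key_less.trans by (intro card_Un_disjoint) (auto simp: key_less_def)
        also have "card (insert j {i \<in> {1..n}. key_less w C j i}) = Suc (card {i \<in> {1..n}. key_less w C j i})"
          by (rule card_insert_disjoint) (auto simp: key_less.irrefl)
        finally show ?thesis using j by (simp add: \<pi>_def rank_in_def)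
      qed
      also have "{i \<in> {1..n}. key_less w C j i} =
          {i \<in> {1..n}. \<beta> j < w i} \<union> {i \<in> {1..n}. w i = \<beta> j \<and> i \<notin> C \<and> j < i}"
        using jC eq by (auto simp: key_less_def)
      also have "card \<dots> = card {i \<in> {1..n}. \<beta> j < w i} + card {i \<in> {1..n}. w i = \<beta> j \<and> i \<notin> C \<and> j < i}"
        by (intro card_Un_disjoint) auto
      also have "card {i \<in> {1..n}. \<beta> j < w i} = card {i \<in> {1..n}. \<beta> j < \<beta> i}"
        by (rule card_image_eq)
      also have "card {i \<in> {1..n}. w i = \<beta> j \<and> i \<notin> C \<and> j < i} \<le> card {i \<in> {1..n}. j < i \<and> \<beta> i \<le> \<beta> j}"
      proof (intro card_mono)
        have "\<beta> i \<le> w i" if "i \<in> {1..n}" "i \<notin> C" for i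
          using wC that by (auto simp: coloured_words_def)
        then have "\<beta> i \<le> \<beta> j" if "i \<in> {1..n}" "w i = \<beta> j" "i \<notin> C" for i
          using that by fastforce
        then show "{i \<in> {1..n}. w i = \<beta> j \<and> i \<notin> C \<and> j < i} \<subseteq> {i \<in> {1..n}. j < i \<and> \<beta> i \<le> \<beta> j}"
          by blast
      qed simp
      also have "card {i \<in> {1..n}. \<beta> j < \<beta> i} + card {i \<in> {1..n}. j < i \<and> \<beta> i \<le> \<beta> j} =
          card ({i \<in> {1..n}. \<beta> j < \<beta> i} \<union> {i \<in> {1..n}. j < i \<and> \<beta> i \<le> \<beta> j})"
        by (intro card_Un_disjoint[symmetric]) auto
      also have "{i \<in> {1..n}. \<beta> j < \<beta> i} \<union> {i \<in> {1..n}. j < i \<and> \<beta> i \<le> \<beta> j} = {j<..n}"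
        using j less_iff[of j] by auto
      finally show False using \<open>\<pi> j < j\<close> j by simp
    qed
  qed
qed

text \<open>Sorting with \<open>key_less\<close> inverts the encoding: if \<open>dex\<close> meets
  only block boundaries, the keys of consecutive values increase, so the inverse permutation is the
  rank. \<open>rank_coloured_word\<close> supplies the other direction. Colours mark excedance
  values, which are as many as excedance positions.\<close>

lemma sum_dex_free_permutations:
  fixes t :: real
  assumes mono: "mono_on {1..n} \<beta>"
  shows "(\<Sum>\<sigma> | \<sigma> permutes {1..n} \<and> (\<forall>i\<in>dex n \<sigma>. \<beta> i \<noteq> \<beta> (Suc i)). t ^ exc n \<sigma>) =
         (\<Sum>(w, C)\<in>coloured_words n \<beta>. t ^ card C)"
proof (rule sum.reindex_bij_witness[where
    j = "\<lambda>\<sigma>. (restrict (\<beta> \<circ> inv' \<sigma>) {1..n}, {j \<in> {1..n}. inv' \<sigma> j < j})" and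
    i = "\<lambda>(w, C). inv' (rank_in n (key_less w C))"])
  fix \<sigma> assume "\<sigma> \<in> {\<sigma>. \<sigma> permutes {1..n} \<and> (\<forall>i\<in>dex n \<sigma>. \<beta> i \<noteq> \<beta> (Suc i))}"
  then have \<sigma>: "\<sigma> permutes {1..n}" and free: "\<And>i. i \<in> dex n \<sigma> \<Longrightarrow> \<beta> i \<noteq> \<beta> (Suc i)" by auto
  define \<pi> where "\<pi> = inv' \<sigma>"
  define w where "w = restrict (\<beta> \<circ> \<pi>) {1..n}"
  define C where "C = {j \<in> {1..n}. \<pi> j < j}"
  have \<pi>: "\<pi> permutes {1..n}" unfolding \<pi>_def by (rule permutes_inv[OF \<sigma>])
  have \<sigma>_in: "\<sigma> i \<in> {1..n} \<longleftrightarrow> i \<in> {1..n}" for i by (rule permutes_in_image[OF \<sigma>])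
  have \<pi>_in: "\<pi> i \<in> {1..n} \<longleftrightarrow> i \<in> {1..n}" for i by (rule permutes_in_image[OF \<pi>])
  have \<pi>\<sigma>: "\<pi> (\<sigma> i) = i" and \<sigma>\<pi>: "\<sigma> (\<pi> i) = i" for i
    unfolding \<pi>_def using permutes_inverses[OF \<sigma>] by auto
  \<comment> \<open>Either \<beta> rises at i, or i is not in \<open>dex\<close> and the barred
    order increases.\<close>
  have step: "key_less w C (\<sigma> i) (\<sigma> (Suc i))" if i: "i \<in> {1..<n}" for i
  proof -
    have in1: "i \<in> {1..n}" "Suc i \<in> {1..n}" using i by auto
    have w: "w (\<sigma> i) = \<beta> i" "w (\<sigma> (Suc i)) = \<beta> (Suc i)" using in1 \<sigma>_in by (auto simp: w_def \<pi>\<sigma> simp del: atLeastAtMost_iff)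
    have C: "\<sigma> i \<in> C \<longleftrightarrow> i < \<sigma> i" "\<sigma> (Suc i) \<in> C \<longleftrightarrow> Suc i < \<sigma> (Suc i)"
      using in1 \<sigma>_in by (auto simp: C_def \<pi>\<sigma> simp del: atLeastAtMost_iff)
    have "\<beta> i \<le> \<beta> (Suc i)" using monotone_onD[OF mono in1] by simp
    moreover have "\<sigma> i < \<sigma> (Suc i) \<or> \<sigma> (Suc i) < \<sigma> i"
      using permutes_inj[OF \<sigma>] by (simp add: inj_eq flip: neq_iff)
    ultimately show ?thesis
      using free[of i] i unfolding key_less_def w C
      by (cases "i < \<sigma> i"; cases "Suc i < \<sigma> (Suc i)") (auto simp: dex_def)
  qed
  have less: "key_less w C (\<sigma> i) (\<sigma> i')" if "i < i'" "1 \<le> i" "i' \<le> n" for i i'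
    using that
  proof (induction i' rule: less_Suc_induct)
    case (1 i)
    then show ?case using step[of i] by simp
  next
    case (2 i j k)
    then show ?case using key_less.trans by auto
  qed
  have "\<pi> = rank_in n (key_less w C)"
  proof (rule key_less.rank_unique[OF \<pi>])
    fix i j assume ij: "i \<in> {1..n}" "j \<in> {1..n}" "key_less w C i j"
    show "\<pi> i < \<pi> j"
    proof (rule ccontr)
      assume "\<not> \<pi> i < \<pi> j"
      moreover have "\<pi> i \<noteq> \<pi> j" using ij key_less.irrefl \<sigma>\<pi> by metis
      ultimately have "key_less w C (\<sigma> (\<pi> j)) (\<sigma> (\<pi> i))"
        using \<pi>_in[of i] \<pi>_in[of j] ij by (intro less) auto
      then show False using key_less.trans key_less.irrefl ij by (metis \<sigma>\<pi>)
    qed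
  qed
  then have "inv' (rank_in n (key_less w C)) = \<sigma>"
    using permutes_inv_inv[OF \<sigma>] by (simp add: \<pi>_def)
  then show "(case (restrict (\<beta> \<circ> inv' \<sigma>) {1..n}, {j \<in> {1..n}. inv' \<sigma> j < j}) of (w, C) \<Rightarrow> inv' (rank_in n (key_less w C))) = \<sigma>"
    by (simp add: w_def C_def \<pi>_def)
  have "(w, C) \<in> coloured_words n \<beta>"
    unfolding coloured_words_def
  proof (safe)
    show "w \<in> extensional {1..n}" by (simp add: w_def)
    show "j \<in> {1..n}" if "j \<in> C" for j using that by (simp add: C_def)
  next
    fix c
    have "bij_betw \<pi> {j \<in> {1..n}. w j = c} {j \<in> {1..n}. \<beta> j = c}"
      by (rule bij_betw_byWitness[where f' = \<sigma>]) (use \<pi>_in \<sigma>_in \<pi>\<sigma> \<sigma>\<pi> in \<open>auto simp: w_def\<close>)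
    then show "card {j \<in> {1..n}. w j = c} = card {j \<in> {1..n}. \<beta> j = c}" by (rule bij_betw_same_card)
  next
    fix j assume j: "j \<in> C" "\<not> w j < \<beta> j"
    then have jn: "j \<in> {1..n}" "\<pi> j \<in> {1..n}" and lt: "\<pi> j < j" using \<pi>_in by (auto simp: C_def)
    then have "\<beta> (\<pi> j) \<le> \<beta> j" using monotone_onD[OF mono] by simp
    with j jn show eq: "w j = \<beta> j" by (simp add: w_def)
    assume "first_in_block \<beta> j"
    with lt jn eq show False by (auto simp: first_in_block_def w_def)
  next
    fix j assume j: "j \<in> {1..n}" "j \<notin> C"
    then have jn: "\<pi> j \<in> {1..n}" and ge: "j \<le> \<pi> j" using \<pi>_in by (auto simp: C_def)
    with j show "\<beta> j \<le> w j" using monotone_onD[OF mono, of j "\<pi> j"] by (simp add: w_def)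
  qed
  then show "(restrict (\<beta> \<circ> inv' \<sigma>) {1..n}, {j \<in> {1..n}. inv' \<sigma> j < j}) \<in> coloured_words n \<beta>"
    by (simp add: w_def C_def \<pi>_def)
  have "bij_betw \<pi> C {i \<in> {1..n}. i < \<sigma> i}"
    by (rule bij_betw_byWitness[where f' = \<sigma>]) (use \<pi>_in \<sigma>_in \<pi>\<sigma> \<sigma>\<pi> in \<open>auto simp: C_def\<close>)
  then have "card C = exc n \<sigma>" by (simp add: exc_def bij_betw_same_card)
  then show "(case (restrict (\<beta> \<circ> inv' \<sigma>) {1..n}, {j \<in> {1..n}. inv' \<sigma> j < j}) of (w, C) \<Rightarrow> t ^ card C) = t ^ exc n \<sigma>"
    by (simp add: C_def \<pi>_def)
next
  fix p assume "p \<in> coloured_words n \<beta>"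
  then obtain w C where p: "p = (w, C)" and wC: "(w, C) \<in> coloured_words n \<beta>" by (cases p) auto
  define \<pi> where "\<pi> = rank_in n (key_less w C)"
  have \<pi>: "\<pi> permutes {1..n}" unfolding \<pi>_def by (rule key_less.rank_permutes)
  have rank: "\<beta> (\<pi> j) = w j" "\<pi> j < j \<longleftrightarrow> j \<in> C" if "j \<in> {1..n}" for j
    unfolding \<pi>_def using rank_coloured_word[OF mono wC that] by auto
  have inv_inv: "inv' (inv' \<pi>) = \<pi>" by (rule permutes_inv_inv[OF \<pi>])
  have ext: "w \<in> extensional {1..n}" "C \<subseteq> {1..n}" using wC by (auto simp: coloured_words_def)
  have 1: "restrict (\<beta> \<circ> inv' (inv' \<pi>)) {1..n} = w"
    unfolding inv_inv using ext rank by (intro extensionalityI[of _ "{1..n}"]) auto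
  have 2: "{j \<in> {1..n}. inv' (inv' \<pi>) j < j} = C"
    unfolding inv_inv using ext rank by auto
  show "(\<lambda>\<sigma>. (restrict (\<beta> \<circ> inv' \<sigma>) {1..n}, {j \<in> {1..n}. inv' \<sigma> j < j})) (case p of (w, C) \<Rightarrow> inv' (rank_in n (key_less w C))) = p"
    using 1 2 by (simp add: p \<pi>_def)
  define \<sigma> where "\<sigma> = inv' \<pi>"
  have \<sigma>: "\<sigma> permutes {1..n}" unfolding \<sigma>_def by (rule permutes_inv[OF \<pi>])
  have \<sigma>_in: "\<sigma> i \<in> {1..n} \<longleftrightarrow> i \<in> {1..n}" for i by (rule permutes_in_image[OF \<sigma>])
  have \<pi>\<sigma>: "\<pi> (\<sigma> i) = i" for i
    unfolding \<sigma>_def using permutes_inverses[OF \<pi>] by auto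
  have "\<beta> i \<noteq> \<beta> (Suc i)" if i: "i \<in> dex n \<sigma>" for i
  proof
    assume eq: "\<beta> i = \<beta> (Suc i)"
    have in1: "i \<in> {1..n}" "Suc i \<in> {1..n}" using i dex_subset[of n \<sigma>] by auto
    then have in2: "\<sigma> i \<in> {1..n}" "\<sigma> (Suc i) \<in> {1..n}" using \<sigma>_in by blast+
    have "\<not> key_less w C (\<sigma> (Suc i)) (\<sigma> i)"
      using key_less.rank_less[OF in2(2) in2(1), of w C] \<pi>\<sigma> unfolding \<pi>_def[symmetric] by auto
    moreover have "w (\<sigma> i) = w (\<sigma> (Suc i))" using rank(1)[OF in2(1)] rank(1)[OF in2(2)] eq \<pi>\<sigma> by simp
    moreover have "\<sigma> i \<in> C \<longleftrightarrow> i < \<sigma> i" "\<sigma> (Suc i) \<in> C \<longleftrightarrow> Suc i < \<sigma> (Suc i)"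
      using rank(2)[OF in2(1)] rank(2)[OF in2(2)] \<pi>\<sigma> by auto
    ultimately show False using i by (auto simp: dex_def key_less_def split: if_splits)
  qed
  with \<sigma> show "(case p of (w, C) \<Rightarrow> inv' (rank_in n (key_less w C))) \<in> {\<sigma>. \<sigma> permutes {1..n} \<and> (\<forall>i\<in>dex n \<sigma>. \<beta> i \<noteq> \<beta> (Suc i))}"
    by (simp add: p \<sigma>_def \<pi>_def)
qed

section \<open>Coloured words as coefficients of products of linear forms\<close>

lemma lookup_prod_linear_forms:
  assumes "finite P"
  shows "Poly_Mapping.lookup (\<Prod>j\<in>P. \<Sum>c<s. cst (u j c) * var c) (content_mon s a) =
    (\<Sum>w | w \<in> P \<rightarrow>\<^sub>E {..<s} \<and> (\<forall>c<s. card {j \<in> P. w j = c} = a c). \<Prod>j\<in>P. u j (w j))"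
proof -
  have prod_var: "(\<Prod>j\<in>P. var (w j)) = Poly_Mapping.single (content_mon s (\<lambda>c. card {j \<in> P. w j = c})) 1"
    if "w \<in> P \<rightarrow>\<^sub>E {..<s}" for w
  proof -
    have "(\<Prod>j\<in>P. var (w j)) = Poly_Mapping.single (\<Sum>j\<in>P. Poly_Mapping.single (w j) 1) 1"
      using assms by (induction P) (simp_all add: var_def mult_single)
    also have "(\<Sum>j\<in>P. Poly_Mapping.single (w j) 1) = content_mon s (\<lambda>c. card {j \<in> P. w j = c})"
      using that assms
      by (intro poly_mapping_eqI)
         (auto simp: lookup_sum lookup_single when_def lookup_content_mon sum.If_cases Int_def PiE_iff)
    finally show ?thesis .
  qed
  have inj: "content_mon s b = content_mon s a \<longleftrightarrow> (\<forall>c<s. b c = a c)" for b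
    by (metis (no_types, lifting) content_mon_def lessThan_iff lookup_content_mon sum.cong)
  have "(\<Prod>j\<in>P. \<Sum>c<s. cst (u j c) * var c) = (\<Sum>w\<in>P \<rightarrow>\<^sub>E {..<s}. \<Prod>j\<in>P. cst (u j (w j)) * var (w j))"
    by (rule prod_sum_PiE) (use assms in auto)
  also have "\<dots> = (\<Sum>w\<in>P \<rightarrow>\<^sub>E {..<s}. cst (\<Prod>j\<in>P. u j (w j)) * Poly_Mapping.single (content_mon s (\<lambda>c. card {j \<in> P. w j = c})) 1)"
    by (intro sum.cong refl) (simp add: prod.distrib cst_prod prod_var)
  finally have "Poly_Mapping.lookup (\<Prod>j\<in>P. \<Sum>c<s. cst (u j c) * var c) (content_mon s a) =
     (\<Sum>w\<in>P \<rightarrow>\<^sub>E {..<s}. if \<forall>c<s. card {j \<in> P. w j = c} = a c then \<Prod>j\<in>P. u j (w j) else 0)"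
    by (simp add: lookup_sum lookup_cst_mult lookup_single when_def inj if_distrib cong: if_cong)
  also have "\<dots> = (\<Sum>w | w \<in> P \<rightarrow>\<^sub>E {..<s} \<and> (\<forall>c<s. card {j \<in> P. w j = c} = a c). \<Prod>j\<in>P. u j (w j))"
    by (rule sum.mono_neutral_cong_right) (use assms in \<open>auto simp: finite_PiE\<close>)
  finally show ?thesis .
qed

text \<open>The form of the first position of block B: a letter c < B must be coloured and weighs t,
  a letter c \<ge> B must be plain and weighs 1.\<close>

definition yform :: "nat \<Rightarrow> real \<Rightarrow> nat \<Rightarrow> mpol" where
  "yform s t B = (\<Sum>c<s. cst (if c < B then t else 1) * var c)"

lemma yform_Suc: "B < s \<Longrightarrow> yform s t (Suc B) = yform s t B + cst (t - 1) * var B"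
proof -
  assume "B < s"
  have "yform s t (Suc B) = (\<Sum>c<s. cst (if c < B then t else 1) * var c + (if c = B then cst (t - 1) * var c else 0))"
    unfolding yform_def
    by (intro sum.cong refl) (auto simp: cst_add less_Suc_eq simp flip: distrib_right)
  also have "\<dots> = yform s t B + cst (t - 1) * var B"
    using \<open>B < s\<close> by (simp add: sum.distrib yform_def)
  finally show ?thesis .
qed

lemma yform_top: "yform s t s = cst t * yform s t 0"
  by (simp add: yform_def cst_1 sum_distrib_left)

text \<open>Every position but the first may also take a coloured B, hence the extra t * u_B in the
  remaining m - 1 factors.\<close>

definition block_factor :: "nat \<Rightarrow> real \<Rightarrow> nat \<Rightarrow> nat \<Rightarrow> mpol" where
  "block_factor s t B m = (if m = 0 then 1 else yform s t B * (yform s t B + cst t * var B) ^ (m - 1))"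

text \<open>The letters and colours allowed at j depend only on \<beta> j and on
  \<open>first_in_block\<close>, so the positions are independent and the prescribed content selects
  a coefficient. In the proof, \<open>f\<close> weighs coloured letters and \<open>g\<close> plain
  ones.\<close>

lemma sum_coloured_words:
  assumes \<beta>: "\<And>j. j \<in> {1..n} \<Longrightarrow> \<beta> j < s"
  shows "(\<Sum>(w, C)\<in>coloured_words n \<beta>. t ^ card C) =
    Poly_Mapping.lookup (\<Prod>B<s. block_factor s t B (card {j \<in> {1..n}. \<beta> j = B}))
      (content_mon s (\<lambda>B. card {j \<in> {1..n}. \<beta> j = B}))"
proof -
  define a where "a B = card {j \<in> {1..n}. \<beta> j = B}" for B
  define f where "f j c = (if c < \<beta> j \<or> c = \<beta> j \<and> \<not> first_in_block \<beta> j then t else 0)" for j c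
  define g where "g j c = (if \<beta> j \<le> c then 1 else 0 :: real)" for j c
  define L where "L j = (\<Sum>c<s. cst (f j c + g j c) * var c)" for j
  define W where "W = {w. w \<in> {1..n} \<rightarrow>\<^sub>E {..<s} \<and> (\<forall>c<s. card {j \<in> {1..n}. w j = c} = a c)}"
  have finW: "finite W" unfolding W_def
    by (rule finite_subset[of _ "{1..n} \<rightarrow>\<^sub>E {..<s}"]) (auto intro: finite_PiE)
  have L_eq: "L j = (if first_in_block \<beta> j then yform s t (\<beta> j) else yform s t (\<beta> j) + cst t * var (\<beta> j))"
    if "j \<in> {1..n}" for j
  proof -
    have "L j = (\<Sum>c<s. cst (if c < \<beta> j then t else 1) * var c +
        (if c = \<beta> j then (if first_in_block \<beta> j then 0 else cst t * var c) else 0))"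
      unfolding L_def
      by (intro sum.cong refl) (auto simp: f_def g_def cst_0 cst_add add.commute simp flip: distrib_right)
    also have "\<dots> = yform s t (\<beta> j) + (if first_in_block \<beta> j then 0 else cst t * var (\<beta> j))"
      using \<beta>[OF that] by (simp add: sum.distrib yform_def)
    finally show ?thesis by simp
  qed
  have block: "(\<Prod>j\<in>{j \<in> {1..n}. \<beta> j = B}. L j) = block_factor s t B (a B)" for B
  proof (cases "{j \<in> {1..n}. \<beta> j = B} = {}")
    case True
    then have "a B = 0" by (simp only: a_def card.empty)
    then show ?thesis unfolding True by (simp add: block_factor_def)
  next
    case False
    define A where "A = {j \<in> {1..n}. \<beta> j = B}"
    define m where "m = Min A"
    have fin: "finite A" and ne: "A \<noteq> {}" using False by (auto simp: A_def)
    have m: "m \<in> A" and m_le: "\<And>j. j \<in> A \<Longrightarrow> m \<le> j"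
      using fin ne by (auto simp: m_def)
    have first: "first_in_block \<beta> j \<longleftrightarrow> j = m" if "j \<in> A" for j
    proof
      assume "first_in_block \<beta> j"
      then show "j = m" using that m m_le[OF that] unfolding first_in_block_def A_def by force
    next
      assume "j = m"
      show "first_in_block \<beta> j" unfolding first_in_block_def
      proof
        fix i assume "i \<in> {1..<j}"
        then show "\<beta> i \<noteq> \<beta> j" using m_le[of i] \<open>j = m\<close> m by (auto simp: A_def)
      qed
    qed
    have "(\<Prod>j\<in>A. L j) = L m * (\<Prod>j\<in>A - {m}. L j)" by (rule prod.remove[OF fin m])
    also have "L m = yform s t B" using m first[OF m] L_eq[of m] by (simp add: A_def)
    also have "(\<Prod>j\<in>A - {m}. L j) = (\<Prod>j\<in>A - {m}. yform s t B + cst t * var B)"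
      by (intro prod.cong refl) (use L_eq first in \<open>auto simp: A_def\<close>)
    also have "\<dots> = (yform s t B + cst t * var B) ^ (card A - 1)" using fin m by simp
    finally have "(\<Prod>j\<in>A. L j) = yform s t B * (yform s t B + cst t * var B) ^ (a B - 1)"
      by (simp only: a_def A_def)
    moreover have "a B \<noteq> 0" using ne fin unfolding a_def A_def[symmetric] by simp
    ultimately show ?thesis unfolding A_def[symmetric] block_factor_def by simp
  qed
  have "(\<Prod>B<s. block_factor s t B (a B)) = (\<Prod>j\<in>{1..n}. L j)"
    unfolding block[symmetric] by (rule prod.group) (use \<beta> in auto)
  then have "Poly_Mapping.lookup (\<Prod>B<s. block_factor s t B (a B)) (content_mon s a) =
     (\<Sum>w\<in>W. \<Prod>j\<in>{1..n}. f j (w j) + g j (w j))"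
    unfolding L_def W_def by (simp only: lookup_prod_linear_forms finite_atLeastAtMost)
  \<comment> \<open>Choosing \<open>f\<close> or \<open>g\<close> at every position amounts to
    choosing the coloured set C.\<close>
  also have "\<dots> = (\<Sum>w\<in>W. \<Sum>C\<in>Pow {1..n}. (\<Prod>j\<in>C. f j (w j)) * (\<Prod>j\<in>{1..n} - C. g j (w j)))"
    by (subst prod_add) auto
  also have "\<dots> = (\<Sum>(w, C)\<in>W \<times> Pow {1..n}. (\<Prod>j\<in>C. f j (w j)) * (\<Prod>j\<in>{1..n} - C. g j (w j)))"
    by (simp add: sum.cartesian_product)
  also have "\<dots> = (\<Sum>(w, C)\<in>coloured_words n \<beta>. t ^ card C)"
  proof (rule sum.mono_neutral_cong_right)
    show "finite (W \<times> Pow {1..n})" using finW by simp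
    show "coloured_words n \<beta> \<subseteq> W \<times> Pow {1..n}"
    proof (rule subrelI)
      fix w C assume wC: "(w, C) \<in> coloured_words n \<beta>"
      have "w j < s" if "j \<in> {1..n}" for j
      proof -
        have "card {i \<in> {1..n}. w i = w j} \<noteq> 0" using that by auto
        moreover have "card {i \<in> {1..n}. w i = w j} = card {i \<in> {1..n}. \<beta> i = w j}"
          using wC by (auto simp: coloured_words_def)
        ultimately have "{i \<in> {1..n}. \<beta> i = w j} \<noteq> {}" by (metis card.empty)
        then obtain i where "i \<in> {1..n}" "\<beta> i = w j" by blast
        then show ?thesis using \<beta>[of i] by simp
      qed
      with wC show "(w, C) \<in> W \<times> Pow {1..n}"
        by (auto simp: coloured_words_def W_def a_def PiE_iff)
    qed
    have outside: "card {j \<in> {1..n}. w j = c} = card {j \<in> {1..n}. \<beta> j = c}" if "w \<in> W" for w c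
    proof (cases "c < s")
      case False
      then have "{j \<in> {1..n}. w j = c} = {}" "{j \<in> {1..n}. \<beta> j = c} = {}"
        using that \<beta> by (auto simp: W_def PiE_iff)
      then show ?thesis by (simp only:)
    qed (use that in \<open>auto simp: W_def a_def\<close>)
    show "\<forall>p\<in>W \<times> Pow {1..n} - coloured_words n \<beta>.
       (case p of (w, C) \<Rightarrow> (\<Prod>j\<in>C. f j (w j)) * (\<Prod>j\<in>{1..n} - C. g j (w j))) = 0"
    proof (rule ballI)
      fix p assume "p \<in> W \<times> Pow {1..n} - coloured_words n \<beta>"
      then obtain w C where p: "p = (w, C)"
        and *: "w \<in> W" "C \<subseteq> {1..n}" "(w, C) \<notin> coloured_words n \<beta>" by auto
      have "w \<in> extensional {1..n}" using * by (auto simp: W_def PiE_iff)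
      with * outside[OF *(1)] consider
          j where "j \<in> C" "\<not> (w j < \<beta> j \<or> w j = \<beta> j \<and> \<not> first_in_block \<beta> j)"
        | j where "j \<in> {1..n} - C" "\<not> \<beta> j \<le> w j"
        unfolding coloured_words_def by blast
      then have "(\<Prod>j\<in>C. f j (w j)) * (\<Prod>j\<in>{1..n} - C. g j (w j)) = 0"
      proof cases
        case 1
        then have "(\<Prod>j\<in>C. f j (w j)) = 0"
          using * by (intro prod_zero) (auto simp: f_def intro: finite_subset)
        then show ?thesis by simp
      next
        case 2
        then have "(\<Prod>j\<in>{1..n} - C. g j (w j)) = 0"
          by (intro prod_zero) (auto simp: g_def)
        then show ?thesis by simp
      qed
      then show "(case p of (w, C) \<Rightarrow> (\<Prod>j\<in>C. f j (w j)) * (\<Prod>j\<in>{1..n} - C. g j (w j))) = 0"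
        by (simp add: p)
    qed
    show "(case p of (w, C) \<Rightarrow> (\<Prod>j\<in>C. f j (w j)) * (\<Prod>j\<in>{1..n} - C. g j (w j))) =
       (case p of (w, C) \<Rightarrow> t ^ card C)" if "p \<in> coloured_words n \<beta>" for p
    proof -
      obtain w C where p: "p = (w, C)" by (cases p)
      have "(\<Prod>j\<in>C. f j (w j)) = (\<Prod>j\<in>C. t)"
        by (intro prod.cong refl) (use that in \<open>auto simp: p f_def coloured_words_def\<close>)
      moreover have "(\<Prod>j\<in>{1..n} - C. g j (w j)) = 1"
        by (intro prod.neutral) (use that in \<open>auto simp: p g_def coloured_words_def\<close>)
      ultimately show ?thesis by (simp add: p)
    qed
  qed
  finally show ?thesis unfolding a_def[abs_def] by (rule sym)
qed

section \<open>Blocks of a composition\<close>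

primrec block_of :: "nat list \<Rightarrow> nat \<Rightarrow> nat" where
  "block_of [] j = 0"
| "block_of (m # a) j = (if j \<le> sum_list a then block_of a j else length a)"

lemma block_of_less: "1 \<le> j \<Longrightarrow> j \<le> sum_list a \<Longrightarrow> block_of a j < length a"
  by (induction a) (auto simp: less_Suc_eq)

lemma block_of_mono: "mono_on {1..sum_list a} (block_of a)"
proof (induction a)
  case (Cons m a)
  show ?case
  proof (rule monotone_onI)
    fix i j assume ij: "i \<in> {1..sum_list (m # a)}" "j \<in> {1..sum_list (m # a)}" "i \<le> j"
    then show "block_of (m # a) i \<le> block_of (m # a) j"
      using monotone_onD[OF Cons, of i j] block_of_less[of i a] by auto
  qed
qed simp

lemma block_of_eq_iff:
  "1 \<le> i \<Longrightarrow> i < sum_list a \<Longrightarrow> block_of a i = block_of a (Suc i) \<longleftrightarrow> i \<notin> partial_sums a"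
proof (induction a)
  case (Cons m a)
  have ps: "partial_sums a \<subseteq> {..sum_list a}" by (induction a) auto
  consider "i < sum_list a" | "i = sum_list a" | "i > sum_list a" by linarith
  then show ?case
  proof cases
    case 1
    with Cons show ?thesis by auto
  next
    case 2
    with block_of_less[of i a] Cons.prems show ?thesis by auto
  next
    case 3
    with ps show ?thesis by force
  qed
qed simp

lemma card_block_of:
  "B < length a \<Longrightarrow> card {j \<in> {1..sum_list a}. block_of a j = B} = rev a ! B"
proof (induction a)
  case (Cons m a)
  show ?case
  proof (cases "B < length a")
    case True
    then have "{j \<in> {1..sum_list (m # a)}. block_of (m # a) j = B} = {j \<in> {1..sum_list a}. block_of a j = B}"
      by auto
    with True Cons.IH show ?thesis by (simp add: nth_append)
  next
    case False
    with Cons.prems have B: "B = length a" by simp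
    have "{j \<in> {1..sum_list (m # a)}. block_of (m # a) j = B} = {sum_list a<..sum_list (m # a)}"
    proof -
      have "sum_list a < x" if "1 \<le> x" "block_of a x = length a" for x
        using block_of_less[of x a] that by (rule_tac ccontr) auto
      then show ?thesis using B by (auto simp: not_le)
    qed
    then show ?thesis by (simp add: B nth_append)
  qed
qed simp

text \<open>Block products are written along the reversed list, so that list induction peels off the
  last block just as \<open>star\<close> does.\<close>

primrec list_prod :: "(nat \<Rightarrow> nat \<Rightarrow> mpol) \<Rightarrow> nat list \<Rightarrow> mpol" where
  "list_prod F [] = 1"
| "list_prod F (m # a) = list_prod F a * F (length a) m"

primrec list_mon :: "nat list \<Rightarrow> (nat \<Rightarrow>\<^sub>0 nat)" where
  "list_mon [] = 0"
| "list_mon (m # a) = list_mon a + Poly_Mapping.single (length a) m"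

lemma list_prod_eq: "list_prod F a = (\<Prod>B<length a. F B (rev a ! B))"
  by (induction a) (auto simp: nth_append intro!: prod.cong)

lemma list_mon_eq: "list_mon a = content_mon (length a) (\<lambda>B. rev a ! B)"
  unfolding content_mon_def by (induction a) (auto simp: nth_append intro!: sum.cong)

definition dex_count :: "real \<Rightarrow> nat list \<Rightarrow> real" where
  "dex_count t a =
     (\<Sum>\<sigma> | \<sigma> permutes {1..sum_list a} \<and> dex (sum_list a) \<sigma> \<subseteq> partial_sums a. t ^ exc (sum_list a) \<sigma>)"

lemma dex_count_eq_lookup:
  "dex_count t a = Poly_Mapping.lookup (list_prod (block_factor (length a) t) a) (list_mon a)"
proof -
  let ?n = "sum_list a"
  have "dex ?n \<sigma> \<subseteq> partial_sums a \<longleftrightarrow> (\<forall>i\<in>dex ?n \<sigma>. block_of a i \<noteq> block_of a (Suc i))" for \<sigma>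
    using dex_subset[of ?n \<sigma>] block_of_eq_iff[of _ a] by fastforce
  then have "dex_count t a = (\<Sum>(w, C)\<in>coloured_words ?n (block_of a). t ^ card C)"
    unfolding dex_count_def by (simp only: sum_dex_free_permutations[OF block_of_mono])
  also have "\<dots> = Poly_Mapping.lookup
      (\<Prod>B<length a. block_factor (length a) t B (card {j \<in> {1..?n}. block_of a j = B}))
      (content_mon (length a) (\<lambda>B. card {j \<in> {1..?n}. block_of a j = B}))"
    by (rule sum_coloured_words) (simp add: block_of_less)
  also have "(\<Prod>B<length a. block_factor (length a) t B (card {j \<in> {1..?n}. block_of a j = B})) =
      list_prod (block_factor (length a) t) a"
    unfolding list_prod_eq by (intro prod.cong refl) (simp only: card_block_of lessThan_iff)
  also have "content_mon (length a) (\<lambda>B. card {j \<in> {1..?n}. block_of a j = B}) = list_mon a"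
    unfolding list_mon_eq content_mon_def by (intro sum.cong refl) (simp only: card_block_of lessThan_iff)
  finally show ?thesis .
qed

text \<open>A zero part repeats a boundary or, at the head of the list, adds the total, which is out
  of the range of \<open>dex\<close>. This is the hypothesis that \<open>phi_star\<close>
  demands.\<close>

lemma dex_count_zero_part: "dex_count t (x @ 0 # y) = dex_count t (x @ y)"
proof -
  have sums: "sum_list (x @ 0 # y) = sum_list (x @ y)" by simp
  have "partial_sums (x @ 0 # y) \<subseteq> insert (sum_list (x @ y)) (partial_sums (x @ y))"
    by (induction x) auto
  moreover have "partial_sums (x @ y) \<subseteq> partial_sums (x @ 0 # y)"
    by (induction x) auto
  ultimately have "dex (sum_list (x @ y)) \<sigma> \<subseteq> partial_sums (x @ 0 # y) \<longleftrightarrow>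
       dex (sum_list (x @ y)) \<sigma> \<subseteq> partial_sums (x @ y)" for \<sigma>
    using dex_subset[of "sum_list (x @ y)" \<sigma>] by force
  then show ?thesis unfolding dex_count_def sums by simp
qed

section \<open>The generating function of the products with complete homogeneous functions\<close>

fun star_gf :: "real \<Rightarrow> (nat list \<Rightarrow> real) \<Rightarrow> nat list \<Rightarrow> real" where
  "star_gf x N [] = N []"
| "star_gf x N (m # a) = (\<Sum>c\<le>m. x ^ c * star_gf x (\<lambda>a. N ((m - c) # a)) a)"

text \<open>Summing over k uncouples the parts: each part gives up its own c with weight
  x^c.\<close>

lemma star_gf_eq_sum:
  "sum_list a \<le> K \<Longrightarrow> (\<Sum>k\<le>K. x ^ k * star k N a) = star_gf x N a"
proof (induction a arbitrary: N K)
  case Nil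
  have "(\<Sum>k\<le>K. x ^ k * star k N []) = (\<Sum>k\<le>K. if k = 0 then N [] else 0)"
    by (intro sum.cong) auto
  then show ?case by simp
next
  case (Cons m a)
  have "(\<Sum>k\<le>K. x ^ k * star k N (m # a)) =
     (\<Sum>k\<le>K. \<Sum>c\<le>min k m. x ^ k * star (k - c) (\<lambda>a. N ((m - c) # a)) a)"
    by (simp add: sum_distrib_left)
  also have "\<dots> = (\<Sum>(k, c)\<in>(SIGMA k:{..K}. {..min k m}). x ^ k * star (k - c) (\<lambda>a. N ((m - c) # a)) a)"
    by (rule sum.Sigma) auto
  also have "\<dots> = (\<Sum>(c, k)\<in>(SIGMA c:{..m}. {..K - c}). x ^ (c + k) * star k (\<lambda>a. N ((m - c) # a)) a)"
    using Cons.prems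
    by (intro sum.reindex_bij_witness[of _ "\<lambda>(c, k). (c + k, c)" "\<lambda>(k, c). (c, k - c)"]) auto
  also have "\<dots> = (\<Sum>c\<le>m. \<Sum>k\<le>K - c. x ^ (c + k) * star k (\<lambda>a. N ((m - c) # a)) a)"
    by (rule sum.Sigma[symmetric]) auto
  also have "\<dots> = (\<Sum>c\<le>m. x ^ c * star_gf x (\<lambda>a. N ((m - c) # a)) a)"
  proof (rule sum.cong[OF refl])
    fix c assume "c \<in> {..m}"
    then have "(\<Sum>k\<le>K - c. x ^ k * star k (\<lambda>a. N ((m - c) # a)) a) = star_gf x (\<lambda>a. N ((m - c) # a)) a"
      using Cons.prems by (intro Cons.IH) auto
    then show "(\<Sum>k\<le>K - c. x ^ (c + k) * star k (\<lambda>a. N ((m - c) # a)) a) =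
        x ^ c * star_gf x (\<lambda>a. N ((m - c) # a)) a"
      by (simp add: power_add mult.assoc flip: sum_distrib_left)
  qed
  finally show ?case by simp
qed

lemma star_gf_cong:
  "(\<And>a'. length a' = length a \<Longrightarrow> N a' = N' a') \<Longrightarrow> star_gf x N a = star_gf x N' a"
proof (induction a arbitrary: N N')
  case (Cons m a)
  have "star_gf x (\<lambda>a. N ((m - c) # a)) a = star_gf x (\<lambda>a. N' ((m - c) # a)) a" for c
    by (rule Cons.IH) (simp add: Cons.prems)
  then show ?case by simp
qed simp

text \<open>Lowering an exponent by c amounts to multiplying by the c-th power of the variable, so
  the removal becomes a convolution within each block factor. R and \<kappa> carry the factors and
  exponents of blocks already peeled off.\<close>

lemma star_gf_lookup:
  "star_gf x (\<lambda>a. Poly_Mapping.lookup (R * list_prod F a) (list_mon a + \<kappa>)) a =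
   Poly_Mapping.lookup (R * list_prod (\<lambda>B m. \<Sum>c\<le>m. (cst x * var B) ^ c * F B (m - c)) a) (list_mon a + \<kappa>)"
proof (induction a arbitrary: R \<kappa>)
  case (Cons m a)
  let ?F = "\<lambda>B m. \<Sum>c\<le>m. (cst x * var B) ^ c * F B (m - c)"
  let ?B = "length a"
  have "star_gf x (\<lambda>a. Poly_Mapping.lookup (R * list_prod F ((m - c) # a)) (list_mon ((m - c) # a) + \<kappa>)) a =
      Poly_Mapping.lookup (var ?B ^ c * (F ?B (m - c) * R * list_prod ?F a)) (list_mon (m # a) + \<kappa>)"
    if c: "c \<le> m" for c
  proof -
    have "star_gf x (\<lambda>a. Poly_Mapping.lookup (R * list_prod F ((m - c) # a)) (list_mon ((m - c) # a) + \<kappa>)) a =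
      star_gf x (\<lambda>a. Poly_Mapping.lookup ((F ?B (m - c) * R) * list_prod F a)
        (list_mon a + (Poly_Mapping.single ?B (m - c) + \<kappa>))) a"
      by (rule star_gf_cong) (simp add: algebra_simps)
    also have "\<dots> = Poly_Mapping.lookup (F ?B (m - c) * R * list_prod ?F a)
        (list_mon a + (Poly_Mapping.single ?B (m - c) + \<kappa>))"
      by (rule Cons.IH)
    also have "list_mon a + (Poly_Mapping.single ?B (m - c) + \<kappa>) = list_mon (m # a) + \<kappa> - Poly_Mapping.single ?B c"
      using c by (intro poly_mapping_eqI) (auto simp: lookup_add lookup_minus lookup_single when_def)
    finally show ?thesis using c by (simp add: lookup_var_power_mult lookup_add)
  qed
  then have "star_gf x (\<lambda>a. Poly_Mapping.lookup (R * list_prod F a) (list_mon a + \<kappa>)) (m # a) =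
      (\<Sum>c\<le>m. Poly_Mapping.lookup (cst (x ^ c) * (var ?B ^ c * (F ?B (m - c) * R * list_prod ?F a))) (list_mon (m # a) + \<kappa>))"
    by (simp add: lookup_cst_mult)
  also have "\<dots> = Poly_Mapping.lookup (R * list_prod ?F (m # a)) (list_mon (m # a) + \<kappa>)"
    unfolding lookup_sum[symmetric] list_prod.simps sum_distrib_left
    by (intro arg_cong2[where f = Poly_Mapping.lookup] sum.cong refl)
       (simp only: power_mult_distrib cst_power mult_ac)
  finally show ?case .
qed simp

lemma sum_block_factor:
  fixes v y w :: mpol
  assumes "F = (\<lambda>m. if m = 0 then 1 else y * w ^ (m - 1))"
  shows "(\<Sum>c\<le>m. v ^ c * F (m - c)) = v ^ m + y * (\<Sum>c<m. v ^ c * w ^ (m - Suc c))"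
proof -
  have "(\<Sum>c\<le>m. v ^ c * F (m - c)) = v ^ m + (\<Sum>c<m. v ^ c * F (m - c))"
    by (simp add: assms add.commute flip: lessThan_Suc_atMost)
  also have "(\<Sum>c<m. v ^ c * F (m - c)) = y * (\<Sum>c<m. v ^ c * w ^ (m - Suc c))"
    by (simp add: assms sum_distrib_left algebra_simps)
  finally show ?thesis .
qed

text \<open>At x = t and x = 1 the convolved block factors are u_B^b + y (B+1) * E and u_B^b + y B *
  E, where y is \<open>yform\<close>, b the size of block B and E is common to both. This is the
  input of \<open>cyclic_shift_identity\<close>.\<close>

lemma dex_count_identity: "star_gf t (dex_count t) a - t * star_gf 1 (dex_count t) a = 1 - t"
proof -
  define s where "s = length a"
  define b where "b B = rev a ! B" for B
  define Y where "Y B = yform s t B + cst t * var B" for B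
  define E where "E B = (\<Sum>c<b B. var B ^ c * Y B ^ (b B - Suc c))" for B
  have gf: "star_gf x (dex_count t) a =
      Poly_Mapping.lookup (\<Prod>B<s. \<Sum>c\<le>b B. (cst x * var B) ^ c * block_factor s t B (b B - c)) (content_mon s b)" for x
  proof -
    have "star_gf x (dex_count t) a =
        star_gf x (\<lambda>a. Poly_Mapping.lookup (1 * list_prod (block_factor s t) a) (list_mon a + 0)) a"
      by (rule star_gf_cong) (simp add: dex_count_eq_lookup s_def)
    then show ?thesis unfolding star_gf_lookup by (simp add: list_prod_eq list_mon_eq s_def b_def[abs_def])
  qed
  have telescope: "v ^ m + (z - v) * (\<Sum>c<m. v ^ c * z ^ (m - Suc c)) = z ^ m" for v z :: mpol and m
    using power_diff_sumr2[of v m z] by (simp add: algebra_simps)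
  have Y_Suc: "Y B - var B = yform s t (Suc B)" if "B < s" for B
  proof -
    have "cst (t - 1) = cst t - 1" by (simp add: cst_def single_diff)
    then show ?thesis unfolding yform_Suc[OF that] Y_def by (simp add: left_diff_distrib)
  qed
  have block: "(\<Sum>c\<le>b B. v ^ c * block_factor s t B (b B - c)) =
      v ^ b B + yform s t B * (\<Sum>c<b B. v ^ c * Y B ^ (b B - Suc c))" for v B
    by (rule sum_block_factor, rule ext) (simp add: block_factor_def Y_def)
  have 1: "(\<Sum>c\<le>b B. (cst t * var B) ^ c * block_factor s t B (b B - c)) =
      var B ^ b B + yform s t (Suc B) * E B" if "B < s" for B
  proof -
    \<comment> \<open>For v = t * u_B the difference Y - v is y B, so the geometric sum collapses to
      Y^b.\<close>
    have "(\<Sum>c\<le>b B. (cst t * var B) ^ c * block_factor s t B (b B - c)) = Y B ^ b B"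
      unfolding block using telescope[of "cst t * var B" "b B" "Y B"] by (simp add: Y_def)
    \<comment> \<open>The same power is expanded again from u_B, and Y - u_B is now the next form y
      (B+1).\<close>
    also have "\<dots> = var B ^ b B + yform s t (Suc B) * E B"
      using telescope[of "var B" "b B" "Y B"] Y_Suc[OF that] by (simp add: E_def)
    finally show ?thesis .
  qed
  have 2: "(\<Sum>c\<le>b B. (cst 1 * var B) ^ c * block_factor s t B (b B - c)) =
      var B ^ b B + yform s t B * E B" for B
    unfolding block by (simp add: E_def cst_1)
  have "star_gf t (dex_count t) a = Poly_Mapping.lookup (\<Prod>B<s. var B ^ b B + yform s t (Suc B) * E B) (content_mon s b)"
    unfolding gf by (simp add: 1)
  moreover have "star_gf 1 (dex_count t) a = Poly_Mapping.lookup (\<Prod>B<s. var B ^ b B + yform s t B * E B) (content_mon s b)"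
    unfolding gf by (simp add: 2)
  ultimately show ?thesis
    using cyclic_shift_identity[of s "yform s t" t b E] by (simp add: yform_Suc yform_top)
qed

section \<open>The recurrence for the \<open>q\<close>-Eulerian polynomials\<close>

locale unital_ring_hom =
  fixes h :: "'a::comm_ring_1 \<Rightarrow> 'b::comm_ring_1"
  assumes add: "h (x + y) = h x + h y" and mult: "h (x * y) = h x * h y" and one: "h 1 = 1"
begin

lemma zero: "h 0 = 0"
  using add[of 0 0] by simp

lemma minus: "h (x - y) = h x - h y"
  using add[of "x - y" y] by (simp add: algebra_simps)

lemma sum: "h (\<Sum>x\<in>A. f x) = (\<Sum>x\<in>A. h (f x))"
  by (induction A rule: infinite_finite_induct) (simp_all add: add zero)

lemma prod: "h (\<Prod>x\<in>A. f x) = (\<Prod>x\<in>A. h (f x))"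
  by (induction A rule: infinite_finite_induct) (simp_all add: mult one)

lemma map_poly_hom: "unital_ring_hom (map_poly h)"
proof
  show "map_poly h (p + q) = map_poly h p + map_poly h q" for p q
    by (rule poly_eqI) (simp add: coeff_map_poly zero add)
  show "map_poly h (p * q) = map_poly h p * map_poly h q" for p q
    by (rule poly_eqI) (simp add: coeff_map_poly zero coeff_mult sum mult)
qed (simp add: one)

lemma map_poly_monom: "map_poly h (monom c n) = monom (h c) n"
  by (simp add: Polynomial.map_poly_monom zero)

lemma map_poly_smult: "map_poly h (smult c p) = smult (h c) (map_poly h p)"
  by (rule poly_eqI) (simp add: coeff_map_poly zero mult)

lemma eval_hom: "unital_ring_hom (\<lambda>p. poly (map_poly h p) x)"
proof -
  interpret mp: unital_ring_hom "map_poly h" by (rule map_poly_hom)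
  show ?thesis by unfold_locales (simp_all add: mp.add mp.mult mp.one)
qed

end

interpretation of_int: unital_ring_hom "of_int :: int \<Rightarrow> 'a::comm_ring_1"
  by unfold_locales simp_all

definition ev :: "'a::comm_ring_1 \<Rightarrow> int poly \<Rightarrow> 'a" where
  "ev q p = poly (map_poly of_int p) q"

interpretation ev: unital_ring_hom "ev q" for q :: "'a::comm_ring_1"
  unfolding ev_def by (rule of_int.eval_hom)

lemma ev_monom: "ev q (monom c n) = of_int c * q ^ n"
  by (simp add: ev_def of_int.map_poly_monom poly_monom)

abbreviation ev2 :: "'a::comm_ring_1 \<Rightarrow> 'a \<Rightarrow> int poly poly \<Rightarrow> 'a" where
  "ev2 q t p \<equiv> poly (map_poly (ev q) p) t"

interpretation ev2: unital_ring_hom "ev2 q t" for q t :: "'a::comm_ring_1"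
  by (rule ev.eval_hom)

lemma ev_q_int: "(1 - q) * ev q (q_int n) = 1 - q ^ n"
  by (simp add: q_int_def ev.sum ev_monom one_diff_power_eq)

lemma ev_q_fact: "(1 - q) ^ n * ev q (q_fact n) = q_poch q n"
proof (induction n)
  case (Suc n)
  have "(1 - q) ^ Suc n * ev q (q_fact (Suc n)) =
      ((1 - q) * ev q (q_int (Suc n))) * ((1 - q) ^ n * ev q (q_fact n))"
    by (simp add: q_fact_Suc ev.mult algebra_simps)
  then show ?case using Suc.IH by (simp add: ev_q_int q_poch_Suc)
qed (simp add: q_fact_def ev.one)

lemma ev_q_binomial:
  fixes q :: real
  assumes q: "0 < q" "q < 1" and "k \<le> n"
  shows "ev q (q_binomial n k) = q_poch q n / (q_poch q k * q_poch q (n - k))"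
proof -
  have "q_poch q n = (1 - q) ^ n * ev q (q_binomial n k * (q_fact k * q_fact (n - k)))"
    by (simp add: q_binomial_exact[OF assms(3)] ev_q_fact)
  also have "(1 - q) ^ n = (1 - q) ^ k * (1 - q) ^ (n - k)"
    using assms(3) by (simp flip: power_add)
  also have "\<dots> * ev q (q_binomial n k * (q_fact k * q_fact (n - k))) =
      ev q (q_binomial n k) * (((1 - q) ^ k * ev q (q_fact k)) * ((1 - q) ^ (n - k) * ev q (q_fact (n - k))))"
    by (simp add: ev.mult)
  finally show ?thesis
    using q_poch_nonzero[OF q] by (simp add: ev_q_fact)
qed

text \<open>\<open>sum_dex\<close> turns the exponent of q into the sum of \<open>dex\<close>, which
  \<open>phi_subset\<close> recognizes permutation by permutation; \<open>dex_count\<close> collects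
  them by linearity.\<close>

lemma ev2_q_eulerian:
  fixes q t :: real
  assumes q: "0 < q" "q < 1"
  shows "ev2 q t (q_eulerian n) = q_poch q n * phi q n (dex_count t)"
proof -
  have "ev2 q t (q_eulerian n) = (\<Sum>\<sigma> | \<sigma> permutes {1..n}. q ^ (maj n \<sigma> - exc n \<sigma>) * t ^ exc n \<sigma>)"
    by (simp add: q_eulerian_def ev2.sum ev.map_poly_monom poly_monom ev_monom)
  also have "\<dots> = (\<Sum>\<sigma> | \<sigma> permutes {1..n}. q ^ (\<Sum>(dex n \<sigma>)) * t ^ exc n \<sigma>)"
    by (intro sum.cong refl) (auto simp flip: sum_dex)
  also have "\<dots> = q_poch q n * (\<Sum>\<sigma> | \<sigma> permutes {1..n}. t ^ exc n \<sigma> * (q ^ (\<Sum>(dex n \<sigma>)) / q_poch q n))"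
    using q_poch_nonzero[OF q, of n] by (simp add: sum_distrib_left mult.commute)
  also have "(\<Sum>\<sigma> | \<sigma> permutes {1..n}. t ^ exc n \<sigma> * (q ^ (\<Sum>(dex n \<sigma>)) / q_poch q n)) =
      phi q n (\<lambda>a. \<Sum>\<sigma> | \<sigma> permutes {1..n}. t ^ exc n \<sigma> * (if dex n \<sigma> \<subseteq> partial_sums a then 1 else 0))"
    by (simp only: phi_sum[OF q] phi_subset[OF q dex_subset])
  also have "\<dots> = phi q n (dex_count t)"
  proof (rule phi_cong[OF q])
    fix a :: "nat list" assume a: "sum_list a = n"
    show "(\<Sum>\<sigma> | \<sigma> permutes {1..n}. t ^ exc n \<sigma> * (if dex n \<sigma> \<subseteq> partial_sums a then 1 else 0)) = dex_count t a"
      unfolding dex_count_def a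
      by (rule sum.mono_neutral_cong_right) (auto simp: finite_permutations)
  qed
  finally show ?thesis .
qed

text \<open>\<open>dex_count_identity\<close> is specialized: \<open>phi_star\<close> turns the
  homogeneous functions into 1 / (q;q)_k, and the factors (q;q) assemble into q-binomials.\<close>

lemma ev2_recurrence:
  fixes q t :: real
  assumes q: "0 < q" "q < 1"
  shows "(\<Sum>k\<le>n. ev q (q_binomial n k) * (t ^ k - t) * ev2 q t (q_eulerian (n - k))) = 1 - t"
proof -
  have nz: "q_poch q m \<noteq> 0" for m by (rule q_poch_nonzero[OF q])
  have "(\<Sum>k\<le>n. ev q (q_binomial n k) * (t ^ k - t) * ev2 q t (q_eulerian (n - k))) =
      (\<Sum>k\<le>n. q_poch q n * ((t ^ k - t) * (phi q (n - k) (dex_count t) / q_poch q k)))"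
    using nz by (intro sum.cong refl) (simp add: ev2_q_eulerian[OF q] ev_q_binomial[OF q] field_simps)
  also have "\<dots> = q_poch q n * (\<Sum>k\<le>n. (t ^ k - t) * phi q n (star k (dex_count t)))"
    unfolding sum_distrib_left
    by (intro sum.cong refl) (simp add: phi_star[OF q dex_count_zero_part])
  also have "(\<Sum>k\<le>n. (t ^ k - t) * phi q n (star k (dex_count t))) =
      phi q n (\<lambda>a. \<Sum>k\<le>n. (t ^ k - t) * star k (dex_count t) a)"
    by (rule phi_sum[OF q, symmetric])
  \<comment> \<open>The constant is dressed as a one-term sum with D = {}, the form evaluated by
    \<open>phi_sum\<close> and \<open>phi_subset\<close>.\<close>
  also have "\<dots> = phi q n (\<lambda>a. \<Sum>x\<in>{()}. (1 - t) * (if {} \<subseteq> partial_sums a then 1 else 0))"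
  proof (rule phi_cong[OF q])
    fix a assume a: "sum_list a = n"
    have "(\<Sum>k\<le>n. (t ^ k - t) * star k (dex_count t) a) =
        (\<Sum>k\<le>n. t ^ k * star k (dex_count t) a) - t * (\<Sum>k\<le>n. 1 ^ k * star k (dex_count t) a)"
      by (simp add: left_diff_distrib sum_subtractf sum_distrib_left)
    also have "\<dots> = 1 - t"
      using a by (simp only: star_gf_eq_sum dex_count_identity order_refl)
    finally show "(\<Sum>k\<le>n. (t ^ k - t) * star k (dex_count t) a) =
        (\<Sum>x\<in>{()}. (1 - t) * (if {} \<subseteq> partial_sums a then 1 else 0))" by simp
  qed
  also have "\<dots> = (1 - t) / q_poch q n"
    by (subst phi_sum[OF q], subst phi_subset[OF q]) simp_all
  finally show ?thesis using nz by simp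
qed

lemma ev_eq_0_imp:
  fixes p :: "int poly"
  assumes "\<And>q::real. 0 < q \<Longrightarrow> q < 1 \<Longrightarrow> ev q p = 0"
  shows "p = 0"
proof (rule ccontr)
  assume "p \<noteq> 0"
  then have "map_poly of_int p \<noteq> (0 :: real poly)"
    by (simp add: map_poly_eq_0_iff)
  then have "finite {q. poly (map_poly of_int p) q = (0::real)}" by (rule poly_roots_finite)
  moreover have "{0<..<1} \<subseteq> {q. poly (map_poly of_int p) q = (0::real)}"
    using assms by (auto simp: ev_def)
  ultimately have "finite {0<..<1::real}" by (rule finite_subset[rotated])
  then show False using infinite_Ioo[of "0::real" 1] by simp
qed

text \<open>This carries identities obtained on 0 < q < 1 back to polynomials, where roots of unity
  may be inserted.\<close>

lemma ev2_eq_0_imp: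
  fixes p :: "int poly poly"
  assumes "\<And>q t::real. 0 < q \<Longrightarrow> q < 1 \<Longrightarrow> ev2 q t p = 0"
  shows "p = 0"
proof (rule poly_eqI)
  fix i
  have "coeff p i = 0"
  proof (rule ev_eq_0_imp)
    fix q :: real assume q: "0 < q" "q < 1"
    then have "map_poly (ev q) p = 0" using assms poly_all_0_iff_0 by blast
    then have "coeff (map_poly (ev q) p) i = 0" by simp
    then show "ev q (coeff p i) = 0" by (simp add: coeff_map_poly ev.zero)
  qed
  then show "coeff p i = coeff 0 i" by simp
qed

lemma q_fact_nonzero: "q_fact n \<noteq> 0"
proof -
  have "q_int (Suc i) \<noteq> 0" for i
  proof -
    have "coeff (q_int (Suc i)) 0 = 1" by (simp add: q_int_def coeff_sum sum.If_cases)
    then show ?thesis by (metis coeff_0 zero_neq_one)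
  qed
  then show ?thesis by (induction n) (simp_all add: q_fact_Suc, simp add: q_fact_def)
qed

lemma q_binomial_0 [simp]: "q_binomial n 0 = 1"
  using q_binomial_exact[of 0 n] q_fact_nonzero[of n] by (simp add: q_fact_def[of 0])

text \<open>In \<open>ev2_recurrence\<close> the term k = 0 is 1 - t times the polynomial for n
  itself, and t^k - t is t - 1 times t + ... + t^(k-1) for k \<ge> 1. The factor t - 1 is cancelled
  in the polynomial ring.\<close>

theorem q_eulerian_recurrence:
  "q_eulerian n = 1 + (\<Sum>k = 1..n. smult (q_binomial n k) ((\<Sum>i = 1..<k. monom 1 i) * q_eulerian (n - k)))"
proof -
  define R where "R = 1 + (\<Sum>k = 1..n. smult (q_binomial n k) ((\<Sum>i = 1..<k. monom 1 i) * q_eulerian (n - k)))"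
  have "(monom 1 1 - 1) * (q_eulerian n - R) = 0"
  proof (rule ev2_eq_0_imp)
    fix q t :: real assume q: "0 < q" "q < 1"
    have geo: "(t - 1) * (\<Sum>i = 1..<k. t ^ i) = t ^ k - t" if "k \<ge> 1" for k
      using that by (induction k rule: dec_induct) (simp_all add: algebra_simps)
    have "ev2 q t R = 1 + (\<Sum>k = 1..n. ev q (q_binomial n k) * ((\<Sum>i = 1..<k. t ^ i) * ev2 q t (q_eulerian (n - k))))"
      by (simp add: R_def ev2.add ev2.one ev2.sum ev.map_poly_smult ev2.mult
          ev.map_poly_monom poly_monom ev.one)
    then have "(t - 1) * ev2 q t R = (t - 1) +
        (\<Sum>k = 1..n. ev q (q_binomial n k) * ((t - 1) * (\<Sum>i = 1..<k. t ^ i)) * ev2 q t (q_eulerian (n - k)))"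
      by (simp only: distrib_left mult_1_right, subst sum_distrib_left, simp only: mult_ac)
    also have "\<dots> = (t - 1) + (\<Sum>k = 1..n. ev q (q_binomial n k) * (t ^ k - t) * ev2 q t (q_eulerian (n - k)))"
      using geo by simp
    also have "(\<Sum>k = 1..n. ev q (q_binomial n k) * (t ^ k - t) * ev2 q t (q_eulerian (n - k))) =
        (1 - t) - (1 - t) * ev2 q t (q_eulerian n)"
    proof -
      have "{..n} = insert 0 {1..n}" by auto
      with ev2_recurrence[OF q, of n t] show ?thesis by (simp add: ev.one algebra_simps)
    qed
    finally show "ev2 q t ((monom 1 1 - 1) * (q_eulerian n - R)) = 0"
      by (simp only: ev2.mult ev2.minus ev.map_poly_monom poly_monom ev.one ev2.one) (simp add: algebra_simps)
  qed
  moreover have "monom 1 1 - 1 \<noteq> (0 :: int poly poly)"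
  proof
    assume "monom 1 1 - 1 = (0 :: int poly poly)"
    then have "coeff (monom 1 1 - 1) 1 = (0 :: int poly)" by simp
    then show False by simp
  qed
  ultimately have "q_eulerian n = R" by simp
  then show ?thesis unfolding R_def .
qed

section \<open>Evaluation at roots of unity\<close>

lemma q_binomial_self [simp]: "q_binomial n n = 1"
  using q_binomial_exact[of n n] q_fact_nonzero[of n] by (simp add: q_fact_def[of 0])

lemma q_binomial_eq_0: "n < k \<Longrightarrow> q_binomial n k = 0"
  by (simp add: q_binomial_def)

text \<open>Over the common denominator this is [n+1] = [k+1] + q^(k+1) [n-k].\<close>

lemma q_binomial_pascal:
  "q_binomial (Suc n) (Suc k) = q_binomial n k + monom 1 (Suc k) * q_binomial n (Suc k)"
proof (cases "k < n")
  case True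
  define m where "m = n - Suc k"
  have n: "n = Suc (k + m)" using True by (simp add: m_def)
  let ?D = "q_fact (Suc k) * q_fact (Suc m)"
  have 1: "q_binomial n k * ?D = q_int (Suc k) * q_fact n"
    using q_binomial_exact[of k n] by (simp add: n q_fact_Suc[of k] mult_ac)
  have 2: "q_binomial n (Suc k) * ?D = q_int (Suc m) * q_fact n"
    using q_binomial_exact[of "Suc k" n] by (simp add: n q_fact_Suc[of m] mult_ac)
  have "q_binomial (Suc n) (Suc k) * ?D = q_int (Suc k + Suc m) * q_fact n"
    using q_binomial_exact[of "Suc k" "Suc n"] by (simp add: n q_fact_Suc[of "Suc _"])
  also have "\<dots> = (q_binomial n k + monom 1 (Suc k) * q_binomial n (Suc k)) * ?D"
    unfolding q_int_add distrib_right 1 mult.assoc 2 ..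
  finally show ?thesis using q_fact_nonzero by simp
next
  case False
  then show ?thesis by (cases "k = n") (simp_all add: q_binomial_eq_0)
qed

lemma q_binomial_absorb:
  assumes "k \<le> n"
  shows "q_int (Suc k) * q_binomial (Suc n) (Suc k) = q_int (Suc n) * q_binomial n k"
proof -
  let ?D = "q_fact k * q_fact (n - k)"
  have "q_int (Suc k) * q_binomial (Suc n) (Suc k) * ?D = q_fact (Suc n)"
    using q_binomial_exact[of "Suc k" "Suc n"] assms by (simp add: q_fact_Suc[of k] mult_ac)
  also have "\<dots> = q_int (Suc n) * q_binomial n k * ?D"
    using q_binomial_exact[OF assms] by (simp add: q_fact_Suc[of n] mult.assoc)
  finally show ?thesis using q_fact_nonzero by simp
qed

lemma coeff_mult_nonneg:
  fixes p q :: "int poly"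
  assumes "\<And>i. 0 \<le> coeff p i" "\<And>i. 0 \<le> coeff q i"
  shows "0 \<le> coeff (p * q) i"
  using assms by (auto simp: coeff_mult intro: sum_nonneg)

lemma q_binomial_nonneg: "0 \<le> coeff (q_binomial n k) i"
proof (induction n arbitrary: k i)
  case 0
  then show ?case by (cases k) (simp_all add: q_binomial_eq_0)
next
  case (Suc n)
  then show ?case by (cases k) (simp_all add: q_binomial_pascal coeff_monom_mult)
qed

lemma q_bin_eulerian_coeff_nonneg: "0 \<le> coeff (q_bin_eulerian_coeff n j) i"
proof -
  have "0 \<le> coeff (coeff (q_eulerian k) l) i" for k l i
    by (auto simp: q_eulerian_def coeff_sum intro!: sum_nonneg)
  then have "0 \<le> coeff (\<Sum>k = 1..n. q_binomial n k * coeff (q_eulerian k) l) i" for l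
    unfolding coeff_sum by (intro sum_nonneg coeff_mult_nonneg q_binomial_nonneg)
  then show ?thesis
    by (cases j) (simp_all add: q_bin_eulerian_coeff_def q_bin_eulerian_def coeff_monom_mult coeff_sum)
qed

locale primitive_root =
  fixes \<zeta> :: complex and d :: nat
  assumes d: "d \<ge> 1" and root: "\<zeta> ^ d = 1" and primitive: "\<And>k. 0 < k \<Longrightarrow> k < d \<Longrightarrow> \<zeta> ^ k \<noteq> 1"
begin

text \<open>In the absorption identity [k] [d,k] = [d] [d-1,k-1] the factor [d] vanishes at \<zeta>,
  while [k] does not.\<close>

lemma ev_q_binomial_d:
  assumes "0 < k" "k < d"
  shows "ev \<zeta> (q_binomial d k) = 0"
proof -
  have "\<zeta> \<noteq> 1" using primitive[of 1] assms by simp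
  then have "ev \<zeta> (q_int d) = 0" using ev_q_int[of \<zeta> d] root by simp
  moreover have "ev \<zeta> (q_int k) \<noteq> 0" using ev_q_int[of \<zeta> k] primitive[OF assms] by auto
  moreover have "q_int k * q_binomial d k = q_int d * q_binomial (d - 1) (k - 1)"
    using q_binomial_absorb[of "k - 1" "d - 1"] assms by simp
  then have "ev \<zeta> (q_int k) * ev \<zeta> (q_binomial d k) = ev \<zeta> (q_int d) * ev \<zeta> (q_binomial (d - 1) (k - 1))"
    by (simp flip: ev.mult)
  ultimately show ?thesis by simp
qed

text \<open>One step of the q-Lucas theorem: adding d to the upper index acts like one row of
  Pascal's triangle with stride d. The q-Pascal rule propagates it, as its factor \<zeta>^k depends
  on k modulo d only.\<close>

lemma ev_q_binomial_add:
  "ev \<zeta> (q_binomial (n + d) k) =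
     ev \<zeta> (q_binomial n k) + (if d \<le> k then ev \<zeta> (q_binomial n (k - d)) else 0)"
proof (induction n arbitrary: k)
  case 0
  consider "k = 0" | "0 < k" "k < d" | "k = d" | "d < k" by linarith
  then show ?case
    using d by cases (simp_all add: ev_q_binomial_d q_binomial_eq_0 ev.zero ev.one)
next
  case (Suc n)
  show ?case
  proof (cases k)
    case 0
    then show ?thesis using d by (simp add: ev.one)
  next
    case (Suc k')
    have pascal: "ev \<zeta> (q_binomial (Suc m) (Suc l)) =
        ev \<zeta> (q_binomial m l) + \<zeta> ^ Suc l * ev \<zeta> (q_binomial m (Suc l))" for m l
      by (simp only: q_binomial_pascal ev.add ev.mult ev_monom of_int_1 mult_1)
    consider "Suc k' < d" | "Suc k' = d" | "d \<le> k'" by linarith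
    then show ?thesis
    proof cases
      case 3
      then have "Suc k' - d = Suc (k' - d)" by simp
      moreover have "\<zeta> ^ Suc k' = \<zeta> ^ Suc (k' - d)"
        using 3 root by (metis add_Suc le_add_diff_inverse2 mult_1_right power_add)
      moreover have "d \<le> Suc k'" using 3 by simp
      ultimately show ?thesis using 3
        by (simp only: Suc add_Suc pascal Suc.IH if_True) (simp only: algebra_simps)
    next
      case 1
      then show ?thesis by (simp add: Suc q_binomial_pascal ev.add ev.mult ev_monom Suc.IH)
    next
      \<comment> \<open>At k = d the shifted binomial enters for the first time; its lower index is
        0 and its value is 1.\<close>
      case 2
      then show ?thesis
        using pascal[of "n + d" k'] pascal[of n k'] Suc.IH[of k'] Suc.IH[of "Suc k'"] root
        by (simp add: Suc ev.one del: power_Suc)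
    qed
  qed
qed

lemma ev_q_binomial_mult:
  "ev \<zeta> (q_binomial (d * N) k) = (if d dvd k then of_nat (N choose (k div d)) else 0)"
proof (induction N arbitrary: k)
  case 0
  then show ?case using d by (cases "k = 0") (auto simp: ev.one ev.zero q_binomial_eq_0 elim!: dvdE)
next
  case (Suc N)
  have "ev \<zeta> (q_binomial (d * Suc N) k) = ev \<zeta> (q_binomial (d * N + d) k)" by (simp add: add.commute)
  also have "\<dots> = (if d dvd k then of_nat (Suc N choose (k div d)) else 0)"
  proof (cases "d dvd k")
    case True
    then obtain i where "k = d * i" by auto
    then show ?thesis using d by (cases i) (simp_all add: ev_q_binomial_add Suc.IH ev.one)
  next
    case False
    moreover have "\<not> d dvd k - d" if "d \<le> k" using False that by (simp add: dvd_minus_self)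
    ultimately show ?thesis by (simp add: ev_q_binomial_add Suc.IH)
  qed
  finally show ?case .
qed

lemma sum_multiples:
  assumes "\<And>k. \<not> d dvd k \<Longrightarrow> F k = (0 :: 'a :: comm_monoid_add)"
  shows "(\<Sum>k = 1..d * N. F k) = (\<Sum>i = 1..N. F (d * i))"
proof -
  have "(\<Sum>k = 1..d * N. F k) = (\<Sum>k\<in>(*) d ` {1..N}. F k)"
    using d by (intro sum.mono_neutral_right ballI assms) (auto elim!: dvdE)
  also have "\<dots> = (\<Sum>i = 1..N. F (d * i))"
    using d by (subst sum.reindex) (auto simp: inj_on_def)
  finally show ?thesis .
qed

abbreviation eulerian :: "nat \<Rightarrow> complex poly" where
  "eulerian N \<equiv> map_poly (ev \<zeta>) (q_eulerian (d * N))"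

interpretation mp: unital_ring_hom "map_poly (ev \<zeta>)"
  by (rule ev.map_poly_hom)

text \<open>Only lower indices divisible by d survive, and they become ordinary binomials.\<close>

lemma eulerian_recurrence:
  "eulerian N = 1 + (\<Sum>i = 1..N. of_nat (N choose i) * (\<Sum>l = 1..<d * i. monom 1 1 ^ l) * eulerian (N - i))"
proof -
  have "eulerian N = 1 + (\<Sum>k = 1..d * N. smult (ev \<zeta> (q_binomial (d * N) k))
      ((\<Sum>l = 1..<k. monom 1 l) * map_poly (ev \<zeta>) (q_eulerian (d * N - k))))"
    by (subst q_eulerian_recurrence)
       (simp add: mp.add mp.one mp.sum mp.mult ev.map_poly_smult ev.map_poly_monom ev.one)
  also have "\<dots> = 1 + (\<Sum>i = 1..N. smult (ev \<zeta> (q_binomial (d * N) (d * i)))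
      ((\<Sum>l = 1..<d * i. monom 1 l) * map_poly (ev \<zeta>) (q_eulerian (d * N - d * i))))"
    by (subst sum_multiples) (simp_all add: ev_q_binomial_mult)
  also have "\<dots> = 1 + (\<Sum>i = 1..N. of_nat (N choose i) * (\<Sum>l = 1..<d * i. monom 1 1 ^ l) * eulerian (N - i))"
    using d by (simp add: ev_q_binomial_mult of_nat_poly monom_power diff_mult_distrib2)
  finally show ?thesis .
qed

lemma map_poly_q_bin_eulerian:
  "map_poly (ev \<zeta>) (q_bin_eulerian (d * N)) = 1 + monom 1 1 * (\<Sum>k = 1..N. of_nat (N choose k) * eulerian k)"
proof -
  have "map_poly (ev \<zeta>) (q_bin_eulerian (d * N)) = 1 + monom 1 1 *
      (\<Sum>k = 1..d * N. smult (ev \<zeta> (q_binomial (d * N) k)) (map_poly (ev \<zeta>) (q_eulerian k)))"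
    by (simp add: q_bin_eulerian_def mp.add mp.one mp.sum mp.mult ev.map_poly_smult ev.map_poly_monom ev.one)
  also have "\<dots> = 1 + monom 1 1 * (\<Sum>k = 1..N. smult (ev \<zeta> (q_binomial (d * N) (d * k))) (eulerian k))"
    by (subst sum_multiples) (simp_all add: ev_q_binomial_mult)
  also have "\<dots> = 1 + monom 1 1 * (\<Sum>k = 1..N. of_nat (N choose k) * eulerian k)"
    using d by (simp add: ev_q_binomial_mult of_nat_poly)
  finally show ?thesis .
qed

end

section \<open>Invariant codes\<close>

definition letter_set :: "nat \<Rightarrow> enat set" where
  "letter_set m = insert \<infinity> (enat ` {0..m})"

text \<open>P stands for the orbits of positions. The letters 0 and infinity are free; when \<tau> 0
  = 0, only words that use every letter from 1 to m contribute.\<close>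

definition word_weight :: "(nat \<Rightarrow> 'a::comm_ring_1) \<Rightarrow> 'b set \<Rightarrow> nat \<Rightarrow> 'a" where
  "word_weight \<tau> P m = (\<Sum>h\<in>P \<rightarrow>\<^sub>E letter_set m. \<Prod>k = 1..m. \<tau> (card {i \<in> P. h i = enat k}))"

fun size_weight :: "(nat \<Rightarrow> 'a::comm_ring_1) \<Rightarrow> nat \<Rightarrow> nat \<Rightarrow> 'a" where
  "size_weight \<tau> N 0 = 2 ^ N"
| "size_weight \<tau> N (Suc m) = (\<Sum>i = 1..N. of_nat (N choose i) * \<tau> i * size_weight \<tau> (N - i) m)"

lemma sum_Pow_card:
  fixes F :: "nat \<Rightarrow> 'a::comm_ring_1"
  assumes "finite P"
  shows "(\<Sum>K\<in>Pow P. F (card K)) = (\<Sum>i\<le>card P. of_nat (card P choose i) * F i)"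
proof -
  have "(\<Sum>K\<in>Pow P. F (card K)) = (\<Sum>i\<le>card P. \<Sum>K | K \<in> Pow P \<and> card K = i. F (card K))"
    by (rule sum.group[symmetric]) (use assms in \<open>auto intro: card_mono\<close>)
  also have "\<dots> = (\<Sum>i\<le>card P. of_nat (card P choose i) * F i)"
    using n_subsets[OF assms] by (intro sum.cong refl) simp
  finally show ?thesis .
qed

lemma sum_PiE_insert_letter:
  assumes P: "finite P" and L: "finite L" and b: "b \<notin> L"
  shows "(\<Sum>h\<in>P \<rightarrow>\<^sub>E insert b L. F h) =
    (\<Sum>K\<in>Pow P. \<Sum>h\<in>(P - K) \<rightarrow>\<^sub>E L. F (\<lambda>i. if i \<in> K then b else h i))"
proof -
  have "(\<Sum>h\<in>P \<rightarrow>\<^sub>E insert b L. F h) =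
    (\<Sum>(K, h)\<in>(SIGMA K:Pow P. (P - K) \<rightarrow>\<^sub>E L). F (\<lambda>i. if i \<in> K then b else h i))"
  proof (rule sum.reindex_bij_witness[where
      i = "\<lambda>(K, h). (\<lambda>i. if i \<in> K then b else h i)" and
      j = "\<lambda>h. ({i \<in> P. h i = b}, restrict h (P - {i \<in> P. h i = b}))"])
    fix h assume h: "h \<in> P \<rightarrow>\<^sub>E insert b L"
    show inv: "(case ({i \<in> P. h i = b}, restrict h (P - {i \<in> P. h i = b})) of
        (K, h) \<Rightarrow> \<lambda>i. if i \<in> K then b else h i) = h"
      using h by (auto simp: fun_eq_iff PiE_def extensional_def)
    show "({i \<in> P. h i = b}, restrict h (P - {i \<in> P. h i = b})) \<in> (SIGMA K:Pow P. (P - K) \<rightarrow>\<^sub>E L)"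
      using h by (auto simp: PiE_def)
    show "(case ({i \<in> P. h i = b}, restrict h (P - {i \<in> P. h i = b})) of
        (K, h) \<Rightarrow> F (\<lambda>i. if i \<in> K then b else h i)) = F h"
      using inv by simp
  next
    fix p assume "p \<in> (SIGMA K:Pow P. (P - K) \<rightarrow>\<^sub>E L)"
    then obtain K h where p: "p = (K, h)" and K: "K \<subseteq> P" and h: "h \<in> (P - K) \<rightarrow>\<^sub>E L" by auto
    have hL: "h i \<in> L" if "i \<in> P" "i \<notin> K" for i using h that by auto
    show "(case p of (K, h) \<Rightarrow> \<lambda>i. if i \<in> K then b else h i) \<in> P \<rightarrow>\<^sub>E insert b L"
      using K h hL by (auto simp: p PiE_def extensional_def)
    have "{i \<in> P. (if i \<in> K then b else h i) = b} = K" using K hL b by auto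
    then show "({i \<in> P. (case p of (K, h) \<Rightarrow> \<lambda>i. if i \<in> K then b else h i) i = b},
        restrict (case p of (K, h) \<Rightarrow> \<lambda>i. if i \<in> K then b else h i)
          (P - {i \<in> P. (case p of (K, h) \<Rightarrow> \<lambda>i. if i \<in> K then b else h i) i = b})) = p"
      using h by (auto simp: p fun_eq_iff PiE_def extensional_def)
  qed
  also have "\<dots> = (\<Sum>K\<in>Pow P. \<Sum>h\<in>(P - K) \<rightarrow>\<^sub>E L. F (\<lambda>i. if i \<in> K then b else h i))"
    by (rule sum.Sigma[symmetric]) (use P L in \<open>auto intro!: finite_PiE\<close>)
  finally show ?thesis .
qed

text \<open>K is the set of positions of the largest letter, and \<tau> 0 = 0 discards the empty K.
  Without positive letters every position holds 0 or infinity, which gives 2^N.\<close>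

lemma word_weight_eq_size_weight:
  assumes \<tau>: "\<tau> 0 = 0"
  shows "finite P \<Longrightarrow> word_weight \<tau> P m = size_weight \<tau> (card P) m"
proof (induction m arbitrary: P)
  case 0
  have "word_weight \<tau> P 0 = of_nat (card (P \<rightarrow>\<^sub>E {\<infinity>, enat 0}))"
    by (simp add: word_weight_def letter_set_def)
  also have "\<dots> = 2 ^ card P" using 0 by (simp add: card_PiE)
  finally show ?case by simp
next
  case (Suc m)
  have letters: "letter_set (Suc m) = insert (enat (Suc m)) (letter_set m)"
    by (auto simp: letter_set_def atLeastAtMostSuc_conv)
  have new: "enat (Suc m) \<notin> letter_set m" by (auto simp: letter_set_def)
  have "word_weight \<tau> P (Suc m) = (\<Sum>K\<in>Pow P. \<Sum>h\<in>(P - K) \<rightarrow>\<^sub>E letter_set m.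
      \<Prod>k = 1..Suc m. \<tau> (card {i \<in> P. (if i \<in> K then enat (Suc m) else h i) = enat k}))"
    unfolding word_weight_def letters by (rule sum_PiE_insert_letter[OF Suc.prems _ new]) (simp add: letter_set_def)
  also have "\<dots> = (\<Sum>K\<in>Pow P. \<Sum>h\<in>(P - K) \<rightarrow>\<^sub>E letter_set m.
      \<tau> (card K) * (\<Prod>k = 1..m. \<tau> (card {i \<in> P - K. h i = enat k})))"
  proof (intro sum.cong refl)
    fix K h assume K: "K \<in> Pow P" and h: "h \<in> (P - K) \<rightarrow>\<^sub>E letter_set m"
    have "{i \<in> P. (if i \<in> K then enat (Suc m) else h i) = enat (Suc m)} = K"
    proof -
      have "h i \<noteq> enat (Suc m)" if "i \<in> P" "i \<notin> K" for i using PiE_mem[OF h, of i] that new by auto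
      then show ?thesis using K by auto
    qed
    moreover have "(\<Prod>k = 1..m. \<tau> (card {i \<in> P. (if i \<in> K then enat (Suc m) else h i) = enat k})) =
        (\<Prod>k = 1..m. \<tau> (card {i \<in> P - K. h i = enat k}))"
      by (intro prod.cong refl arg_cong[of _ _ \<tau>] arg_cong[of _ _ card]) auto
    ultimately show "(\<Prod>k = 1..Suc m. \<tau> (card {i \<in> P. (if i \<in> K then enat (Suc m) else h i) = enat k})) =
        \<tau> (card K) * (\<Prod>k = 1..m. \<tau> (card {i \<in> P - K. h i = enat k}))"
      by (simp only: prod.nat_ivl_Suc' le_add1 plus_1_eq_Suc)
  qed
  also have "\<dots> = (\<Sum>K\<in>Pow P. \<tau> (card K) * word_weight \<tau> (P - K) m)"
    by (simp add: word_weight_def sum_distrib_left)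
  also have "\<dots> = (\<Sum>K\<in>Pow P. \<tau> (card K) * size_weight \<tau> (card P - card K) m)"
    using Suc.prems by (intro sum.cong refl) (auto simp: Suc.IH card_Diff_subset finite_subset)
  also have "\<dots> = (\<Sum>i\<le>card P. of_nat (card P choose i) * (\<tau> i * size_weight \<tau> (card P - i) m))"
    by (rule sum_Pow_card[OF Suc.prems])
  also have "\<dots> = (\<Sum>i = 1..card P. of_nat (card P choose i) * (\<tau> i * size_weight \<tau> (card P - i) m))"
    by (rule sum.mono_neutral_right) (auto simp: \<tau> not_less_eq_eq)
  finally show ?case by (simp add: mult.assoc)
qed

lemma size_weight_eq_0: "N < m \<Longrightarrow> size_weight \<tau> N m = 0"
proof (induction m arbitrary: N)
  case (Suc m)
  have "size_weight \<tau> (N - i) m = 0" if "i \<in> {1..N}" for i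
    using that Suc.prems by (intro Suc.IH) auto
  then show ?case by simp
qed simp

text \<open>In exponential generating functions the left side is e^(2z) / (1 - T(z)) and A is e^z /
  (1 - T(z)), where T collects the \<tau> i for i \<ge> 1. The missing factor e^z is the binomial
  sum.\<close>

lemma sum_size_weight:
  fixes A :: "nat \<Rightarrow> 'a::comm_ring_1"
  assumes A: "\<And>N. A N = 1 + (\<Sum>i = 1..N. of_nat (N choose i) * \<tau> i * A (N - i))"
  shows "N \<le> M \<Longrightarrow> (\<Sum>m\<le>M. size_weight \<tau> N m) = (\<Sum>k\<le>N. of_nat (N choose k) * A k)"
proof (induction N arbitrary: M rule: less_induct)
  case (less N)
  \<comment> \<open>The added term m = M + 1 is zero because M + 1 > N; after it the shifted
    recursion sums up to M again.\<close>
  have "(\<Sum>m\<le>M. size_weight \<tau> N m) = (\<Sum>m\<le>Suc M. size_weight \<tau> N m)"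
    using less.prems by (simp add: size_weight_eq_0 del: size_weight.simps)
  also have "\<dots> = 2 ^ N + (\<Sum>m\<le>M. \<Sum>i = 1..N. of_nat (N choose i) * \<tau> i * size_weight \<tau> (N - i) m)"
    by (subst sum.atMost_Suc_shift) simp
  also have "\<dots> = 2 ^ N + (\<Sum>i = 1..N. of_nat (N choose i) * \<tau> i * (\<Sum>m\<le>M. size_weight \<tau> (N - i) m))"
    by (subst sum.swap) (simp add: sum_distrib_left)
  also have "\<dots> = 2 ^ N + (\<Sum>i = 1..N. of_nat (N choose i) * \<tau> i * (\<Sum>k\<le>N - i. of_nat ((N - i) choose k) * A k))"
    using less.prems by (auto intro!: arg_cong2[of _ _ _ _ "(+)"] sum.cong simp: less.IH)
  also have "(\<Sum>i = 1..N. of_nat (N choose i) * \<tau> i * (\<Sum>k\<le>N - i. of_nat ((N - i) choose k) * A k)) =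
      (\<Sum>(i, k)\<in>(SIGMA i:{1..N}. {..N - i}). of_nat ((N choose i) * ((N - i) choose k)) * (\<tau> i * A k))"
    by (subst sum.Sigma[symmetric]) (auto simp: sum_distrib_left mult_ac)
  also have "\<dots> = (\<Sum>(k, i)\<in>(SIGMA k:{..N}. {1..k}). of_nat ((N choose k) * (k choose i)) * (\<tau> i * A (k - i)))"
    by (rule sum.reindex_bij_witness[of _ "\<lambda>(k, i). (i, k - i)" "\<lambda>(i, k). (i + k, i)"])
       (auto simp: choose_mult simp del: of_nat_mult)
  also have "\<dots> = (\<Sum>k\<le>N. of_nat (N choose k) * (\<Sum>i = 1..k. of_nat (k choose i) * \<tau> i * A (k - i)))"
    by (subst sum.Sigma[symmetric]) (auto simp: sum_distrib_left mult_ac)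
  also have "2 ^ N = (\<Sum>k\<le>N. of_nat (N choose k) :: 'a)"
    using choose_row_sum[of N] by (metis of_nat_numeral of_nat_power of_nat_sum)
  finally show ?case
    by (subst A) (simp add: distrib_left sum.distrib)
qed

section \<open>The cyclic group\<close>

lemma cycle_of_list_upt:
  "cycle_of_list [a..<Suc (a + m)] x = (if a \<le> x \<and> x < a + m then Suc x else if x = a + m then a else x)"
proof (induction m arbitrary: a)
  case 0
  then show ?case by simp
next
  case (Suc m)
  have 1: "[a..<Suc (a + Suc m)] = a # Suc a # [Suc (Suc a)..<Suc (a + Suc m)]"
    by (simp add: upt_conv_Cons)
  have 2: "[Suc a..<Suc (Suc a + m)] = Suc a # [Suc (Suc a)..<Suc (a + Suc m)]"
    by (simp add: upt_conv_Cons)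
  have "cycle_of_list [a..<Suc (a + Suc m)] x =
      Transposition.transpose a (Suc a) (cycle_of_list [Suc a..<Suc (Suc a + m)] x)"
    unfolding 1 2 by simp
  then show ?case unfolding Suc.IH by (auto simp: Transposition.transpose_def)
qed

lemma long_cycle_eq:
  assumes "n \<ge> 1"
  shows "long_cycle n x = (if x \<in> {1..n} then x mod n + 1 else x)"
  using cycle_of_list_upt[of 1 "n - 1" x] assms by (auto simp: long_cycle_def)

lemma long_cycle_permutes: "long_cycle n permutes {1..n}"
proof -
  have "cycle_of_list [1..<Suc n] permutes set [1..<Suc n]"
    by (rule cycle_permutes)
  moreover have "set [1..<Suc n] = {1..n}" by auto
  ultimately show ?thesis by (simp only: long_cycle_def)
qed

lemma long_cycle_funpow:
  assumes "n \<ge> 1"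
  shows "(long_cycle n ^^ r) x = (if x \<in> {1..n} then (x - 1 + r) mod n + 1 else x)"
proof (induction r)
  case 0
  then show ?case by auto
next
  case (Suc r)
  show ?case
  proof (cases "x \<in> {1..n}")
    case True
    have "(x - 1 + r) mod n < n" using assms by simp
    then have in_range: "(x - 1 + r) mod n + 1 \<in> {1..n}" by auto
    have "(long_cycle n ^^ Suc r) x = long_cycle n ((x - 1 + r) mod n + 1)"
      using True Suc by (simp only: funpow.simps o_apply if_True)
    also have "\<dots> = ((x - 1 + r) mod n + 1) mod n + 1"
      using in_range by (simp only: long_cycle_eq[OF assms] if_True)
    also have "\<dots> = (x - 1 + Suc r) mod n + 1" by (simp add: mod_Suc_eq)
    finally show ?thesis using True by simp
  next
    case False
    then have "(long_cycle n ^^ Suc r) x = long_cycle n x"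
      using Suc by (simp only: funpow.simps o_apply if_False)
    also have "\<dots> = x" using False by (simp only: long_cycle_eq[OF assms] if_False)
    finally show ?thesis using False by (simp only: if_False)
  qed
qed

lemma sym_group_pow: "\<sigma> [^]\<^bsub>sym_group n\<^esub> (r::nat) = \<sigma> ^^ r"
proof -
  interpret group "sym_group n" by (rule sym_group_is_group)
  show ?thesis
    by (induction r) (simp_all add: sym_group_one sym_group_mult funpow_Suc_right del: funpow.simps)
qed

context
  fixes n :: nat
  assumes n: "n \<ge> 1"
begin

interpretation sym: group "sym_group n" by (rule sym_group_is_group)

lemma long_cycle_in_sym: "long_cycle n \<in> carrier (sym_group n)"
  using long_cycle_permutes by (simp only: sym_group_carrier)

lemma cyc_group_pow: "\<sigma> [^]\<^bsub>cyc_group n\<^esub> (r::nat) = \<sigma> ^^ r"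
proof -
  have "\<sigma> [^]\<^bsub>cyc_group n\<^esub> r = \<sigma> [^]\<^bsub>sym_group n\<^esub> r"
    by (simp add: cyc_group_def pow_subgroup_generated)
  then show ?thesis by (simp add: sym_group_pow)
qed

lemma long_cycle_funpow_n: "long_cycle n ^^ n = id"
proof
  fix x
  show "(long_cycle n ^^ n) x = id x" using n by (cases x) (simp_all add: long_cycle_funpow)
qed

lemma carrier_cyc_group: "carrier (cyc_group n) = (\<lambda>r. long_cycle n ^^ r) ` {..<n}"
proof -
  have red: "long_cycle n [^]\<^bsub>sym_group n\<^esub> k = long_cycle n ^^ nat (k mod int n)" for k :: int
  proof -
    have "long_cycle n [^]\<^bsub>sym_group n\<^esub> int n = \<one>\<^bsub>sym_group n\<^esub>"
      by (simp add: int_pow_int sym_group_pow long_cycle_funpow_n sym_group_one)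
    then have "long_cycle n [^]\<^bsub>sym_group n\<^esub> (int n * (k div int n)) = \<one>\<^bsub>sym_group n\<^esub>"
      using sym.int_pow_pow[OF long_cycle_in_sym, of "int n" "k div int n"] by simp
    then have "long_cycle n [^]\<^bsub>sym_group n\<^esub> (int n * (k div int n) + k mod int n) =
        long_cycle n [^]\<^bsub>sym_group n\<^esub> (k mod int n)"
      using long_cycle_in_sym by (simp only: sym.int_pow_mult sym.l_one sym.int_pow_closed)
    then have "long_cycle n [^]\<^bsub>sym_group n\<^esub> k = long_cycle n [^]\<^bsub>sym_group n\<^esub> (k mod int n)"
      by (simp only: mult_div_mod_eq)
    also have "\<dots> = long_cycle n [^]\<^bsub>sym_group n\<^esub> int (nat (k mod int n))" using n by simp
    also have "\<dots> = long_cycle n ^^ nat (k mod int n)" by (simp only: int_pow_int sym_group_pow)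
    finally show ?thesis .
  qed
  have "carrier (cyc_group n) = {long_cycle n [^]\<^bsub>sym_group n\<^esub> (k::int) |k. k \<in> UNIV}"
    using sym.generate_pow[OF long_cycle_in_sym] long_cycle_in_sym
    by (simp add: cyc_group_def carrier_subgroup_generated)
  also have "\<dots> = (\<lambda>r. long_cycle n ^^ r) ` {..<n}"
  proof safe
    fix k :: int
    have "nat (k mod int n) < n" using n by (simp add: nat_less_iff)
    then show "long_cycle n [^]\<^bsub>sym_group n\<^esub> k \<in> (\<lambda>r. long_cycle n ^^ r) ` {..<n}"
      unfolding red by blast
  next
    fix r
    have "long_cycle n ^^ r = long_cycle n [^]\<^bsub>sym_group n\<^esub> int r"
      by (simp only: int_pow_int sym_group_pow)
    then show "\<exists>k. long_cycle n ^^ r = long_cycle n [^]\<^bsub>sym_group n\<^esub> (k::int) \<and> k \<in> UNIV" by blast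
  qed
  finally show ?thesis .
qed

lemma card_cyc_group: "card (carrier (cyc_group n)) = n"
proof -
  have "inj_on (\<lambda>r. long_cycle n ^^ r) {..<n}"
  proof (rule inj_onI)
    fix r r' assume r: "r \<in> {..<n}" "r' \<in> {..<n}" and eq: "long_cycle n ^^ r = long_cycle n ^^ r'"
    from fun_cong[OF eq, of 1] r n show "r = r'" by (simp add: long_cycle_funpow)
  qed
  then show ?thesis by (simp add: carrier_cyc_group card_image)
qed

lemma cyc_group_basics:
  "group (cyc_group n)" "long_cycle n \<in> carrier (cyc_group n)"
  "generate (cyc_group n) {long_cycle n} = carrier (cyc_group n)"
proof -
  show "group (cyc_group n)" by (simp add: cyc_group_def)
  show mem: "long_cycle n \<in> carrier (cyc_group n)"
    using long_cycle_in_sym by (simp add: cyc_group_def carrier_subgroup_generated generate.incl)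
  show "generate (cyc_group n) {long_cycle n} = carrier (cyc_group n)"
  proof -
    have "generate (cyc_group n) (carrier (cyc_group n) \<inter> {long_cycle n}) = carrier (cyc_group n)"
      unfolding carrier_subgroup_generated[symmetric] by (simp add: cyc_group_def)
    with mem show ?thesis by simp
  qed
qed

text \<open>Acting through positions reverses composition, so commutativity of the group is what
  makes the map a homomorphism.\<close>

lemma cyc_group_action:
  assumes act: "\<And>g x. g \<in> carrier (cyc_group n) \<Longrightarrow> x \<in> X \<Longrightarrow> code_act g x \<in> X"
    and ext: "\<And>\<alpha> f. (\<alpha>, f) \<in> X \<Longrightarrow> \<alpha> \<in> extensional {1..n}"
  shows "group_action (cyc_group n) X (\<lambda>g. restrict (code_act g) X)"
proof -
  interpret cyc: group "cyc_group n" by (rule cyc_group_basics)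
  have mult: "g \<otimes>\<^bsub>cyc_group n\<^esub> h = g \<circ> h" for g h
    by (simp add: cyc_group_def sym_group_mult)
  have one: "\<one>\<^bsub>cyc_group n\<^esub> = id"
    by (simp add: cyc_group_def sym_group_one)
  have comm: "g \<circ> h = h \<circ> g" if "g \<in> carrier (cyc_group n)" "h \<in> carrier (cyc_group n)" for g h
    using that by (auto simp: carrier_cyc_group add.commute simp flip: funpow_add)
  have comp: "code_act g (code_act h x) = code_act (h \<circ> g) x" for g h x
    by (cases x) (simp add: code_act_def comp_assoc)
  have id: "code_act id x = x" for x by (cases x) (simp add: code_act_def)
  have inverse: "\<exists>h\<in>carrier (cyc_group n). g \<circ> h = id \<and> h \<circ> g = id" if "g \<in> carrier (cyc_group n)" for g
    using cyc.l_inv[OF that] cyc.r_inv[OF that] cyc.inv_closed[OF that]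
    by (intro bexI[of _ "inv\<^bsub>cyc_group n\<^esub> g"]) (auto simp: mult one)
  have bij: "bij_betw (code_act g) X X" if g: "g \<in> carrier (cyc_group n)" for g
  proof -
    obtain h where "h \<in> carrier (cyc_group n)" "g \<circ> h = id" "h \<circ> g = id" using inverse[OF g] by blast
    with g show ?thesis
      by (intro bij_betw_byWitness[where f' = "code_act h"]) (auto simp: comp id act)
  qed
  have "group_hom (cyc_group n) (BijGroup X) (\<lambda>g. restrict (code_act g) X)"
  proof (intro group_hom.intro group_hom_axioms.intro homI)
    show "group (cyc_group n)" by (rule cyc_group_basics)
    show "group (BijGroup X)" by (rule group_BijGroup)
    show bijc: "restrict (code_act g) X \<in> carrier (BijGroup X)" if "g \<in> carrier (cyc_group n)" for g
      using bij[OF that] by (simp add: BijGroup_def Bij_def)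
    fix g h assume g: "g \<in> carrier (cyc_group n)" and h: "h \<in> carrier (cyc_group n)"
    show "restrict (code_act (g \<otimes>\<^bsub>cyc_group n\<^esub> h)) X =
        restrict (code_act g) X \<otimes>\<^bsub>BijGroup X\<^esub> restrict (code_act h) X"
      using bijc[OF g] bijc[OF h] act[OF h]
      by (auto simp: BijGroup_def mult comm[OF g h] compose_def comp fun_eq_iff)
  qed
  then show ?thesis by (rule group_action.intro)
qed

end

section \<open>Codes fixed by a rotation\<close>

lemma rotation_invariant_iff:
  fixes a :: "nat \<Rightarrow> 'a"
  assumes n: "n \<ge> 1"
  shows "(\<forall>y<n. a ((y + r) mod n) = a y) \<longleftrightarrow> (\<forall>y<n. a y = a (y mod gcd n r))"
\<comment> \<open>Here gcd n 0 = n and both sides hold trivially; \<open>bezout_nat\<close> below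
  requires r to be nonzero.\<close>
proof (cases "r = 0")
  case True
  then show ?thesis by simp
next
  case False
  let ?g = "gcd n r"
  have g: "0 < ?g" using n by simp
  show ?thesis
  proof
    assume inv: "\<forall>y<n. a ((y + r) mod n) = a y"
    define b where "b y = a (y mod n)" for y
    have b_r: "b (y + r * k) = b y" for y k
    proof (induction k)
      case (Suc k)
      have "b (y + r * Suc k) = a (((y + r * k) mod n + r) mod n)"
        by (simp add: b_def mod_add_left_eq mod_add_right_eq algebra_simps)
      also have "\<dots> = b (y + r * k)" using inv n by (simp add: b_def)
      finally show ?case using Suc by simp
    qed simp
    have b_n: "b (y + n * k) = b y" for y k by (simp add: b_def)
    obtain u v where uv: "r * u = n * v + gcd r n" using bezout_nat[OF False, of n] by blast
    have b_g: "b (y + ?g * k) = b y" for y k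
    proof (induction k)
      case (Suc k)
      have "b (y + ?g * Suc k) = b ((y + ?g * k) + ?g + n * v)"
        by (simp only: b_n) (simp add: algebra_simps)
      also have "\<dots> = b ((y + ?g * k) + r * u)"
        by (simp add: uv gcd.commute algebra_simps)
      finally show ?case using Suc by (simp add: b_r)
    qed simp
    show "\<forall>y<n. a y = a (y mod ?g)"
    proof (intro allI impI)
      fix y assume y: "y < n"
      have "y mod ?g < n" using y mod_less_eq_dividend[of y ?g] by linarith
      then have "a (y mod ?g) = b (y mod ?g)" by (simp add: b_def)
      also have "\<dots> = b (y mod ?g + ?g * (y div ?g))" by (simp only: b_g)
      also have "\<dots> = a y" using y by (simp add: b_def)
      finally show "a y = a (y mod ?g)" by simp
    qed
  next
    assume per: "\<forall>y<n. a y = a (y mod ?g)"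
    show "\<forall>y<n. a ((y + r) mod n) = a y"
    proof (intro allI impI)
      fix y assume y: "y < n"
      have "(y + r) mod n < n" using n by simp
      then have "a ((y + r) mod n) = a ((y + r) mod n mod ?g)" using per by blast
      also have "(y + r) mod n mod ?g = (y + r) mod ?g" by (rule mod_mod_cancel) simp
      also have "\<dots> = y mod ?g" by (metis gcd_dvd2 mod_add_right_eq add_0_right dvd_imp_mod_0)
      finally show "a ((y + r) mod n) = a y" using per y by simp
    qed
  qed
qed

lemma card_residues:
  assumes g: "g \<ge> 1"
  shows "card {x \<in> {1..d * g}. P ((x - 1) mod g)} = d * card {i \<in> {..<g}. P i}"
proof -
  have "bij_betw (\<lambda>(c, i). c * g + i + 1) ({..<d} \<times> {i \<in> {..<g}. P i}) {x \<in> {1..d * g}. P ((x - 1) mod g)}"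
  proof (rule bij_betw_byWitness[where f' = "\<lambda>x. ((x - 1) div g, (x - 1) mod g)"])
    show "(\<lambda>(c, i). c * g + i + 1) ` ({..<d} \<times> {i \<in> {..<g}. P i}) \<subseteq> {x \<in> {1..d * g}. P ((x - 1) mod g)}"
    proof (rule subsetI)
      fix x assume "x \<in> (\<lambda>(c, i). c * g + i + 1) ` ({..<d} \<times> {i \<in> {..<g}. P i})"
      then obtain c i where x: "x = c * g + i + 1" and ci: "c < d" "i < g" "P i" by auto
      have "x \<le> Suc c * g" using ci x by simp
      also have "\<dots> \<le> d * g" using ci by (intro mult_right_mono) auto
      finally show "x \<in> {x \<in> {1..d * g}. P ((x - 1) mod g)}" using x ci by simp
    qed
    show "(\<lambda>x. ((x - 1) div g, (x - 1) mod g)) ` {x \<in> {1..d * g}. P ((x - 1) mod g)} \<subseteq> {..<d} \<times> {i \<in> {..<g}. P i}"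
    proof (rule subsetI)
      fix p assume "p \<in> (\<lambda>x. ((x - 1) div g, (x - 1) mod g)) ` {x \<in> {1..d * g}. P ((x - 1) mod g)}"
      then obtain x where p: "p = ((x - 1) div g, (x - 1) mod g)" and x: "x \<in> {1..d * g}" "P ((x - 1) mod g)"
        by blast
      have "(x - 1) div g < d" using x by (intro less_mult_imp_div_less) auto
      with x g show "p \<in> {..<d} \<times> {i \<in> {..<g}. P i}" by (simp add: p)
    qed
  qed (use g in auto)
  then have "card {x \<in> {1..d * g}. P ((x - 1) mod g)} = card ({..<d} \<times> {i \<in> {..<g}. P i})"
    by (rule bij_betw_same_card[symmetric])
  then show ?thesis by (simp add: card_cartesian_product)
qed

definition periodic_codes :: "nat \<Rightarrow> nat \<Rightarrow> ((nat \<Rightarrow> enat) \<times> (nat \<Rightarrow> nat)) set" where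
  "periodic_codes n g = {(\<alpha>, f). is_code n (\<alpha>, f) \<and> (\<forall>y<n. \<alpha> (Suc y) = \<alpha> (Suc (y mod g)))}"

text \<open>
  A code with period \<open>g\<close> is determined by its largest letter, its first \<open>g\<close> letters and the marks.
\<close>

definition code_data :: "nat \<Rightarrow> nat \<Rightarrow> (nat \<times> (nat \<Rightarrow> enat) \<times> (nat \<Rightarrow> nat)) set" where
  "code_data d g = (SIGMA m:{..d * g}. SIGMA h:{..<g} \<rightarrow>\<^sub>E letter_set m.
     PiE {1..m} (\<lambda>k. {1..<d * card {i \<in> {..<g}. h i = enat k}}))"

lemma finite_code_data: "finite (code_data d g)"
  unfolding code_data_def by (intro finite_SigmaI finite_PiE) (auto simp: letter_set_def)

lemma finite_letters:
  fixes \<alpha> :: "nat \<Rightarrow> enat"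
  shows "finite {k. enat k \<in> \<alpha> ` {1..n}}"
proof -
  have "{k. enat k \<in> \<alpha> ` {1..n}} \<subseteq> the_enat ` \<alpha> ` {1..n}"
  proof
    fix k assume "k \<in> {k. enat k \<in> \<alpha> ` {1..n}}"
    then show "k \<in> the_enat ` \<alpha> ` {1..n}" by (intro image_eqI[of _ _ "enat k"]) auto
  qed
  then show ?thesis by (rule finite_subset) simp
qed

lemma letter_le_max_letter:
  assumes "i \<in> {1..n}" "\<alpha> i = enat k"
  shows "k \<le> max_letter n \<alpha>"
proof -
  have "k \<in> {k. enat k \<in> \<alpha> ` {1..n}}" using assms by (auto intro: image_eqI[of _ _ i])
  then show ?thesis unfolding max_letter_def using finite_letters by (intro Max_ge) auto
qed

lemma max_letter_le:
  assumes "is_code n (\<alpha>, f)"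
  shows "max_letter n \<alpha> \<le> n"
proof -
  have "enat ` {1..max_letter n \<alpha>} \<subseteq> \<alpha> ` {1..n}"
  proof safe
    fix k assume "k \<in> {1..max_letter n \<alpha>}"
    then have "card (occs n \<alpha> k) \<noteq> 0" using assms unfolding is_code_iff by fastforce
    then have "occs n \<alpha> k \<noteq> {}" by auto
    then show "enat k \<in> \<alpha> ` {1..n}" unfolding occs_def by force
  qed
  then have "card (enat ` {1..max_letter n \<alpha>}) \<le> card (\<alpha> ` {1..n})" by (intro card_mono) auto
  also have "\<dots> \<le> n" using card_image_le[of "{1..n}" \<alpha>] by simp
  finally show ?thesis by (simp add: card_image inj_on_def)
qed

text \<open>A letter occurring c times admits marks {1..<c}, a nonempty set only for c \<ge> 2. A
  function f in the product set thus forces every letter from 1 to m to occur twice, so that m is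
  indeed the largest letter.\<close>

lemma bij_betw_periodic_codes:
  assumes g: "g \<ge> 1" and d: "d \<ge> 1"
  shows "bij_betw (\<lambda>(m, h, f). (\<lambda>x. if x \<in> {1..d * g} then h ((x - 1) mod g) else undefined, f))
    (code_data d g) (periodic_codes (d * g) g)"
    and "(m, h, f) \<in> code_data d g \<Longrightarrow>
      max_letter (d * g) (\<lambda>x. if x \<in> {1..d * g} then h ((x - 1) mod g) else undefined) = m"
proof -
  let ?n = "d * g"
  define lift where "lift h = (\<lambda>x. if x \<in> {1..d * g} then h ((x - 1) mod g) else undefined)" for h :: "nat \<Rightarrow> enat"
  have gn: "g \<le> ?n" using d by (cases d) auto
  have card_occs: "card (occs ?n (lift h) k) = d * card {i \<in> {..<g}. h i = enat k}" for h k
  proof -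
    have "occs ?n (lift h) k = {x \<in> {1..d * g}. h ((x - 1) mod g) = enat k}"
      by (auto simp: occs_def lift_def)
    then show ?thesis using card_residues[OF g, of d "\<lambda>i. h i = enat k"] by simp
  qed
  have max_lift: "max_letter ?n (lift h) = m" if mem: "(m, h, f) \<in> code_data d g" for m h f
  proof -
    have h: "h \<in> {..<g} \<rightarrow>\<^sub>E letter_set m" and f: "f \<in> PiE {1..m} (\<lambda>k. {1..<d * card {i \<in> {..<g}. h i = enat k}})"
      using mem by (auto simp: code_data_def)
    have upper: "k \<le> m" if k: "enat k \<in> lift h ` {1..?n}" for k
    proof -
      from k obtain x where x: "x \<in> {1..?n}" "enat k = lift h x" by auto
      have "h ((x - 1) mod g) \<in> letter_set m" using h g by (intro PiE_mem[OF h]) simp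
      with x show ?thesis by (auto simp: lift_def letter_set_def)
    qed
    have mem_m: "enat m \<in> lift h ` {1..?n}" if "m \<noteq> 0"
    proof -
      have "f m \<in> {1..<d * card {i \<in> {..<g}. h i = enat m}}" using that by (intro PiE_mem[OF f]) simp
      then have "0 < d * card {i \<in> {..<g}. h i = enat m}" unfolding atLeastLessThan_iff by linarith
      then have "0 < card (occs ?n (lift h) m)" by (simp only: card_occs)
      then have "occs ?n (lift h) m \<noteq> {}" by auto
      then show ?thesis unfolding occs_def by force
    qed
    show ?thesis unfolding max_letter_def
    proof (rule Max_eqI)
      show "finite (insert 0 {k. enat k \<in> lift h ` {1..?n}})" using finite_letters by simp
      show "m \<in> insert 0 {k. enat k \<in> lift h ` {1..?n}}" using mem_m by auto
    qed (use upper in auto)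
  qed
  then show "max_letter (d * g) (\<lambda>x. if x \<in> {1..d * g} then h ((x - 1) mod g) else undefined) = m"
    if "(m, h, f) \<in> code_data d g" using that by (simp add: lift_def)
  have "bij_betw (\<lambda>(m, h, f). (lift h, f)) (code_data d g) (periodic_codes ?n g)"
  proof (rule bij_betw_byWitness[where f' = "\<lambda>(\<alpha>, f). (max_letter ?n \<alpha>, restrict (\<lambda>i. \<alpha> (Suc i)) {..<g}, f)"])
    have lift_Suc: "lift h (Suc i) = h i" if "i < g" for h i
    proof -
      have "i < d * g" using that gn by (rule less_le_trans)
      with that show ?thesis by (simp add: lift_def)
    qed
    show "\<forall>p\<in>code_data d g. (\<lambda>(\<alpha>, f). (max_letter ?n \<alpha>, restrict (\<lambda>i. \<alpha> (Suc i)) {..<g}, f))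
        ((\<lambda>(m, h, f). (lift h, f)) p) = p"
    proof
      fix p assume p: "p \<in> code_data d g"
      obtain m h f where eq: "p = (m, h, f)" by (cases p)
      have "h \<in> extensional {..<g}" using p by (auto simp: eq code_data_def PiE_def)
      then have "restrict (\<lambda>i. lift h (Suc i)) {..<g} = h"
        by (intro extensionalityI[of _ "{..<g}"]) (auto simp: lift_Suc)
      then show "(\<lambda>(\<alpha>, f). (max_letter ?n \<alpha>, restrict (\<lambda>i. \<alpha> (Suc i)) {..<g}, f))
        ((\<lambda>(m, h, f). (lift h, f)) p) = p"
        using max_lift p by (simp add: eq)
    qed
    have restore: "lift (restrict (\<lambda>i. \<alpha> (Suc i)) {..<g}) = \<alpha>" if "(\<alpha>, f) \<in> periodic_codes ?n g" for \<alpha> f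
    proof (rule extensionalityI[of _ "{1..?n}"])
      show "lift (restrict (\<lambda>i. \<alpha> (Suc i)) {..<g}) \<in> extensional {1..?n}"
        by (auto simp: lift_def extensional_def)
      show "\<alpha> \<in> extensional {1..?n}" using that by (auto simp: periodic_codes_def is_code_iff)
      fix x assume x: "x \<in> {1..?n}"
      then have "x - 1 < ?n" by auto
      then have "\<alpha> (Suc (x - 1)) = \<alpha> (Suc ((x - 1) mod g))" using that by (auto simp: periodic_codes_def)
      with x g show "lift (restrict (\<lambda>i. \<alpha> (Suc i)) {..<g}) x = \<alpha> x" by (simp add: lift_def)
    qed
    then show "\<forall>p\<in>periodic_codes ?n g. (\<lambda>(m, h, f). (lift h, f))
        ((\<lambda>(\<alpha>, f). (max_letter ?n \<alpha>, restrict (\<lambda>i. \<alpha> (Suc i)) {..<g}, f)) p) = p"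
      by auto
    show "(\<lambda>(m, h, f). (lift h, f)) ` code_data d g \<subseteq> periodic_codes ?n g"
    proof
      fix p assume "p \<in> (\<lambda>(m, h, f). (lift h, f)) ` code_data d g"
      then obtain m h f where p: "p = (lift h, f)" and mem: "(m, h, f) \<in> code_data d g" by auto
      have f: "f \<in> PiE {1..m} (\<lambda>k. {1..<d * card {i \<in> {..<g}. h i = enat k}})"
        using mem by (auto simp: code_data_def)
      have "2 \<le> d * card {i \<in> {..<g}. h i = enat k} \<and> 1 \<le> f k \<and> f k \<le> d * card {i \<in> {..<g}. h i = enat k} - 1"
        if "k \<in> {1..m}" for k
        using PiE_mem[OF f that] by auto
      moreover have "lift h \<in> extensional {1..?n}" by (auto simp: lift_def extensional_def)
      moreover have "f \<in> extensional {1..m}" using f by (auto simp: PiE_def)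
      moreover have "lift h (Suc y) = lift h (Suc (y mod g))" if "y < ?n" for y
      proof -
        have "y mod g < ?n" using that mod_less_eq_dividend[of y g] by linarith
        with that show ?thesis by (simp add: lift_def)
      qed
      ultimately show "p \<in> periodic_codes ?n g"
        unfolding periodic_codes_def p by (simp only: mem_Collect_eq prod.case is_code_iff max_lift[OF mem] card_occs) blast
    qed
    show "(\<lambda>(\<alpha>, f). (max_letter ?n \<alpha>, restrict (\<lambda>i. \<alpha> (Suc i)) {..<g}, f)) ` periodic_codes ?n g \<subseteq> code_data d g"
    proof
      fix p assume "p \<in> (\<lambda>(\<alpha>, f). (max_letter ?n \<alpha>, restrict (\<lambda>i. \<alpha> (Suc i)) {..<g}, f)) ` periodic_codes ?n g"
      then obtain \<alpha> f where mem: "(\<alpha>, f) \<in> periodic_codes ?n g"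
        and p: "p = (max_letter ?n \<alpha>, restrict (\<lambda>i. \<alpha> (Suc i)) {..<g}, f)" by auto
      define m where "m = max_letter ?n \<alpha>"
      define h where "h = restrict (\<lambda>i. \<alpha> (Suc i)) {..<g}"
      have code: "is_code ?n (\<alpha>, f)" using mem by (auto simp: periodic_codes_def)
      have "m \<le> ?n" unfolding m_def by (rule max_letter_le[OF code])
      moreover have "h \<in> {..<g} \<rightarrow>\<^sub>E letter_set m"
      proof (rule PiE_I)
        fix i assume i: "i \<in> {..<g}"
        then have "i < g" by simp
        then have "i < ?n" using gn by (rule less_le_trans)
        then have "Suc i \<in> {1..?n}" by simp
        then have "\<alpha> (Suc i) \<in> letter_set m"
          using letter_le_max_letter[of "Suc i" ?n \<alpha>] by (cases "\<alpha> (Suc i)") (auto simp: letter_set_def m_def)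
        with i show "h i \<in> letter_set m" by (simp add: h_def)
      qed (simp add: h_def)
      moreover have "f \<in> PiE {1..m} (\<lambda>k. {1..<d * card {i \<in> {..<g}. h i = enat k}})"
      proof (rule PiE_I)
        fix k assume k: "k \<in> {1..m}"
        have "card (occs ?n \<alpha> k) = d * card {i \<in> {..<g}. h i = enat k}"
          using card_occs[of h k] restore[OF mem] by (simp add: h_def)
        moreover have "2 \<le> card (occs ?n \<alpha> k) \<and> 1 \<le> f k \<and> f k \<le> card (occs ?n \<alpha> k) - 1"
          using code k unfolding is_code_iff m_def by blast
        ultimately show "f k \<in> {1..<d * card {i \<in> {..<g}. h i = enat k}}" by auto
      next
        fix k assume "k \<notin> {1..m}"
        moreover have "f \<in> extensional {1..m}" using code unfolding is_code_iff m_def by blast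
        ultimately show "f k = undefined" by (rule extensional_arb[rotated])
      qed
      ultimately show "p \<in> code_data d g" unfolding p code_data_def m_def[symmetric] h_def[symmetric] by blast
    qed
  qed
  then show "bij_betw (\<lambda>(m, h, f). (\<lambda>x. if x \<in> {1..d * g} then h ((x - 1) mod g) else undefined, f))
    (code_data d g) (periodic_codes ?n g)" by (simp add: lift_def)
qed

lemma finite_periodic_codes: "g \<ge> 1 \<Longrightarrow> d \<ge> 1 \<Longrightarrow> finite (periodic_codes (d * g) g)"
  using bij_betw_finite[OF bij_betw_periodic_codes(1)] finite_code_data by blast

text \<open>A letter on i orbits occurs d * i times, and its mark runs over 1 to d * i - 1
  independently of the other marks.\<close>

lemma sum_periodic_codes:
  fixes T :: "'a::comm_ring_1"
  assumes g: "g \<ge> 1" and d: "d \<ge> 1"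
  shows "(\<Sum>(\<alpha>, f)\<in>periodic_codes (d * g) g. T ^ (\<Sum>k = 1..max_letter (d * g) \<alpha>. f k)) =
    (\<Sum>m\<le>d * g. size_weight (\<lambda>i. \<Sum>l = 1..<d * i. T ^ l) g m)"
proof -
  let ?\<tau> = "\<lambda>i. \<Sum>l = 1..<d * i. T ^ l"
  let ?F = "\<lambda>m h. PiE {1..m} (\<lambda>k. {1..<d * card {i \<in> {..<g}. h i = enat k}})"
  have "(\<Sum>(\<alpha>, f)\<in>periodic_codes (d * g) g. T ^ (\<Sum>k = 1..max_letter (d * g) \<alpha>. f k)) =
     (\<Sum>(m, h, f)\<in>code_data d g. T ^ (\<Sum>k = 1..m. f k))"
  proof (subst sum.reindex_bij_betw[OF bij_betw_periodic_codes(1)[OF g d], symmetric], rule sum.cong[OF refl])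
    fix p assume p: "p \<in> code_data d g"
    obtain m h f where eq: "p = (m, h, f)" by (cases p)
    show "(case case p of (m, h, f) \<Rightarrow> (\<lambda>x. if x \<in> {1..d * g} then h ((x - 1) mod g) else undefined, f) of
        (\<alpha>, f) \<Rightarrow> T ^ (\<Sum>k = 1..max_letter (d * g) \<alpha>. f k)) = (case p of (m, h, f) \<Rightarrow> T ^ (\<Sum>k = 1..m. f k))"
      using bij_betw_periodic_codes(2)[OF g d p[unfolded eq]] by (simp only: eq prod.case)
  qed
  also have "\<dots> = (\<Sum>m\<le>d * g. \<Sum>h\<in>{..<g} \<rightarrow>\<^sub>E letter_set m. \<Sum>f\<in>?F m h. T ^ (\<Sum>k = 1..m. f k))"
    unfolding code_data_def
    by (subst sum.Sigma[symmetric]; (subst sum.Sigma[symmetric])?)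
       (auto intro!: finite_PiE sum.cong simp: letter_set_def split_def sum.Sigma)
  also have "\<dots> = (\<Sum>m\<le>d * g. word_weight ?\<tau> {..<g} m)"
    unfolding word_weight_def power_sum by (intro sum.cong refl) (subst prod_sum_PiE, auto)
  also have "\<dots> = (\<Sum>m\<le>d * g. size_weight ?\<tau> g m)"
    by (simp add: word_weight_eq_size_weight)
  finally show ?thesis .
qed

text \<open>The code of infinities alone has an empty sum of marks but index -1; after the shift by
  one it contributes 1 in place of T.\<close>

lemma sum_periodic_codes_index:
  fixes T :: "'a::comm_ring_1"
  assumes g: "g \<ge> 1" and d: "d \<ge> 1"
  shows "(\<Sum>x\<in>periodic_codes (d * g) g. T ^ nat (code_index (d * g) x + 1)) =
    1 + T * ((\<Sum>m\<le>d * g. size_weight (\<lambda>i. \<Sum>l = 1..<d * i. T ^ l) g m) - 1)"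
proof -
  let ?n = "d * g"
  let ?X = "periodic_codes ?n g"
  let ?W = "\<lambda>(\<alpha>, f). T ^ (\<Sum>k = 1..max_letter ?n \<alpha>. f k)"
  define x0 :: "(nat \<Rightarrow> enat) \<times> (nat \<Rightarrow> nat)" where "x0 = (\<lambda>i\<in>{1..?n}. \<infinity>, \<lambda>_. undefined)"
  have max0: "max_letter ?n \<alpha> = 0" if "\<forall>i\<in>{1..?n}. \<alpha> i = \<infinity>" for \<alpha>
  proof -
    have "{k. enat k \<in> \<alpha> ` {1..?n}} = {}" using that by force
    then show ?thesis unfolding max_letter_def by (simp only: Max_singleton)
  qed
  have x0: "x0 \<in> ?X"
  proof -
    have "max_letter ?n (\<lambda>i\<in>{1..?n}. \<infinity>) = 0" by (rule max0) simp
    moreover have "(\<lambda>i\<in>{1..?n}. \<infinity> :: enat) (Suc y) = (\<lambda>i\<in>{1..?n}. \<infinity>) (Suc (y mod g))" if "y < ?n" for y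
    proof -
      have "y mod g < ?n" using that mod_less_eq_dividend[of y g] by linarith
      with that show ?thesis by simp
    qed
    ultimately show ?thesis by (simp add: x0_def periodic_codes_def is_code_iff)
  qed
  have W0: "?W x0 = 1"
    using max0[of "\<lambda>i\<in>{1..?n}. \<infinity>"] by (simp add: x0_def)
  have index: "code_index ?n (\<alpha>, f) = (if (\<alpha>, f) = x0 then -1 else int (\<Sum>k = 1..max_letter ?n \<alpha>. f k))"
    if "(\<alpha>, f) \<in> ?X" for \<alpha> f
  proof (cases "\<forall>i\<in>{1..?n}. \<alpha> i = \<infinity>")
    case True
    have "\<alpha> = (\<lambda>i\<in>{1..?n}. \<infinity>)"
      using that True by (intro extensionalityI[of _ "{1..?n}"]) (auto simp: periodic_codes_def is_code_iff)
    moreover have "f = (\<lambda>_. undefined)"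
      using that max0[OF True] by (auto simp: periodic_codes_def is_code_iff)
    ultimately show ?thesis using True by (simp add: code_index_def x0_def)
  next
    case False
    then have "(\<alpha>, f) \<noteq> x0" by (auto simp: x0_def)
    with False show ?thesis by (simp only: code_index_def prod.case if_False of_nat_sum)
  qed
  have fin: "finite ?X" by (rule finite_periodic_codes[OF g d])
  have "(\<Sum>x\<in>?X. T ^ nat (code_index ?n x + 1)) =
      T ^ nat (code_index ?n x0 + 1) + (\<Sum>x\<in>?X - {x0}. T ^ nat (code_index ?n x + 1))"
    by (rule sum.remove[OF fin x0])
  also have "T ^ nat (code_index ?n x0 + 1) = 1"
    using index[of "fst x0" "snd x0"] x0 by simp
  also have "(\<Sum>x\<in>?X - {x0}. T ^ nat (code_index ?n x + 1)) = (\<Sum>x\<in>?X - {x0}. T * ?W x)"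
  proof (rule sum.cong[OF refl])
    fix x assume x: "x \<in> ?X - {x0}"
    obtain \<alpha> f where eq: "x = (\<alpha>, f)" by (cases x)
    from x index[of \<alpha> f] have "code_index ?n x = int (\<Sum>k = 1..max_letter ?n \<alpha>. f k)" by (simp add: eq)
    then have "nat (code_index ?n x + 1) = Suc (\<Sum>k = 1..max_letter ?n \<alpha>. f k)" by linarith
    then show "T ^ nat (code_index ?n x + 1) = T * ?W x" by (simp add: eq)
  qed
  also have "\<dots> = T * (sum ?W ?X - ?W x0)"
    by (simp add: sum.remove[OF fin x0] flip: sum_distrib_left)
  finally show ?thesis unfolding W0 sum_periodic_codes[OF g d] .
qed

text \<open>T is the variable t, and coefficients of t^j are compared. Separating the code of
  infinities subtracts 1, which cancels the term k = 0 and leaves the sum from k = 1 in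
  \<open>q_bin_eulerian\<close>.\<close>

lemma (in primitive_root) card_periodic_codes:
  assumes N: "N \<ge> 1"
  shows "of_nat (card {x \<in> periodic_codes (d * N) N. code_index (d * N) x = int j - 1}) =
    ev \<zeta> (q_bin_eulerian_coeff (d * N) j)"
proof -
  let ?X = "periodic_codes (d * N) N"
  let ?\<tau> = "\<lambda>i. \<Sum>l = 1..<d * i. monom (1::complex) 1 ^ l"
  have fin: "finite ?X" by (rule finite_periodic_codes[OF N d])
  have "(\<Sum>m\<le>d * N. size_weight ?\<tau> N m) = (\<Sum>k\<le>N. of_nat (N choose k) * eulerian k)"
    by (rule sum_size_weight[OF eulerian_recurrence]) (use d in simp)
  also have "{..N} = insert 0 {1..N}" by auto
  also have "(\<Sum>k\<in>insert 0 {1..N}. of_nat (N choose k) * eulerian k) = 1 + (\<Sum>k = 1..N. of_nat (N choose k) * eulerian k)"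
    using eulerian_recurrence[of 0] by simp
  finally have "(\<Sum>x\<in>?X. monom 1 1 ^ nat (code_index (d * N) x + 1)) = map_poly (ev \<zeta>) (q_bin_eulerian (d * N))"
    unfolding sum_periodic_codes_index[OF N d] map_poly_q_bin_eulerian by simp
  then have "coeff (map_poly (ev \<zeta>) (q_bin_eulerian (d * N))) j =
      (\<Sum>x\<in>?X. if nat (code_index (d * N) x + 1) = j then 1 else 0)"
    by (simp add: monom_power coeff_sum flip: \<open>_ = map_poly _ _\<close>)
  also have "\<dots> = of_nat (card {x \<in> ?X. nat (code_index (d * N) x + 1) = j})"
    using fin by (simp add: sum.If_cases Int_def)
  \<comment> \<open>The truncation by \<open>nat\<close> is harmless, as no index is below
    -1.\<close>
  also have "{x \<in> ?X. nat (code_index (d * N) x + 1) = j} = {x \<in> ?X. code_index (d * N) x = int j - 1}"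
  proof -
    have "-1 \<le> code_index (d * N) x" for x
      by (auto simp: code_index_def split: prod.splits intro!: order_trans[OF _ sum_nonneg])
    then show ?thesis by (auto simp: nat_eq_iff add.commute) (smt (verit))+
  qed
  finally show ?thesis by (simp add: coeff_map_poly ev.zero q_bin_eulerian_coeff_def)
qed

section \<open>The action on codes and the sieving identity\<close>

text \<open>The letters move while f stays. By \<open>is_code_iff\<close> the bounds on f k involve
  only the number of occurrences, which a permutation of positions preserves.\<close>

lemma code_act_ext_codes:
  assumes \<sigma>: "\<sigma> permutes {1..n}" and x: "x \<in> ext_codes n i"
  shows "code_act \<sigma> x \<in> ext_codes n i"
proof -
  obtain \<alpha> f where eq: "x = (\<alpha>, f)" by (cases x)
  have img: "(\<alpha> \<circ> \<sigma>) ` {1..n} = \<alpha> ` {1..n}"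
    by (metis image_comp permutes_image[OF \<sigma>])
  then have max: "max_letter n (\<alpha> \<circ> \<sigma>) = max_letter n \<alpha>" by (simp only: max_letter_def)
  have occs: "card (occs n (\<alpha> \<circ> \<sigma>) k) = card (occs n \<alpha> k)" for k
  proof -
    have "\<sigma> ` occs n (\<alpha> \<circ> \<sigma>) k = occs n \<alpha> k"
    proof safe
      fix y assume "y \<in> occs n (\<alpha> \<circ> \<sigma>) k"
      then show "\<sigma> y \<in> occs n \<alpha> k"
        using permutes_in_image[OF \<sigma>, of y] by (simp add: occs_def del: atLeastAtMost_iff)
    next
      fix y assume y: "y \<in> occs n \<alpha> k"
      then obtain z where "z \<in> {1..n}" "y = \<sigma> z"
        using permutes_image[OF \<sigma>] unfolding occs_def by blast
      with y show "y \<in> \<sigma> ` occs n (\<alpha> \<circ> \<sigma>) k" by (auto simp: occs_def)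
    qed
    then show ?thesis using card_image[OF permutes_inj_on[OF \<sigma>], of "occs n (\<alpha> \<circ> \<sigma>) k"] by simp
  qed
  have "\<alpha> \<circ> \<sigma> \<in> extensional {1..n}" if "\<alpha> \<in> extensional {1..n}"
    using that permutes_not_in[OF \<sigma>] unfolding extensional_def by simp
  then have "is_code n (\<alpha> \<circ> \<sigma>, f)" if "is_code n (\<alpha>, f)"
    using that unfolding is_code_iff max occs by blast
  moreover have "(\<forall>y\<in>{1..n}. (\<alpha> \<circ> \<sigma>) y = \<infinity>) \<longleftrightarrow> (\<forall>y\<in>{1..n}. \<alpha> y = \<infinity>)"
    using img by (metis (no_types, lifting) imageE image_eqI)
  then have "code_index n (\<alpha> \<circ> \<sigma>, f) = code_index n (\<alpha>, f)"
    unfolding code_index_def prod.case max by (simp only:)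
  ultimately show ?thesis using x by (simp add: eq ext_codes_def code_act_def)
qed

lemma fixed_codes_eq:
  assumes n: "n \<ge> 1"
  shows "{x \<in> ext_codes n i. code_act (long_cycle n ^^ r) x = x} =
    {x \<in> periodic_codes n (gcd n r). code_index n x = i}"
proof -
  have "code_act (long_cycle n ^^ r) (\<alpha>, f) = (\<alpha>, f) \<longleftrightarrow> (\<forall>y<n. \<alpha> (Suc y) = \<alpha> (Suc (y mod gcd n r)))" for \<alpha> f
  proof -
    have "code_act (long_cycle n ^^ r) (\<alpha>, f) = (\<alpha>, f) \<longleftrightarrow> (\<forall>x. \<alpha> ((long_cycle n ^^ r) x) = \<alpha> x)"
      by (auto simp: code_act_def fun_eq_iff)
    also have "\<dots> \<longleftrightarrow> (\<forall>x\<in>{1..n}. \<alpha> (Suc ((x - 1 + r) mod n)) = \<alpha> x)"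
      by (auto simp: long_cycle_funpow[OF n])
    also have "\<dots> \<longleftrightarrow> (\<forall>y<n. \<alpha> (Suc ((y + r) mod n)) = \<alpha> (Suc y))"
    proof -
      have "{1..n} = Suc ` {..<n}" by (simp add: image_Suc_lessThan)
      then show ?thesis by (simp add: Ball_def image_iff) auto
    qed
    also have "\<dots> \<longleftrightarrow> (\<forall>y<n. \<alpha> (Suc y) = \<alpha> (Suc (y mod gcd n r)))"
      by (rule rotation_invariant_iff[OF n, of "\<lambda>y. \<alpha> (Suc y)"])
    finally show ?thesis .
  qed
  then show ?thesis by (auto simp: ext_codes_def periodic_codes_def)
qed

text \<open>The k-th power is 1 exactly when n divides r * k; dividing out the gcd leaves a factor
  coprime to n div gcd n r.\<close>

lemma primitive_root_exp:
  assumes n: "n \<ge> 1"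
  shows "primitive_root (exp (2 * complex_of_real pi * \<i> / of_nat n) ^ r) (n div gcd n r)"
proof -
  let ?\<zeta> = "exp (2 * complex_of_real pi * \<i> / of_nat n) ^ r"
  let ?g = "gcd n r"
  have pow: "?\<zeta> ^ k = 1 \<longleftrightarrow> n dvd r * k" for k
  proof -
    have "?\<zeta> ^ k = exp (2 * complex_of_real pi * \<i> * of_nat (r * k) / of_nat n)"
      by (simp add: mult_ac flip: power_mult exp_of_nat_mult)
    then show ?thesis using complex_root_unity_eq_1[OF n, of "r * k"] by (simp only:)
  qed
  have iff: "n dvd r * k \<longleftrightarrow> n div ?g dvd k" for k
  proof -
    have g: "0 < ?g" using n by simp
    have "n dvd r * k \<longleftrightarrow> ?g * (n div ?g) dvd ?g * ((r div ?g) * k)"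
      by (simp flip: mult.assoc)
    also have "\<dots> \<longleftrightarrow> n div ?g dvd (r div ?g) * k" using g by (rule nat_mult_dvd_cancel1)
    also have "\<dots> \<longleftrightarrow> n div ?g dvd k"
      using div_gcd_coprime[of n r] n by (simp add: coprime_dvd_mult_right_iff)
    finally show ?thesis .
  qed
  have d: "n div ?g \<ge> 1" using n by (simp add: div_greater_zero_iff Suc_le_eq gcd_le1_nat)
  show ?thesis
  proof
    show "n div ?g \<ge> 1" by (rule d)
    show "?\<zeta> ^ (n div ?g) = 1" unfolding pow iff by simp
    show "?\<zeta> ^ k \<noteq> 1" if "0 < k" "k < n div ?g" for k
      unfolding pow iff using that by (auto dest: dvd_imp_le)
  qed
qed

theorem theorem6p27:
  fixes n j :: nat
  assumes "n \<ge> 1" and "j \<le> n"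
  shows "cyclic_sieving (ext_codes n (int j - 1)) (cyc_group n) (long_cycle n) code_act
           (q_bin_eulerian_coeff n j)"
  unfolding cyclic_sieving_def Let_def
proof (intro conjI allI)
  note n = assms(1)
  let ?X = "ext_codes n (int j - 1)"
  show "group (cyc_group n)" "long_cycle n \<in> carrier (cyc_group n)"
    "generate (cyc_group n) {long_cycle n} = carrier (cyc_group n)"
    using cyc_group_basics[OF n] by auto
  show "finite (carrier (cyc_group n))" by (simp add: carrier_cyc_group[OF n])
  \<comment> \<open>For g = n and d = 1 periodicity is no restriction.\<close>
  have "?X \<subseteq> periodic_codes (1 * n) n" by (auto simp: ext_codes_def periodic_codes_def)
  then show "finite ?X" using finite_periodic_codes[OF n, of 1] finite_subset by blast
  show "group_action (cyc_group n) ?X (\<lambda>g. restrict (code_act g) ?X)"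
  proof (rule cyc_group_action[OF n])
    fix g x assume "g \<in> carrier (cyc_group n)" "x \<in> ?X"
    then show "code_act g x \<in> ?X"
      by (auto simp: carrier_cyc_group[OF n] intro!: code_act_ext_codes permutes_funpow long_cycle_permutes)
  qed (auto simp: ext_codes_def is_code_iff)
  show "0 \<le> coeff (q_bin_eulerian_coeff n j) i" for i by (rule q_bin_eulerian_coeff_nonneg)
  fix r :: nat
  let ?\<zeta> = "exp (2 * complex_of_real pi * \<i> / of_nat n) ^ r"
  let ?g = "gcd n r"
  \<comment> \<open>The rotation by r has gcd n r orbits of length n div gcd n r, so the order of
    \<zeta> equals the orbit length and N is the number of orbits.\<close>
  interpret primitive_root ?\<zeta> "n div ?g" by (rule primitive_root_exp[OF n])
  have "?g \<ge> 1" using n by (simp add: Suc_le_eq)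
  from card_periodic_codes[OF this, of j]
  show "of_nat (card {x \<in> ?X. code_act (long_cycle n [^]\<^bsub>cyc_group n\<^esub> r) x = x}) =
      poly (map_poly of_int (q_bin_eulerian_coeff n j))
       (exp (2 * complex_of_real pi * \<i> / of_nat (card (carrier (cyc_group n)))) ^ r)"
    by (simp add: cyc_group_pow[OF n] fixed_codes_eq[OF n] card_cyc_group[OF n] ev_def)
qed

end
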